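(* Let $n\ge2$ and let $\sigma=(b_1\ge b_2\ge\cdots)$ be a partition of $n$. The map $\pi:\mathcal{S}_\sigma\longrightarrow\mathbb{A}^{b_1-1}$ which associates to $x$ the coefficients of the family of polynomials $(p_1^x(t),\dots,p_n^x(t))$ is the geometric quotient of $\mathcal{S}_\sigma$ under the action of $\operatorname{SL}(n)$.
   Context: Everything is over $\mathbb{C}$; $\operatorname{SL}(n)$ acts on $\mathfrak{sl}(n)$ by the adjoint action. For $x\in\mathfrak{sl}(n)$ and $1\le i\le n$, $Q_i^x(t)$ is the monic gcd in $\mathbb{C}[t]$ of the $(n+1-i)\times(n+1-i)$ minors of $x-tI_n$, $Q_{n+1}^x:=1$, and $q_i^x:=Q_i^x/Q_{i+1}^x$ (the invariant factors of $x-tI_n$, with $q_{i+1}^x$ dividing $q_i^x$). The sheet $\mathcal{S}_\sigma$ (a sheet being a maximal irreducible subset of $\mathfrak{sl}(n)$ consisting of orbits of a fixed dimension, viewed as a locally closed subvariety) is the set of $x\in\mathfrak{sl}(n)$ such that $\deg q_i^x=b_i$ for all $i$. For $x\in\mathcal{S}_\sigma$ let $p_i^x:=q_i^x/q_{i+1}^x$ for $1\le i\le n$ (with $q_{n+1}^x:=1$); it is monic of degree $b_i-b_{i+1}$ (with $b_{n+1}:=0$). The families $(p_1,\dots,p_n)$ of monic polynomials with $\deg p_i=b_i-b_{i+1}$ are parametrized by their nonleading coefficients by $\mathbb{C}^{b_1}$. Writing $S(p_i)$ for the sum of the roots of $p_i$ counted with multiplicities (given by minus its first nonleading coefficient, and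 $0$ if $p_i=1$), the relation $\sum_{i=1}^n iS(p_i)=0$ defines a linear hyperplane of $\mathbb{C}^{b_1}$, denoted $\mathbb{A}^{b_1-1}$; since $x$ has trace zero, $(p_1^x,\dots,p_n^x)$ lies in $\mathbb{A}^{b_1-1}$. *)

theory Defs
  imports
    "HOL-Analysis.Abstract_Topology"
    "HOL-Algebra.Group_Action"
    "HOL-Computational_Algebra.Field_as_Ring"
    "HOL-Computational_Algebra.Polynomial_Factorial"
    "Jordan_Normal_Form.Determinant"
    "Jordan_Normal_Form.DL_Submatrix"
begin

section \<open>Classical varieties over the complex numbers\<close>

text \<open>
  An affine space is a set of points together with a finite set of coordinate functions that
  identifies the points with the tuples of complex numbers indexed by the coordinates. This makes
  it possible to treat spaces of matrices and spaces of polynomial coefficients alike. Varieties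
  are reduced and are given by their points: they are locally closed subsets of an affine space,
  with the induced Zariski topology and the sheaf of functions that are locally quotients of
  polynomial functions. They are not required to be irreducible.
\<close>

record 'a coord_space =
  points :: "'a set"
  coords :: "('a \<Rightarrow> complex) set"

definition affine_space :: "'a coord_space \<Rightarrow> bool" where
  "affine_space A \<longleftrightarrow> finite (coords A) \<and>
     bij_betw (\<lambda>x. restrict (\<lambda>f. f x) (coords A)) (points A) (coords A \<rightarrow>\<^sub>E UNIV)"

inductive_set polynomial_functions :: "'a coord_space \<Rightarrow> ('a \<Rightarrow> complex) set"
  for A :: "'a coord_space" where
  const: "(\<lambda>_. c) \<in> polynomial_functions A"
| coord: "f \<in> coords A \<Longrightarrow> f \<in> polynomial_functions A"
| add: "f \<in> polynomial_functions A \<Longrightarrow> g \<in> polynomial_functions A \<Longrightarrow>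
          (\<lambda>x. f x + g x) \<in> polynomial_functions A"
| mult: "f \<in> polynomial_functions A \<Longrightarrow> g \<in> polynomial_functions A \<Longrightarrow>
          (\<lambda>x. f x * g x) \<in> polynomial_functions A"

definition zariski_open :: "'a coord_space \<Rightarrow> 'a set \<Rightarrow> bool" where
  "zariski_open A U \<longleftrightarrow>
     (\<exists>F \<subseteq> polynomial_functions A. U = points A - {x. \<forall>f\<in>F. f x = 0})"

definition zariski :: "'a coord_space \<Rightarrow> 'a topology" where
  "zariski A = topology (zariski_open A)"

lemma istopology_zariski_open: "istopology (zariski_open A)"
proof -
  have "zariski_open A (S \<inter> T)" if S: "zariski_open A S" and T: "zariski_open A T" for S T
  proof -
    obtain F where F: "F \<subseteq> polynomial_functions A" "S = points A - {x. \<forall>f\<in>F. f x = 0}"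
      using S by (auto simp: zariski_open_def)
    obtain G where G: "G \<subseteq> polynomial_functions A" "T = points A - {x. \<forall>f\<in>G. f x = 0}"
      using T by (auto simp: zariski_open_def)
    let ?H = "(\<lambda>(f, g) x. f x * g x) ` (F \<times> G)"
    have "?H \<subseteq> polynomial_functions A"
    proof clarsimp
      fix f g assume "f \<in> F" "g \<in> G"
      then show "(\<lambda>x. f x * g x) \<in> polynomial_functions A"
        using F(1) G(1) by (intro polynomial_functions.mult) blast+
    qed
    moreover have "S \<inter> T = points A - {x. \<forall>f\<in>?H. f x = 0}"
    proof (rule Set.set_eqI)
      fix x
      have "(\<exists>h\<in>?H. h x \<noteq> 0) \<longleftrightarrow> (\<exists>f\<in>F. f x \<noteq> 0) \<and> (\<exists>g\<in>G. g x \<noteq> 0)"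
        by simp
      moreover have "x \<in> S \<inter> T \<longleftrightarrow>
          x \<in> points A \<and> (\<exists>f\<in>F. f x \<noteq> 0) \<and> (\<exists>g\<in>G. g x \<noteq> 0)"
        by (auto simp: F(2) G(2))
      ultimately show "x \<in> S \<inter> T \<longleftrightarrow> x \<in> points A - {x. \<forall>f\<in>?H. f x = 0}"
        by (simp only: Diff_iff mem_Collect_eq ball_simps(10) not_not)
    qed
    ultimately show ?thesis unfolding zariski_open_def by blast
  qed
  moreover have "zariski_open A (\<Union>K)" if K: "\<forall>S\<in>K. zariski_open A S" for K
  proof -
    let ?F = "{f \<in> polynomial_functions A. \<forall>x\<in>points A. f x \<noteq> 0 \<longrightarrow> x \<in> \<Union>K}"
    have "x \<in> points A - {x. \<forall>f\<in>?F. f x = 0}" if x: "x \<in> \<Union>K" for x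
    proof -
      from x obtain S where S: "S \<in> K" "x \<in> S" by blast
      with K obtain F where F: "F \<subseteq> polynomial_functions A"
        and eq: "S = points A - {x. \<forall>f\<in>F. f x = 0}"
        unfolding zariski_open_def by blast
      from S(2) eq obtain f where f: "f \<in> F" "f x \<noteq> 0" "x \<in> points A" by blast
      have "y \<in> S" if "y \<in> points A" "f y \<noteq> 0" for y
        unfolding eq using that f(1) by blast
      then have "f \<in> ?F" using f(1) F S(1) by blast
      with f(2,3) show ?thesis by blast
    qed
    then have "\<Union>K = points A - {x. \<forall>f\<in>?F. f x = 0}" by blast
    then show ?thesis unfolding zariski_open_def
      by (intro exI[of _ ?F] conjI) (rule Collect_restrict)
  qed
  ultimately show ?thesis unfolding istopology_def by blast
qed

lemma openin_zariski: "openin (zariski A) = zariski_open A"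
  by (simp add: zariski_def istopology_zariski_open)

lemma topspace_zariski: "topspace (zariski A) = points A"
proof -
  have "zariski_open A (points A)"
    unfolding zariski_open_def
    by (rule exI[of _ "{\<lambda>_. 1}"]) (auto intro: polynomial_functions.const)
  then show ?thesis
    by (auto simp: topspace_def openin_zariski zariski_open_def)
qed

definition variety :: "'a coord_space \<Rightarrow> 'a set \<Rightarrow> bool" where
  "variety A X \<longleftrightarrow> affine_space A \<and>
     (\<exists>U C. openin (zariski A) U \<and> closedin (zariski A) C \<and> X = U \<inter> C)"

definition regular_on :: "'a coord_space \<Rightarrow> 'a set \<Rightarrow> ('a \<Rightarrow> complex) \<Rightarrow> bool" where
  "regular_on A X f \<longleftrightarrow>
     (\<forall>x\<in>X. \<exists>U. openin (subtopology (zariski A) X) U \<and> x \<in> U \<and>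
        (\<exists>g\<in>polynomial_functions A. \<exists>h\<in>polynomial_functions A.
           \<forall>y\<in>U. h y \<noteq> 0 \<and> f y = g y / h y))"

definition variety_morphism ::
  "'a coord_space \<Rightarrow> 'a set \<Rightarrow> 'b coord_space \<Rightarrow> 'b set \<Rightarrow> ('a \<Rightarrow> 'b) \<Rightarrow> bool" where
  "variety_morphism A X B Y \<phi> \<longleftrightarrow>
     continuous_map (subtopology (zariski A) X) (subtopology (zariski B) Y) \<phi> \<and>
     (\<forall>V f. openin (subtopology (zariski B) Y) V \<and> regular_on B V f \<longrightarrow>
        regular_on A {x \<in> X. \<phi> x \<in> V} (f \<circ> \<phi>))"

section \<open>Geometric quotients\<close>

text \<open>
  Mumford's conditions, on points: \<open>\<phi>\<close> is a morphism whose fibres are exactly the orbits, it is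
  surjective and submersive (both are part of the notion of a quotient map), and the regular
  functions on an open set of the target are the invariant regular functions on its preimage.
  The algebraic structure of the acting group does not enter into these conditions. The action
  maps are extensional functions on \<open>X\<close>, as \<^const>\<open>group_action\<close> demands.
\<close>

definition geometric_quotient ::
  "('g, 'm) monoid_scheme \<Rightarrow> ('g \<Rightarrow> 'a \<Rightarrow> 'a) \<Rightarrow>
   'a coord_space \<Rightarrow> 'a set \<Rightarrow> 'b coord_space \<Rightarrow> 'b set \<Rightarrow> ('a \<Rightarrow> 'b) \<Rightarrow> bool" where
  "geometric_quotient G act A X B Y \<phi> \<longleftrightarrow>
     variety A X \<and> variety B Y \<and> group_action G X act \<and>
     variety_morphism A X B Y \<phi> \<and>
     (\<forall>x\<in>X. {y \<in> X. \<phi> y = \<phi> x} = orbit G act x) \<and>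
     quotient_map (subtopology (zariski A) X) (subtopology (zariski B) Y) \<phi> \<and>
     (\<forall>V f. openin (subtopology (zariski B) Y) V \<longrightarrow>
        (regular_on A {x \<in> X. \<phi> x \<in> V} f \<and>
         (\<forall>g\<in>carrier G. \<forall>x\<in>{x \<in> X. \<phi> x \<in> V}. f (act g x) = f x)) \<longleftrightarrow>
        (\<exists>h. regular_on B V h \<and> (\<forall>x\<in>{x \<in> X. \<phi> x \<in> V}. f x = h (\<phi> x))))"

section \<open>Matrices, and the adjoint action of the special linear group\<close>

definition matrix_space :: "nat \<Rightarrow> complex mat coord_space" where
  "matrix_space n = \<lparr>points = carrier_mat n n,
     coords = {\<lambda>x. x $$ (i, j) | i j. i < n \<and> j < n}\<rparr>"

definition sl :: "nat \<Rightarrow> complex mat set" where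
  "sl n = {x \<in> carrier_mat n n. (\<Sum>i<n. x $$ (i, i)) = 0}"

definition SL :: "nat \<Rightarrow> complex mat monoid" where
  "SL n = \<lparr>carrier = {g \<in> carrier_mat n n. det g = 1}, monoid.mult = (*), one = 1\<^sub>m n\<rparr>"

definition adjoint_action :: "nat \<Rightarrow> complex mat set \<Rightarrow> complex mat \<Rightarrow> complex mat \<Rightarrow> complex mat" where
  "adjoint_action n X g = restrict (\<lambda>x. g * x * inv\<^bsub>SL n\<^esub> g) X"

section \<open>Invariant factors and sheets\<close>

definition shifted_matrix :: "nat \<Rightarrow> complex mat \<Rightarrow> complex poly mat" where
  "shifted_matrix n x = map_mat (\<lambda>c. [:c:]) x - [:0, 1:] \<cdot>\<^sub>m 1\<^sub>m n"

definition minors :: "nat \<Rightarrow> nat \<Rightarrow> 'a :: comm_ring_1 mat \<Rightarrow> 'a set" where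
  "minors n k M = {det (submatrix M I J) | I J.
     I \<subseteq> {..<n} \<and> J \<subseteq> {..<n} \<and> card I = k \<and> card J = k}"

text \<open>\<^const>\<open>Gcd\<close> of complex polynomials is normalized, hence the monic gcd.\<close>

lemma lead_coeff_Gcd_complex_poly:
  fixes P :: "complex poly set"
  assumes "p \<in> P" "p \<noteq> 0"
  shows "lead_coeff (Gcd P) = 1"
proof -
  have "Gcd P \<noteq> 0" using assms by auto
  then have "unit_factor (Gcd P) = 1" by (simp add: unit_factor_Gcd)
  then show ?thesis
    by (simp add: unit_factor_poly_def one_pCons)
qed

definition minor_gcd :: "nat \<Rightarrow> complex mat \<Rightarrow> nat \<Rightarrow> complex poly" where
  "minor_gcd n x i = (if i \<le> n then Gcd (minors n (n + 1 - i) (shifted_matrix n x)) else 1)"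

definition inv_factor :: "nat \<Rightarrow> complex mat \<Rightarrow> nat \<Rightarrow> complex poly" where
  "inv_factor n x i = (if i \<le> n then minor_gcd n x i div minor_gcd n x (i + 1) else 1)"

definition inv_factor_ratio :: "nat \<Rightarrow> complex mat \<Rightarrow> nat \<Rightarrow> complex poly" where
  "inv_factor_ratio n x i = inv_factor n x i div inv_factor n x (i + 1)"

text \<open>Partitions are sequences indexed from 1; the value at 0 is irrelevant.\<close>

definition is_partition :: "nat \<Rightarrow> (nat \<Rightarrow> nat) \<Rightarrow> bool" where
  "is_partition n b \<longleftrightarrow>
     (\<forall>i\<ge>1. b (i + 1) \<le> b i) \<and> (\<forall>i>n. b i = 0) \<and> (\<Sum>i=1..n. b i) = n"

definition sheet :: "nat \<Rightarrow> (nat \<Rightarrow> nat) \<Rightarrow> complex mat set" where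
  "sheet n b = {x \<in> sl n. \<forall>i\<in>{1..n}. degree (inv_factor n x i) = b i}"

section \<open>Families of monic polynomials\<close>

text \<open>
  The point \<open>c\<close> of \<open>family_space n b\<close> stands for the family of monic polynomials in which the
  \<open>i\<close>-th one has degree \<open>b i - b (i + 1)\<close> and coefficient \<open>c (i, j)\<close> at the \<open>j\<close>-th power of the
  variable. For a partition \<open>b\<close> of \<open>n\<close> there are \<open>b 1\<close> coordinates.
\<close>

definition family_index :: "nat \<Rightarrow> (nat \<Rightarrow> nat) \<Rightarrow> (nat \<times> nat) set" where
  "family_index n b = {(i, j). i \<in> {1..n} \<and> j < b i - b (i + 1)}"

definition family_space :: "nat \<Rightarrow> (nat \<Rightarrow> nat) \<Rightarrow> (nat \<times> nat \<Rightarrow> complex) coord_space" where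
  "family_space n b = \<lparr>points = family_index n b \<rightarrow>\<^sub>E UNIV,
     coords = {\<lambda>c. c k | k. k \<in> family_index n b}\<rparr>"

definition family_poly :: "(nat \<Rightarrow> nat) \<Rightarrow> (nat \<times> nat \<Rightarrow> complex) \<Rightarrow> nat \<Rightarrow> complex poly" where
  "family_poly b c i =
     monom 1 (b i - b (i + 1)) + (\<Sum>j < b i - b (i + 1). monom (c (i, j)) j)"

definition root_sum :: "complex poly \<Rightarrow> complex" where
  "root_sum f = (\<Sum>z | poly f z = 0. of_nat (order z f) * z)"

definition trace_zero_families :: "nat \<Rightarrow> (nat \<Rightarrow> nat) \<Rightarrow> (nat \<times> nat \<Rightarrow> complex) set" where
  "trace_zero_families n b = {c \<in> points (family_space n b).
     (\<Sum>i=1..n. of_nat i * root_sum (family_poly b c i)) = 0}"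

definition sheet_quotient :: "nat \<Rightarrow> (nat \<Rightarrow> nat) \<Rightarrow> complex mat \<Rightarrow> (nat \<times> nat \<Rightarrow> complex)" where
  "sheet_quotient n b x = restrict (\<lambda>(i, j). coeff (inv_factor_ratio n x i) j) (family_index n b)"

lemma affine_space_indexed:
  assumes fin: "finite I" and C: "coords A = e ` I" and inj: "inj_on e I"
    and bij: "bij_betw (\<lambda>x. restrict (\<lambda>k. e k x) I) (points A) (I \<rightarrow>\<^sub>E UNIV)"
  shows "affine_space A"
proof -
  let ?r = "\<lambda>u. restrict (\<lambda>f. u (the_inv_into I e f)) (e ` I)"
  have r: "bij_betw ?r (I \<rightarrow>\<^sub>E UNIV) (e ` I \<rightarrow>\<^sub>E (UNIV :: complex set))"
    by (rule bij_betw_byWitness[where f' = "\<lambda>v. restrict (\<lambda>k. v (e k)) I"])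
       (auto simp: fun_eq_iff restrict_def PiE_def extensional_def the_inv_into_f_f[OF inj])
  have "restrict (\<lambda>f. f x) (coords A) = ?r (restrict (\<lambda>k. e k x) I)" for x
    by (auto simp: C fun_eq_iff the_inv_into_f_f[OF inj])
  then have "(\<lambda>x. restrict (\<lambda>f. f x) (coords A)) = ?r \<circ> (\<lambda>x. restrict (\<lambda>k. e k x) I)"
    by (simp add: fun_eq_iff)
  then show ?thesis
    using bij_betw_trans[OF bij r] fin by (simp add: affine_space_def C)
qed

lemma affine_space_matrix_space: "affine_space (matrix_space n)"
proof (rule affine_space_indexed[where I = "{..<n} \<times> {..<n}" and e = "\<lambda>k x. x $$ k"])
  show "inj_on (\<lambda>k x. x $$ k :: complex) ({..<n} \<times> {..<n})"
  proof (rule inj_onI)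
    fix k l assume "k \<in> {..<n} \<times> {..<n}" "l \<in> {..<n} \<times> {..<n}"
      and eq: "(\<lambda>x. x $$ k :: complex) = (\<lambda>x. x $$ l)"
    then show "k = l"
      using fun_cong[OF eq, of "mat n n (\<lambda>m. if m = k then 1 else 0)"]
      by (auto split: if_splits)
  qed
  show "bij_betw (\<lambda>x. restrict (\<lambda>k. x $$ k) ({..<n} \<times> {..<n})) (points (matrix_space n))
          ({..<n} \<times> {..<n} \<rightarrow>\<^sub>E UNIV)"
    by (rule bij_betw_byWitness[where f' = "mat n n"])
       (auto simp: matrix_space_def fun_eq_iff restrict_def PiE_def extensional_def)
qed (auto simp: matrix_space_def)

lemma affine_space_family_space: "affine_space (family_space n b)"
proof (rule affine_space_indexed[where I = "family_index n b" and e = "\<lambda>k c. c k"])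
  have "family_index n b = (SIGMA i:{1..n}. {..<b i - b (i + 1)})"
    by (auto simp: family_index_def)
  then show "finite (family_index n b)" by simp
  show "inj_on (\<lambda>k c. c k :: complex) (family_index n b)"
  proof (rule inj_onI)
    fix k l :: "nat \<times> nat"
    assume eq: "(\<lambda>c. c k :: complex) = (\<lambda>c. c l)"
    show "k = l"
      using fun_cong[OF eq, of "\<lambda>m. if m = k then 1 else 0"] by (auto split: if_splits)
  qed
  show "bij_betw (\<lambda>c. restrict (\<lambda>k. c k) (family_index n b)) (points (family_space n b))
          (family_index n b \<rightarrow>\<^sub>E UNIV)"
    by (rule bij_betw_byWitness[where f' = id])
       (auto simp: family_space_def fun_eq_iff restrict_def PiE_def extensional_def)
qed (auto simp: family_space_def)

end

theory Submission
  imports Defs "Jordan_Normal_Form.Char_Poly"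
begin

text \<open>
  The quotient map has a polynomial section \<open>s\<close>: send a family \<open>(p\<^sub>1, \<dots>, p\<^sub>n)\<close> to the block diagonal
  matrix of the companion matrices of \<open>q\<^sub>i = p\<^sub>i p\<^sub>i\<^sub>+\<^sub>1 \<dots> p\<^sub>n\<close>. Over \<open>\<complex>[t]\<close> both \<open>x - t\<close> and
  \<open>s (\<pi> x) - t\<close> are equivalent to the Smith form with the invariant factors of \<open>x\<close>, so \<open>x\<close> and
  \<open>s (\<pi> x)\<close> are similar. Hence the fibres of \<open>\<pi>\<close> are the orbits, comparing traces shows that \<open>\<pi>\<close> and
  \<open>s\<close> respect the trace conditions, and pulling back along \<open>s\<close> yields the quotient topology and the
  description of the invariant functions. It remains to see that the sheet is locally closed and
  that \<open>\<pi>\<close> is regular: by a determinantal elimination the degree of the gcd of the minors of \<open>x - t\<close> is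
  upper semicontinuous, and where it is constant the coefficients of the gcd are locally quotients
  of polynomials in \<open>x\<close>.
\<close>

section \<open>Regular functions and morphisms\<close>

text \<open>The obstacle is that the gcd of the minors of \<open>x - t\<close> is not polynomial in
  \<open>x\<close>. A Bezout combination that equals the gcd at a base point keeps its coefficients
  when \<open>x\<close> moves, but nearby it is only a multiple of the gcd, possibly of larger
  degree. It has to be reduced against \<open>det (x - t)\<close>, which is a multiple of the gcd of
  degree \<open>n\<close> at every \<open>x\<close>. Ordinary division does not achieve this,
  because the higher coefficients of the combination vanish at the base point; an adjugate matrix
  solves the linear system with coefficients polynomial in \<open>x\<close>. On the sheet the result
  is a scalar multiple of the gcd. The weights \<open>i\<close> in the trace condition arise because
  \<open>p_i\<close> is a factor of each of \<open>q_1\<close>, ..., \<open>q_i\<close>. The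
  \<open>n\<close> companion blocks have the sizes \<open>b_1\<close>, ..., \<open>b_n\<close>, some
  of them possibly zero, and so fill a matrix of size \<open>n\<close>. Equal invariant factors give
  conjugacy under all invertible matrices; an \<open>n\<close>-th root of the determinant brings it
  into \<open>SL n\<close>.\<close>

lemma polynomial_functions_sum:
  assumes "\<And>i. i \<in> I \<Longrightarrow> f i \<in> polynomial_functions A"
  shows "(\<lambda>x. \<Sum>i\<in>I. f i x) \<in> polynomial_functions A"
  using assms
  by (induction I rule: infinite_finite_induct)
     (auto intro!: polynomial_functions.const polynomial_functions.add)

lemma openin_zariski_nonzero:
  assumes "f \<in> polynomial_functions A"
  shows "openin (zariski A) {x \<in> points A. f x \<noteq> 0}"
  unfolding openin_zariski zariski_open_def
  by (rule exI[of _ "{f}"]) (use assms in auto)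

lemma closedin_zariski_zero:
  assumes "f \<in> polynomial_functions A"
  shows "closedin (zariski A) {x \<in> points A. f x = 0}"
proof -
  have "points A - {x \<in> points A. f x = 0} = {x \<in> points A. f x \<noteq> 0}" by auto
  then show ?thesis
    unfolding closedin_def using openin_zariski_nonzero[OF assms]
    by (auto simp: topspace_zariski)
qed

lemma openin_subtopology_nonzero:
  assumes "X \<subseteq> points A" "f \<in> polynomial_functions A"
  shows "openin (subtopology (zariski A) X) {x \<in> X. f x \<noteq> 0}"
  unfolding openin_subtopology
  by (rule exI[of _ "{x \<in> points A. f x \<noteq> 0}"]) (use assms openin_zariski_nonzero in auto)

lemma openin_subtopology_zariskiE:
  assumes "openin (subtopology (zariski A) X) U" "x \<in> U"
  obtains u where "u \<in> polynomial_functions A" "u x \<noteq> 0" "\<And>y. y \<in> X \<Longrightarrow> y \<in> points A \<Longrightarrow> u y \<noteq> 0 \<Longrightarrow> y \<in> U"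
proof -
  obtain T where T: "zariski_open A T" "U = T \<inter> X"
    using assms(1) unfolding openin_subtopology openin_zariski by auto
  obtain F where F: "F \<subseteq> polynomial_functions A" "T = points A - {x. \<forall>f\<in>F. f x = 0}"
    using T(1) unfolding zariski_open_def by auto
  obtain f where "f \<in> F" "f x \<noteq> 0" using assms(2) F T(2) by auto
  then show ?thesis using F T(2) that[of f] by auto
qed

text \<open>The neighbourhood in the definition shrinks to the nonvanishing locus of a polynomial
  \<open>u\<close>. Replacing \<open>g / h\<close> by \<open>g u / (h u)\<close> lets the
  denominator carry the neighbourhood, so that later arguments handle functions instead of open
  sets.\<close>

lemma regular_on_iff:
  assumes X: "X \<subseteq> points A"
  shows "regular_on A X f \<longleftrightarrow>
    (\<forall>x\<in>X. \<exists>g\<in>polynomial_functions A. \<exists>h\<in>polynomial_functions A.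
       h x \<noteq> 0 \<and> (\<forall>y\<in>X. h y \<noteq> 0 \<longrightarrow> f y = g y / h y))" (is "_ \<longleftrightarrow> (\<forall>x\<in>X. ?P x)")
proof
  assume r: "regular_on A X f"
  show "\<forall>x\<in>X. ?P x"
  proof
    fix x assume x: "x \<in> X"
    obtain U g h where U: "openin (subtopology (zariski A) X) U" "x \<in> U"
      and gh: "g \<in> polynomial_functions A" "h \<in> polynomial_functions A"
      and eq: "\<And>y. y \<in> U \<Longrightarrow> h y \<noteq> 0 \<and> f y = g y / h y"
      using r x unfolding regular_on_def by metis
    obtain u where u: "u \<in> polynomial_functions A" "u x \<noteq> 0"
      "\<And>y. y \<in> X \<Longrightarrow> y \<in> points A \<Longrightarrow> u y \<noteq> 0 \<Longrightarrow> y \<in> U"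
      using openin_subtopology_zariskiE[OF U] by metis
    have "f y = g y * u y / (h y * u y)" if "y \<in> X" "h y * u y \<noteq> 0" for y
      using u(3)[of y] eq[of y] that X by auto
    then show "?P x"
      using u(1,2) gh eq[OF U(2)]
      by (intro bexI[of _ "\<lambda>y. g y * u y"] bexI[of _ "\<lambda>y. h y * u y"])
         (auto intro!: polynomial_functions.mult)
  qed
next
  assume r: "\<forall>x\<in>X. ?P x"
  show "regular_on A X f"
    unfolding regular_on_def
  proof
    fix x assume x: "x \<in> X"
    then obtain g h where gh: "g \<in> polynomial_functions A" "h \<in> polynomial_functions A"
      "h x \<noteq> 0" "\<And>y. y \<in> X \<Longrightarrow> h y \<noteq> 0 \<Longrightarrow> f y = g y / h y"
      using r by metis
    show "\<exists>U. openin (subtopology (zariski A) X) U \<and> x \<in> U \<and>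
        (\<exists>g\<in>polynomial_functions A. \<exists>h\<in>polynomial_functions A.
           \<forall>y\<in>U. h y \<noteq> 0 \<and> f y = g y / h y)"
      by (intro exI[of _ "{y \<in> X. h y \<noteq> 0}"] conjI openin_subtopology_nonzero X gh(2)
            bexI[of _ g] bexI[of _ h]) (use gh x in auto)
  qed
qed

lemma regular_onD:
  assumes "regular_on A X f" "X \<subseteq> points A" "x \<in> X"
  obtains g h where "g \<in> polynomial_functions A" "h \<in> polynomial_functions A"
    "h x \<noteq> 0" "\<And>y. y \<in> X \<Longrightarrow> h y \<noteq> 0 \<Longrightarrow> f y = g y / h y"
  using assms(1) regular_on_iff[OF assms(2)] assms(3) by metis

lemma regular_onI:
  assumes "X \<subseteq> points A"
    "\<And>x. x \<in> X \<Longrightarrow> \<exists>g h. g \<in> polynomial_functions A \<and> h \<in> polynomial_functions A \<and>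
       h x \<noteq> 0 \<and> (\<forall>y\<in>X. h y \<noteq> 0 \<longrightarrow> f y = g y / h y)"
  shows "regular_on A X f"
  using assms(2) unfolding regular_on_iff[OF assms(1)] by blast

lemma regular_on_subset:
  assumes f: "regular_on A X f" and X: "X \<subseteq> points A" and UX: "U \<subseteq> X"
  shows "regular_on A U f"
proof (rule regular_onI)
  show "U \<subseteq> points A" using X UX by auto
  fix x assume "x \<in> U"
  then have "x \<in> X" using UX by auto
  then obtain g h where "g \<in> polynomial_functions A" "h \<in> polynomial_functions A"
    "h x \<noteq> 0" "\<And>y. y \<in> X \<Longrightarrow> h y \<noteq> 0 \<Longrightarrow> f y = g y / h y"
    using regular_onD[OF f X] by metis
  with UX show "\<exists>g h. g \<in> polynomial_functions A \<and> h \<in> polynomial_functions A \<and>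
       h x \<noteq> 0 \<and> (\<forall>y\<in>U. h y \<noteq> 0 \<longrightarrow> f y = g y / h y)"
    by (intro exI[of _ g] exI[of _ h]) auto
qed

lemma regular_on_cong:
  assumes X: "X \<subseteq> points A" and f: "regular_on A X f" and eq: "\<And>x. x \<in> X \<Longrightarrow> f x = g x"
  shows "regular_on A X g"
proof (rule regular_onI[OF X])
  fix x assume x: "x \<in> X"
  obtain a h where "a \<in> polynomial_functions A" "h \<in> polynomial_functions A"
    "h x \<noteq> 0" "\<And>y. y \<in> X \<Longrightarrow> h y \<noteq> 0 \<Longrightarrow> f y = a y / h y"
    using regular_onD[OF f X x] by metis
  then show "\<exists>a h. a \<in> polynomial_functions A \<and> h \<in> polynomial_functions A \<and>
       h x \<noteq> 0 \<and> (\<forall>y\<in>X. h y \<noteq> 0 \<longrightarrow> g y = a y / h y)"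
    using eq by (intro exI[of _ a] exI[of _ h]) simp
qed

lemma regular_on_polynomial:
  assumes "X \<subseteq> points A" "f \<in> polynomial_functions A"
  shows "regular_on A X f"
  using assms(2) polynomial_functions.const[of 1 A]
  by (intro regular_onI[OF assms(1)]) (rule exI[of _ f], rule exI[of _ "\<lambda>_. 1"], auto)

lemma regular_on_const:
  assumes "X \<subseteq> points A" shows "regular_on A X (\<lambda>_. c)"
  by (rule regular_on_polynomial[OF assms polynomial_functions.const])

lemma regular_on_add:
  assumes X: "X \<subseteq> points A" and f: "regular_on A X f" and g: "regular_on A X g"
  shows "regular_on A X (\<lambda>x. f x + g x)"
proof (rule regular_onI[OF X])
  fix x assume x: "x \<in> X"
  obtain f1 f2 where 1: "f1 \<in> polynomial_functions A" "f2 \<in> polynomial_functions A"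
    "f2 x \<noteq> 0" "\<And>y. y \<in> X \<Longrightarrow> f2 y \<noteq> 0 \<Longrightarrow> f y = f1 y / f2 y"
    using regular_onD[OF f X x] by metis
  obtain g1 g2 where 2: "g1 \<in> polynomial_functions A" "g2 \<in> polynomial_functions A"
    "g2 x \<noteq> 0" "\<And>y. y \<in> X \<Longrightarrow> g2 y \<noteq> 0 \<Longrightarrow> g y = g1 y / g2 y"
    using regular_onD[OF g X x] by metis
  have "f y + g y = (f1 y * g2 y + g1 y * f2 y) / (f2 y * g2 y)" if "y \<in> X" "f2 y * g2 y \<noteq> 0" for y
    using 1(4)[of y] 2(4)[of y] that by (simp add: add_frac_eq)
  moreover have "(\<lambda>y. f1 y * g2 y + g1 y * f2 y) \<in> polynomial_functions A"
    using 1 2 by (intro polynomial_functions.add polynomial_functions.mult; simp)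
  moreover have "(\<lambda>y. f2 y * g2 y) \<in> polynomial_functions A" "f2 x * g2 x \<noteq> 0"
    using 1 2 by (auto intro: polynomial_functions.mult)
  ultimately show "\<exists>a b. a \<in> polynomial_functions A \<and> b \<in> polynomial_functions A \<and>
       b x \<noteq> 0 \<and> (\<forall>y\<in>X. b y \<noteq> 0 \<longrightarrow> f y + g y = a y / b y)"
    by blast
qed

lemma regular_on_mult:
  assumes X: "X \<subseteq> points A" and f: "regular_on A X f" and g: "regular_on A X g"
  shows "regular_on A X (\<lambda>x. f x * g x)"
proof (rule regular_onI[OF X])
  fix x assume x: "x \<in> X"
  obtain f1 f2 where 1: "f1 \<in> polynomial_functions A" "f2 \<in> polynomial_functions A"
    "f2 x \<noteq> 0" "\<And>y. y \<in> X \<Longrightarrow> f2 y \<noteq> 0 \<Longrightarrow> f y = f1 y / f2 y"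
    using regular_onD[OF f X x] by metis
  obtain g1 g2 where 2: "g1 \<in> polynomial_functions A" "g2 \<in> polynomial_functions A"
    "g2 x \<noteq> 0" "\<And>y. y \<in> X \<Longrightarrow> g2 y \<noteq> 0 \<Longrightarrow> g y = g1 y / g2 y"
    using regular_onD[OF g X x] by metis
  have "f y * g y = (f1 y * g1 y) / (f2 y * g2 y)" if "y \<in> X" "f2 y * g2 y \<noteq> 0" for y
    using 1(4)[of y] 2(4)[of y] that by (simp add: add_frac_eq)
  moreover have "(\<lambda>y. f1 y * g1 y) \<in> polynomial_functions A"
    using 1 2 by (intro polynomial_functions.add polynomial_functions.mult; simp)
  moreover have "(\<lambda>y. f2 y * g2 y) \<in> polynomial_functions A" "f2 x * g2 x \<noteq> 0"
    using 1 2 by (auto intro: polynomial_functions.mult)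
  ultimately show "\<exists>a b. a \<in> polynomial_functions A \<and> b \<in> polynomial_functions A \<and>
       b x \<noteq> 0 \<and> (\<forall>y\<in>X. b y \<noteq> 0 \<longrightarrow> f y * g y = a y / b y)"
    by blast
qed

text \<open>Locally, a quotient of quotients of polynomials is again one. This serves the pullback
  of fractions along a morphism and the division of coefficients by a pivot.\<close>

lemma regular_on_local_quotient:
  assumes X: "X \<subseteq> points A"
    and q: "\<And>x. x \<in> X \<Longrightarrow> \<exists>g h. regular_on A X g \<and> regular_on A X h \<and> h x \<noteq> 0 \<and>
              (\<forall>y\<in>X. h y \<noteq> 0 \<longrightarrow> f y = g y / h y)"
  shows "regular_on A X f"
proof (rule regular_onI[OF X])
  fix x assume x: "x \<in> X"
  then obtain g h where g: "regular_on A X g" and h: "regular_on A X h" and hx: "h x \<noteq> 0"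
    and f: "\<And>y. y \<in> X \<Longrightarrow> h y \<noteq> 0 \<Longrightarrow> f y = g y / h y"
    using q by metis
  obtain g1 g2 where 1: "g1 \<in> polynomial_functions A" "g2 \<in> polynomial_functions A"
    "g2 x \<noteq> 0" "\<And>y. y \<in> X \<Longrightarrow> g2 y \<noteq> 0 \<Longrightarrow> g y = g1 y / g2 y"
    using regular_onD[OF g X x] by metis
  obtain h1 h2 where 2: "h1 \<in> polynomial_functions A" "h2 \<in> polynomial_functions A"
    "h2 x \<noteq> 0" "\<And>y. y \<in> X \<Longrightarrow> h2 y \<noteq> 0 \<Longrightarrow> h y = h1 y / h2 y"
    using regular_onD[OF h X x] by metis
  have h1x: "h1 x \<noteq> 0" using 2(3,4) x hx by fastforce
  \<comment> \<open>The factor \<open>h2\<close> is kept in the denominator too: its nonvanishing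
    keeps \<open>y\<close> where \<open>h\<close> is given by \<open>h1 / h2\<close>.\<close>
  have "f y = (g1 y * (h2 y * h2 y)) / (g2 y * (h1 y * h2 y))"
    if y: "y \<in> X" and nz: "g2 y * (h1 y * h2 y) \<noteq> 0" for y
  proof -
    have nz': "g2 y \<noteq> 0" "h1 y \<noteq> 0" "h2 y \<noteq> 0" using nz by auto
    have "h y = h1 y / h2 y" "g y = g1 y / g2 y" using 1(4) 2(4) y nz' by auto
    then show ?thesis using f[OF y] nz' by simp
  qed
  moreover have "(\<lambda>y. g1 y * (h2 y * h2 y)) \<in> polynomial_functions A"
    "(\<lambda>y. g2 y * (h1 y * h2 y)) \<in> polynomial_functions A"
    using 1 2 by (intro polynomial_functions.mult; simp)+
  moreover have "g2 x * (h1 x * h2 x) \<noteq> 0" using 1 2 h1x by simp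
  ultimately show "\<exists>a b. a \<in> polynomial_functions A \<and> b \<in> polynomial_functions A \<and>
       b x \<noteq> 0 \<and> (\<forall>y\<in>X. b y \<noteq> 0 \<longrightarrow> f y = a y / b y)"
    by blast
qed

lemma regular_on_sum:
  assumes "X \<subseteq> points A" "\<And>i. i \<in> I \<Longrightarrow> regular_on A X (f i)"
  shows "regular_on A X (\<lambda>x. \<Sum>i\<in>I. f i x)"
  using assms(2)
  by (induction I rule: infinite_finite_induct)
     (auto intro!: regular_on_const regular_on_add assms(1))

lemma regular_on_diff:
  assumes X: "X \<subseteq> points A" and "regular_on A X f" "regular_on A X g"
  shows "regular_on A X (\<lambda>x. f x - g x)"
  using regular_on_add[OF X assms(2) regular_on_mult[OF X regular_on_const[OF X, of "-1"] assms(3)]]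
  by simp

lemma openin_regular_nonzero:
  assumes X: "X \<subseteq> points A" and f: "regular_on A X f"
  shows "openin (subtopology (zariski A) X) {x \<in> X. f x \<noteq> 0}"
proof (subst openin_subopen, intro ballI)
  fix x assume "x \<in> {x \<in> X. f x \<noteq> 0}"
  then have x: "x \<in> X" "f x \<noteq> 0" by auto
  obtain g h where gh: "g \<in> polynomial_functions A" "h \<in> polynomial_functions A"
    "h x \<noteq> 0" "\<And>y. y \<in> X \<Longrightarrow> h y \<noteq> 0 \<Longrightarrow> f y = g y / h y"
    using regular_onD[OF f X x(1)] by metis
  have "openin (subtopology (zariski A) X) {y \<in> X. g y * h y \<noteq> 0}"
    by (intro openin_subtopology_nonzero X polynomial_functions.mult gh)
  moreover have "{y \<in> X. g y * h y \<noteq> 0} \<subseteq> {x \<in> X. f x \<noteq> 0}" using gh by auto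
  moreover have "x \<in> {y \<in> X. g y * h y \<noteq> 0}" using gh x by auto
  ultimately show "\<exists>T. openin (subtopology (zariski A) X) T \<and> x \<in> T \<and> T \<subseteq> {x \<in> X. f x \<noteq> 0}"
    by blast
qed

text \<open>Coordinates suffice because both the open sets and the local fractions on the target are
  made from polynomials in them.\<close>

lemma variety_morphismI:
  assumes X: "X \<subseteq> points A" and Y: "Y \<subseteq> points B"
    and maps: "\<And>x. x \<in> X \<Longrightarrow> \<phi> x \<in> Y"
    and coord: "\<And>f. f \<in> coords B \<Longrightarrow> regular_on A X (\<lambda>x. f (\<phi> x))"
  shows "variety_morphism A X B Y \<phi>"
proof -
  have reg: "regular_on A X (\<lambda>x. g (\<phi> x))" if "g \<in> polynomial_functions B" for g
    using that
    by induction (simp_all add: regular_on_const regular_on_add regular_on_mult X coord)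
  have tX: "topspace (subtopology (zariski A) X) = X" using X by (auto simp: topspace_zariski)
  have tY: "topspace (subtopology (zariski B) Y) = Y" using Y by (auto simp: topspace_zariski)
  have cont: "openin (subtopology (zariski A) X) {x \<in> X. \<phi> x \<in> V}"
    if V: "openin (subtopology (zariski B) Y) V" for V
  proof (subst openin_subopen, intro ballI)
    fix x assume "x \<in> {x \<in> X. \<phi> x \<in> V}"
    then have x: "x \<in> X" "\<phi> x \<in> V" by auto
    obtain u where u: "u \<in> polynomial_functions B" "u (\<phi> x) \<noteq> 0"
      "\<And>y. y \<in> Y \<Longrightarrow> y \<in> points B \<Longrightarrow> u y \<noteq> 0 \<Longrightarrow> y \<in> V"
      using openin_subtopology_zariskiE[OF V x(2)] by metis
    show "\<exists>T. openin (subtopology (zariski A) X) T \<and> x \<in> T \<and> T \<subseteq> {x \<in> X. \<phi> x \<in> V}"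
      by (rule exI[of _ "{x \<in> X. u (\<phi> x) \<noteq> 0}"], intro conjI openin_regular_nonzero X reg u(1))
         (use u x maps Y in auto)
  qed
  have pull: "regular_on A {x \<in> X. \<phi> x \<in> V} (f \<circ> \<phi>)"
    if V: "openin (subtopology (zariski B) Y) V" and f: "regular_on B V f" for V f
  proof -
    let ?W = "{x \<in> X. \<phi> x \<in> V}"
    have W: "?W \<subseteq> points A" using X by auto
    have VB: "V \<subseteq> points B" using openin_subset[OF V] Y tY by auto
    show ?thesis
    proof (rule regular_on_local_quotient[OF W])
      fix x assume "x \<in> ?W"
      then have "\<phi> x \<in> V" by auto
      then obtain g h where gh: "g \<in> polynomial_functions B" "h \<in> polynomial_functions B"
        "h (\<phi> x) \<noteq> 0" "\<And>y. y \<in> V \<Longrightarrow> h y \<noteq> 0 \<Longrightarrow> f y = g y / h y"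
        using regular_onD[OF f VB] by metis
      have "regular_on A ?W (\<lambda>x. g (\<phi> x))" "regular_on A ?W (\<lambda>x. h (\<phi> x))"
        using regular_on_subset[OF reg X] gh by auto
      then show "\<exists>g h. regular_on A ?W g \<and> regular_on A ?W h \<and> h x \<noteq> 0 \<and>
          (\<forall>y\<in>?W. h y \<noteq> 0 \<longrightarrow> (f \<circ> \<phi>) y = g y / h y)"
        using gh by (intro exI[of _ "\<lambda>x. g (\<phi> x)"] exI[of _ "\<lambda>x. h (\<phi> x)"]) auto
    qed
  qed
  show ?thesis
    unfolding variety_morphism_def continuous_map_def tX tY using cont pull maps by auto
qed

section \<open>Geometric quotients from a section\<close>

lemma variety_subset_points: "variety A X \<Longrightarrow> X \<subseteq> points A"
  unfolding variety_def by (metis Int_lower1 openin_subset order_trans topspace_zariski)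

text \<open>Pulling the \<open>\<phi>\<close>-preimage of \<open>V\<close> back along
  \<open>s\<close> returns \<open>V\<close>, so openness and regularity descend by composition with
  \<open>s\<close>. An invariant \<open>f\<close> equals \<open>f \<circ> s \<circ> \<phi>\<close>,
  since \<open>s (\<phi> x)\<close> lies in the orbit of \<open>x\<close>.\<close>

lemma geometric_quotient_of_section:
  assumes vX: "variety A X" and vY: "variety B Y" and act: "group_action G X act"
    and mor: "variety_morphism A X B Y \<phi>" and sec: "variety_morphism B Y A X s"
    and inverse: "\<And>y. y \<in> Y \<Longrightarrow> \<phi> (s y) = y"
    and orbits: "\<And>x. x \<in> X \<Longrightarrow> {y \<in> X. \<phi> y = \<phi> x} = orbit G act x"
  shows "geometric_quotient G act A X B Y \<phi>"
proof -
  let ?SX = "subtopology (zariski A) X" and ?SY = "subtopology (zariski B) Y"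
  have X: "X \<subseteq> points A" and Y: "Y \<subseteq> points B"
    using vX vY by (auto dest: variety_subset_points)
  have tX: "topspace ?SX = X" using X by (auto simp: topspace_zariski)
  have tY: "topspace ?SY = Y" using Y by (auto simp: topspace_zariski)
  have c: "continuous_map ?SX ?SY \<phi>" "continuous_map ?SY ?SX s"
    using mor sec unfolding variety_morphism_def by auto
  have maps: "\<phi> x \<in> Y" if "x \<in> X" for x
    using c(1) that unfolding continuous_map_def tX tY by auto
  have smaps: "s y \<in> X" if "y \<in> Y" for y
    using c(2) that unfolding continuous_map_def tX tY by auto
  have pre: "{y \<in> Y. s y \<in> {x \<in> X. \<phi> x \<in> V}} = V" if "V \<subseteq> Y" for V
    using that smaps inverse by auto
  have quot: "quotient_map ?SX ?SY \<phi>"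
    unfolding quotient_map_def tX tY
  proof (intro conjI allI impI iffI)
    show "\<phi> ` X = Y" using maps smaps inverse by force
  next
    fix V assume V: "V \<subseteq> Y" and o: "openin ?SX {x \<in> X. \<phi> x \<in> V}"
    have "openin ?SY {y \<in> topspace ?SY. s y \<in> {x \<in> X. \<phi> x \<in> V}}"
      by (rule openin_continuous_map_preimage[OF c(2) o])
    then show "openin ?SY V" unfolding tY pre[OF V] .
  next
    fix V assume "openin ?SY V"
    then show "openin ?SX {x \<in> X. \<phi> x \<in> V}"
      using openin_continuous_map_preimage[OF c(1)] unfolding tX by blast
  qed
  have "(regular_on A {x \<in> X. \<phi> x \<in> V} f \<and>
         (\<forall>g\<in>carrier G. \<forall>x\<in>{x \<in> X. \<phi> x \<in> V}. f (act g x) = f x)) \<longleftrightarrow>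
        (\<exists>h. regular_on B V h \<and> (\<forall>x\<in>{x \<in> X. \<phi> x \<in> V}. f x = h (\<phi> x)))" (is "?l \<longleftrightarrow> ?r")
    if V: "openin ?SY V" for V f
  proof
    have VY: "V \<subseteq> Y" using openin_subset[OF V] tY by auto
    assume l: ?l
    have oW: "openin ?SX {x \<in> X. \<phi> x \<in> V}"
      using openin_continuous_map_preimage[OF c(1) V] unfolding tX .
    have "regular_on B {y \<in> Y. s y \<in> {x \<in> X. \<phi> x \<in> V}} (f \<circ> s)"
      using sec oW l unfolding variety_morphism_def by blast
    then have "regular_on B V (f \<circ> s)" unfolding pre[OF VY] .
    moreover have "f x = (f \<circ> s) (\<phi> x)" if x: "x \<in> X" "\<phi> x \<in> V" for x
    proof -
      have "s (\<phi> x) \<in> orbit G act x"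
        using orbits[OF x(1)] smaps maps[OF x(1)] inverse by blast
      then obtain g where "g \<in> carrier G" "s (\<phi> x) = act g x" unfolding orbit_def by auto
      then show ?thesis using l x by auto
    qed
    ultimately show ?r by blast
  next
    assume ?r
    then obtain h where h: "regular_on B V h" "\<And>x. x \<in> X \<Longrightarrow> \<phi> x \<in> V \<Longrightarrow> f x = h (\<phi> x)" by auto
    have "regular_on A {x \<in> X. \<phi> x \<in> V} (h \<circ> \<phi>)"
      using mor V h(1) unfolding variety_morphism_def by blast
    then have "regular_on A {x \<in> X. \<phi> x \<in> V} f"
      by (rule regular_on_cong[rotated]) (use h(2) X in auto)
    moreover have "f (act g x) = f x" if g: "g \<in> carrier G" and x: "x \<in> X" "\<phi> x \<in> V" for g x
    proof -
      have "act g x \<in> {y \<in> X. \<phi> y = \<phi> x}"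
        unfolding orbits[OF x(1)] orbit_def using g by blast
      then show ?thesis using h(2) x by auto
    qed
    ultimately show ?l by blast
  qed
  then show ?thesis
    unfolding geometric_quotient_def using vX vY act mor quot orbits by blast
qed

section \<open>Equivalence of matrices and the Smith normal form\<close>

text \<open>A two-sided inverse replaces a unit determinant, so that products and block sums come
  with explicit inverses.\<close>

definition unimodular :: "nat \<Rightarrow> 'a :: comm_ring_1 mat \<Rightarrow> bool" where
  "unimodular n P \<longleftrightarrow> P \<in> carrier_mat n n \<and>
     (\<exists>P'\<in>carrier_mat n n. P * P' = 1\<^sub>m n \<and> P' * P = 1\<^sub>m n)"

definition mat_equiv :: "nat \<Rightarrow> 'a :: comm_ring_1 mat \<Rightarrow> 'a mat \<Rightarrow> bool" where
  "mat_equiv n A B \<longleftrightarrow> A \<in> carrier_mat n n \<and>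
     (\<exists>P Q. unimodular n P \<and> unimodular n Q \<and> B = P * A * Q)"

lemma unimodular_carrier: "unimodular n P \<Longrightarrow> P \<in> carrier_mat n n"
  by (simp add: unimodular_def)

lemma unimodularI:
  assumes "P \<in> carrier_mat n n" "P' \<in> carrier_mat n n" "P * P' = 1\<^sub>m n" "P' * P = 1\<^sub>m n"
  shows "unimodular n P"
  using assms by (auto simp: unimodular_def)

lemma unimodular_one: "unimodular n (1\<^sub>m n)"
  by (rule unimodularI[of _ _ "1\<^sub>m n"]) auto

lemma unimodular_mult:
  assumes "unimodular n P" "unimodular n Q" shows "unimodular n (P * Q)"
proof -
  obtain P' where P: "P \<in> carrier_mat n n" "P' \<in> carrier_mat n n" "P * P' = 1\<^sub>m n" "P' * P = 1\<^sub>m n"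
    using assms(1) by (auto simp: unimodular_def)
  obtain Q' where Q: "Q \<in> carrier_mat n n" "Q' \<in> carrier_mat n n" "Q * Q' = 1\<^sub>m n" "Q' * Q = 1\<^sub>m n"
    using assms(2) by (auto simp: unimodular_def)
  have "P * Q * (Q' * P') = P * (Q * Q') * P'"
    using P(1,2) Q(1,2) by (simp add: assoc_mult_mat[of _ n n _ n _ n])
  moreover have "Q' * P' * (P * Q) = Q' * (P' * P) * Q"
    using P(1,2) Q(1,2) by (simp add: assoc_mult_mat[of _ n n _ n _ n])
  ultimately show ?thesis
    using P Q by (intro unimodularI[of _ _ "Q' * P'"]) auto
qed

lemma mat_equiv_carrier:
  assumes "mat_equiv n A B"
  shows "A \<in> carrier_mat n n" "B \<in> carrier_mat n n"
  using assms by (auto simp: mat_equiv_def dest!: unimodular_carrier)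

lemma mat_equivI:
  "A \<in> carrier_mat n n \<Longrightarrow> unimodular n P \<Longrightarrow> unimodular n Q \<Longrightarrow> B = P * A * Q \<Longrightarrow> mat_equiv n A B"
  by (auto simp: mat_equiv_def)

lemma mat_equiv_left: "A \<in> carrier_mat n n \<Longrightarrow> unimodular n P \<Longrightarrow> mat_equiv n A (P * A)"
  by (rule mat_equivI[OF _ _ unimodular_one]) (auto dest!: unimodular_carrier)

lemma mat_equiv_right: "A \<in> carrier_mat n n \<Longrightarrow> unimodular n Q \<Longrightarrow> mat_equiv n A (A * Q)"
  by (rule mat_equivI[OF _ unimodular_one]) (auto dest!: unimodular_carrier)

lemma mat_equiv_refl: "A \<in> carrier_mat n n \<Longrightarrow> mat_equiv n A A"
  using mat_equiv_left[OF _ unimodular_one, of A] by simp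

lemma mat_equiv_sym:
  assumes "mat_equiv n A B" shows "mat_equiv n B A"
proof -
  obtain P Q where A: "A \<in> carrier_mat n n" and PQ: "unimodular n P" "unimodular n Q"
    and B: "B = P * A * Q" using assms by (auto simp: mat_equiv_def)
  obtain P' where P: "P \<in> carrier_mat n n" "P' \<in> carrier_mat n n" "P * P' = 1\<^sub>m n" "P' * P = 1\<^sub>m n"
    using PQ(1) by (auto simp: unimodular_def)
  obtain Q' where Q: "Q \<in> carrier_mat n n" "Q' \<in> carrier_mat n n" "Q * Q' = 1\<^sub>m n" "Q' * Q = 1\<^sub>m n"
    using PQ(2) by (auto simp: unimodular_def)
  have "P' * B * Q' = (P' * P) * A * (Q * Q')"
    unfolding B using P(1,2) Q(1,2) A by (simp add: assoc_mult_mat[of _ n n _ n _ n])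
  then have "A = P' * B * Q'" using P Q A by simp
  moreover have "unimodular n P'" "unimodular n Q'"
    using P Q by (auto intro: unimodularI)
  ultimately show ?thesis
    using mat_equivI[OF mat_equiv_carrier(2)[OF assms]] by blast
qed

lemma mat_equiv_trans:
  assumes "mat_equiv n A B" "mat_equiv n B C" shows "mat_equiv n A C"
proof -
  obtain P Q where A: "A \<in> carrier_mat n n" and PQ: "unimodular n P" "unimodular n Q"
    and B: "B = P * A * Q" using assms(1) by (auto simp: mat_equiv_def)
  obtain R S where RS: "unimodular n R" "unimodular n S"
    and C: "C = R * B * S" using assms(2) by (auto simp: mat_equiv_def)
  have "C = (R * P) * A * (Q * S)"
    unfolding C B using A PQ[THEN unimodular_carrier] RS[THEN unimodular_carrier]
    by (simp add: assoc_mult_mat[of _ n n _ n _ n])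
  then show ?thesis
    using mat_equivI[OF A unimodular_mult[OF RS(1) PQ(1)] unimodular_mult[OF PQ(2) RS(2)]] by blast
qed

section \<open>Elementary row and column operations\<close>

lemma unimodular_addrow_mat:
  assumes "k < n" "l < n" "k \<noteq> l" shows "unimodular n (addrow_mat n a k l)"
  using addrow_mat_inv[OF assms, of a] addrow_mat_inv[OF assms, of "-a"]
  by (intro unimodularI[of _ _ "addrow_mat n (-a) k l"]) auto

lemma unimodular_swaprows_mat:
  assumes "k < n" "l < n" shows "unimodular n (swaprows_mat n k l)"
  using swaprows_mat_inv[OF assms] by (intro unimodularI[of _ _ "swaprows_mat n k l"]) auto

lemma mat_equiv_addrow:
  assumes "A \<in> carrier_mat n n" "k < n" "l < n" "k \<noteq> l"
  shows "mat_equiv n A (addrow a k l A)"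
  using mat_equiv_left[OF assms(1) unimodular_addrow_mat[OF assms(2-4)], of a]
    addrow_mat[OF assms(1,3), of a k] by simp

lemma mat_equiv_addcol:
  assumes "A \<in> carrier_mat n n" "k < n" "l < n" "k \<noteq> l"
  shows "mat_equiv n A (addcol a k l A)"
  using mat_equiv_right[OF assms(1) unimodular_addrow_mat[OF assms(3,2) assms(4)[symmetric]], of a]
    addcol_mat[OF assms(1,3), of a k] by simp

lemma mat_equiv_swaprows:
  assumes "A \<in> carrier_mat n n" "k < n" "l < n"
  shows "mat_equiv n A (swaprows k l A)"
  using mat_equiv_left[OF assms(1) unimodular_swaprows_mat[OF assms(2,3)]]
    swaprows_mat[OF assms] by simp

lemma mat_equiv_swapcols:
  assumes "A \<in> carrier_mat n n" "k < n" "l < n"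
  shows "mat_equiv n A (swapcols k l A)"
  using mat_equiv_right[OF assms(1) unimodular_swaprows_mat[OF assms(2,3)]]
    swapcols_mat[OF assms] by simp

section \<open>Block matrices and block elimination\<close>

lemma unimodular_four_block:
  assumes "unimodular p P" "unimodular q Q"
  shows "unimodular (p + q) (four_block_mat P (0\<^sub>m p q) (0\<^sub>m q p) Q)"
proof -
  obtain P' where P: "P \<in> carrier_mat p p" "P' \<in> carrier_mat p p" "P * P' = 1\<^sub>m p" "P' * P = 1\<^sub>m p"
    using assms(1) by (auto simp: unimodular_def)
  obtain Q' where Q: "Q \<in> carrier_mat q q" "Q' \<in> carrier_mat q q" "Q * Q' = 1\<^sub>m q" "Q' * Q = 1\<^sub>m q"
    using assms(2) by (auto simp: unimodular_def)
  show ?thesis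
  proof (rule unimodularI)
    show "four_block_mat P (0\<^sub>m p q) (0\<^sub>m q p) Q * four_block_mat P' (0\<^sub>m p q) (0\<^sub>m q p) Q' = 1\<^sub>m (p + q)"
      by (subst mult_four_block_mat[of _ p p _ q _ q _ _ p _ q]) (use P Q in auto)
    show "four_block_mat P' (0\<^sub>m p q) (0\<^sub>m q p) Q' * four_block_mat P (0\<^sub>m p q) (0\<^sub>m q p) Q = 1\<^sub>m (p + q)"
      by (subst mult_four_block_mat[of _ p p _ q _ q _ _ p _ q]) (use P Q in auto)
  qed (use P Q in auto)
qed

lemma mat_equiv_four_block:
  assumes "mat_equiv p A A'" "mat_equiv q B B'"
  shows "mat_equiv (p + q) (four_block_mat A (0\<^sub>m p q) (0\<^sub>m q p) B)
           (four_block_mat A' (0\<^sub>m p q) (0\<^sub>m q p) B')"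
proof -
  obtain P Q where A: "A \<in> carrier_mat p p" and PQ: "unimodular p P" "unimodular p Q"
    and A': "A' = P * A * Q" using assms(1) by (auto simp: mat_equiv_def)
  obtain R S where B: "B \<in> carrier_mat q q" and RS: "unimodular q R" "unimodular q S"
    and B': "B' = R * B * S" using assms(2) by (auto simp: mat_equiv_def)
  note c = A B PQ[THEN unimodular_carrier] RS[THEN unimodular_carrier]
  have "four_block_mat P (0\<^sub>m p q) (0\<^sub>m q p) R * four_block_mat A (0\<^sub>m p q) (0\<^sub>m q p) B
      = four_block_mat (P * A) (0\<^sub>m p q) (0\<^sub>m q p) (R * B)"
    by (subst mult_four_block_mat[of _ p p _ q _ q _ _ p _ q]) (use c in auto)
  moreover have "four_block_mat (P * A) (0\<^sub>m p q) (0\<^sub>m q p) (R * B) *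
      four_block_mat Q (0\<^sub>m p q) (0\<^sub>m q p) S = four_block_mat A' (0\<^sub>m p q) (0\<^sub>m q p) B'"
    unfolding A' B'
    by (subst mult_four_block_mat[of _ p p _ q _ q _ _ p _ q]) (use c in auto)
  ultimately show ?thesis
    by (intro mat_equivI[OF _ unimodular_four_block[OF PQ(1) RS(1)] unimodular_four_block[OF PQ(2) RS(2)]])
       (use c in auto)
qed

text \<open>\<open>C'\<close> plays the role of \<open>- C\<close>; the inverse is the same block
  matrix with \<open>C'\<close>.\<close>

lemma unimodular_lower:
  assumes "C \<in> carrier_mat q p" "C' \<in> carrier_mat q p" "C + C' = 0\<^sub>m q p" "C' + C = 0\<^sub>m q p"
  shows "unimodular (p + q) (four_block_mat (1\<^sub>m p) (0\<^sub>m p q) C (1\<^sub>m q))"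
proof (rule unimodularI)
  show "four_block_mat (1\<^sub>m p) (0\<^sub>m p q) C (1\<^sub>m q) *
      four_block_mat (1\<^sub>m p) (0\<^sub>m p q) C' (1\<^sub>m q) = 1\<^sub>m (p + q)"
    by (subst mult_four_block_mat[of _ p p _ q _ q _ _ p _ q]) (use assms in auto)
  show "four_block_mat (1\<^sub>m p) (0\<^sub>m p q) C' (1\<^sub>m q) *
      four_block_mat (1\<^sub>m p) (0\<^sub>m p q) C (1\<^sub>m q) = 1\<^sub>m (p + q)"
    by (subst mult_four_block_mat[of _ p p _ q _ q _ _ p _ q]) (use assms in auto)
qed (use assms in auto)

lemma unimodular_upper:
  assumes "R \<in> carrier_mat p q" "R' \<in> carrier_mat p q" "R + R' = 0\<^sub>m p q" "R' + R = 0\<^sub>m p q"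
  shows "unimodular (p + q) (four_block_mat (1\<^sub>m p) R (0\<^sub>m q p) (1\<^sub>m q))"
proof (rule unimodularI)
  show "four_block_mat (1\<^sub>m p) R (0\<^sub>m q p) (1\<^sub>m q) *
      four_block_mat (1\<^sub>m p) R' (0\<^sub>m q p) (1\<^sub>m q) = 1\<^sub>m (p + q)"
    by (subst mult_four_block_mat[of _ p p _ q _ q _ _ p _ q]) (use assms in auto)
  show "four_block_mat (1\<^sub>m p) R' (0\<^sub>m q p) (1\<^sub>m q) *
      four_block_mat (1\<^sub>m p) R (0\<^sub>m q p) (1\<^sub>m q) = 1\<^sub>m (p + q)"
    by (subst mult_four_block_mat[of _ p p _ q _ q _ _ p _ q]) (use assms in auto)
qed (use assms in auto)

text \<open>The off-diagonal blocks are multiples of the corner \<open>A\<close>, so subtracting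
  \<open>C\<close> times the first block row and then \<open>R\<close> times the first block column
  (from the right) clears them. In the Smith reduction \<open>A\<close> is a single entry that
  divides its row and column.\<close>

lemma mat_equiv_four_block_eliminate:
  fixes A :: "'a :: comm_ring_1 mat"
  assumes A: "A \<in> carrier_mat p p" and R: "R \<in> carrier_mat p q" and C: "C \<in> carrier_mat q p"
    and D: "D \<in> carrier_mat q q"
  shows "mat_equiv (p + q) (four_block_mat A (A * R) (C * A) D)
           (four_block_mat A (0\<^sub>m p q) (0\<^sub>m q p) (D - C * (A * R)))"
proof -
  have C0: "C + - C = 0\<^sub>m q p" "- C + C = 0\<^sub>m q p"
    and R0: "R + - R = 0\<^sub>m p q" "- R + R = 0\<^sub>m p q"
    by (rule eq_matI; use C R in simp)+
  have low: "unimodular (p + q) (four_block_mat (1\<^sub>m p) (0\<^sub>m p q) (-C) (1\<^sub>m q))"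
    by (rule unimodular_lower[of _ _ _ C]) (use C C0 in simp_all)
  have up: "unimodular (p + q) (four_block_mat (1\<^sub>m p) (-R) (0\<^sub>m q p) (1\<^sub>m q))"
    by (rule unimodular_upper[of _ _ _ R]) (use R R0 in simp_all)
  have AR: "A * R \<in> carrier_mat p q" and CA: "C * A \<in> carrier_mat q p"
    and CAR: "C * (A * R) \<in> carrier_mat q q" using A C R by auto
  have "- X + D = D - X" if "X \<in> carrier_mat q q" for X
    by (rule eq_matI; use that D in simp)
  then have e: "- (C * A) + C * A = 0\<^sub>m q p" "- (A * R) + A * R = 0\<^sub>m p q"
    "- (C * (A * R)) + D = D - C * (A * R)" "- (0\<^sub>m q q) = (0\<^sub>m q q :: 'a mat)"
    using AR CA CAR by (auto intro: eq_matI)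
  have "four_block_mat (1\<^sub>m p) (0\<^sub>m p q) (-C) (1\<^sub>m q) * four_block_mat A (A * R) (C * A) D
      = four_block_mat A (A * R) (0\<^sub>m q p) (D - C * (A * R))"
    by (subst mult_four_block_mat[of _ p p _ q _ q _ _ p _ q])
       (use A R C D AR CA CAR in \<open>simp_all add: e\<close>)
  moreover have "four_block_mat A (A * R) (0\<^sub>m q p) (D - C * (A * R)) *
      four_block_mat (1\<^sub>m p) (-R) (0\<^sub>m q p) (1\<^sub>m q)
      = four_block_mat A (0\<^sub>m p q) (0\<^sub>m q p) (D - C * (A * R))"
    by (subst mult_four_block_mat[of _ p p _ q _ q _ _ p _ q])
       (use A R C D AR CA CAR minus_carrier_mat[OF CAR, of D] in \<open>simp_all add: e\<close>)
  ultimately show ?thesis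
    by (intro mat_equivI[OF _ low up]) (use A D in auto)
qed

section \<open>Existence of the Smith normal form\<close>

lemma dvd_mat_mult:
  fixes A :: "'a :: comm_ring_1 mat"
  assumes "A \<in> carrier_mat n n" "B \<in> carrier_mat n n"
    and "\<And>i j. i < n \<Longrightarrow> j < n \<Longrightarrow> a dvd A $$ (i, j)" "i < n" "j < n"
  shows "a dvd (A * B) $$ (i, j)" "a dvd (B * A) $$ (i, j)"
proof -
  have "(A * B) $$ (i, j) = (\<Sum>k = 0..<n. A $$ (i, k) * B $$ (k, j))"
    and "(B * A) $$ (i, j) = (\<Sum>k = 0..<n. B $$ (i, k) * A $$ (k, j))"
    using assms(1,2,4,5) by (simp_all add: scalar_prod_def)
  then show "a dvd (A * B) $$ (i, j)" "a dvd (B * A) $$ (i, j)"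
    using assms(3-5) by (auto intro!: dvd_sum intro: dvd_mult2)
qed

text \<open>For the chain of divisibilities: a divisor of all entries of the remaining block still
  divides its diagonal form.\<close>

lemma mat_equiv_dvd:
  assumes "mat_equiv n A B" "\<And>i j. i < n \<Longrightarrow> j < n \<Longrightarrow> a dvd A $$ (i, j)" "i < n" "j < n"
  shows "a dvd B $$ (i, j)"
proof -
  obtain P Q where A: "A \<in> carrier_mat n n" and PQ: "unimodular n P" "unimodular n Q"
    and B: "B = P * A * Q" using assms(1) by (auto simp: mat_equiv_def)
  note PQ' = PQ[THEN unimodular_carrier]
  show ?thesis unfolding B
    by (rule dvd_mat_mult(1)[OF _ PQ'(2) _ assms(3,4)])
       (use A PQ' assms(2) dvd_mat_mult(2)[OF A PQ'(1)] in auto)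
qed

lemma mat_equiv_move_to_corner:
  assumes "A \<in> carrier_mat n n" "i < n" "j < n"
  shows "\<exists>B. mat_equiv n A B \<and> B $$ (0, 0) = A $$ (i, j)"
proof (intro exI conjI)
  have c: "swaprows 0 i A \<in> carrier_mat n n" using assms by simp
  show "mat_equiv n A (swapcols 0 j (swaprows 0 i A))"
    by (rule mat_equiv_trans[OF mat_equiv_swaprows mat_equiv_swapcols]) (use assms c in auto)
  show "swapcols 0 j (swaprows 0 i A) $$ (0, 0) = A $$ (i, j)" using assms by auto
qed

text \<open>Among all equivalent matrices with nonzero corner, one with a corner of least Euclidean
  size is taken. Minimality forces the corner to divide its row, its column and, after clearing
  these, the whole remaining block, to which induction applies. No reduction procedure and no
  termination measure is involved.\<close>

lemma smith_normal_form_exists: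
  fixes A :: "'a :: euclidean_ring mat"
  assumes "A \<in> carrier_mat n n"
  shows "\<exists>d. (\<forall>i. Suc i < n \<longrightarrow> d i dvd d (Suc i)) \<and> mat_equiv n A (mat_diag n d)"
  using assms
proof (induction n arbitrary: A)
  case 0
  then have "A = mat_diag 0 (\<lambda>_. 0)" by (auto simp: mat_diag_def)
  then show ?case using mat_equiv_refl[OF 0] by auto
next
  case (Suc n)
  let ?N = "Suc n"
  note A = Suc.prems
  show ?case
  proof (cases "\<forall>i<?N. \<forall>j<?N. A $$ (i, j) = 0")
    case True
    then have "A = mat_diag ?N (\<lambda>_. 0)" using A by (auto simp: mat_diag_def)
    then show ?thesis using mat_equiv_refl[OF A] by (intro exI[of _ "\<lambda>_. 0"]) auto
  next
    case False
    then obtain i0 j0 where "i0 < ?N" "j0 < ?N" "A $$ (i0, j0) \<noteq> 0" by auto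
    then obtain B0 where "mat_equiv ?N A B0 \<and> B0 $$ (0, 0) \<noteq> 0"
      using mat_equiv_move_to_corner[OF A] by metis
    then obtain B where B: "mat_equiv ?N A B" "B $$ (0, 0) \<noteq> 0"
      and Bmin: "\<And>C. mat_equiv ?N A C \<Longrightarrow> C $$ (0, 0) \<noteq> 0 \<Longrightarrow>
         euclidean_size (B $$ (0, 0)) \<le> euclidean_size (C $$ (0, 0))"
      using ex_has_least_nat[of "\<lambda>B. mat_equiv ?N A B \<and> B $$ (0, 0) \<noteq> 0" B0
          "\<lambda>B. euclidean_size (B $$ (0, 0))"] by blast
    define a where "a = B $$ (0, 0)"
    have a0: "a \<noteq> 0" using B a_def by simp
    \<comment> \<open>Every entry can be moved to the corner, so the minimal corner bounds all
      nonzero entries of all equivalent matrices.\<close>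
    have min: "euclidean_size a \<le> euclidean_size (C $$ (i, j))"
      if C: "mat_equiv ?N A C" and ij: "i < ?N" "j < ?N" "C $$ (i, j) \<noteq> 0" for C i j
    proof -
      obtain C' where "mat_equiv ?N C C'" "C' $$ (0, 0) = C $$ (i, j)"
        using mat_equiv_move_to_corner[OF mat_equiv_carrier(2)[OF C] ij(1,2)] by auto
      then show ?thesis using Bmin[OF mat_equiv_trans[OF C]] ij(3) a_def by metis
    qed
    \<comment> \<open>Stated for every equivalent matrix with corner \<open>a\<close>, because below
      it is applied both to \<open>B\<close> and to a modification of \<open>E\<close>. A nonzero
      remainder modulo \<open>a\<close> would be an entry of smaller size.\<close>
    have row: "a dvd C $$ (0, j)"
      if C: "mat_equiv ?N A C" and Ca: "C $$ (0, 0) = a" and j: "j < ?N" for C j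
    proof (rule ccontr)
      assume nd: "\<not> a dvd C $$ (0, j)"
      then have j0: "j \<noteq> 0" using Ca by (metis dvd_refl)
      let ?C = "addcol (- (C $$ (0, j) div a)) j 0 C"
      have Cc: "C \<in> carrier_mat ?N ?N" by (rule mat_equiv_carrier(2)[OF C])
      have "mat_equiv ?N A ?C"
        by (rule mat_equiv_trans[OF C mat_equiv_addcol]) (use Cc j j0 in auto)
      moreover have e: "?C $$ (0, j) = C $$ (0, j) mod a"
        using Cc j Ca by (simp add: minus_div_mult_eq_mod[symmetric])
      ultimately have "euclidean_size a \<le> euclidean_size (C $$ (0, j) mod a)"
        using min[of ?C 0 j] j nd by (simp add: mod_eq_0_iff_dvd)
      then show False using mod_size_less[OF a0] by (simp add: not_less[symmetric])
    qed
    have col: "a dvd C $$ (i, 0)"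
      if C: "mat_equiv ?N A C" and Ca: "C $$ (0, 0) = a" and i: "i < ?N" for C i
    proof (rule ccontr)
      assume nd: "\<not> a dvd C $$ (i, 0)"
      then have i0: "i \<noteq> 0" using Ca by (metis dvd_refl)
      let ?C = "addrow (- (C $$ (i, 0) div a)) i 0 C"
      have Cc: "C \<in> carrier_mat ?N ?N" by (rule mat_equiv_carrier(2)[OF C])
      have "mat_equiv ?N A ?C"
        by (rule mat_equiv_trans[OF C mat_equiv_addrow]) (use Cc i i0 in auto)
      moreover have e: "?C $$ (i, 0) = C $$ (i, 0) mod a"
        using Cc i Ca by (simp add: minus_div_mult_eq_mod[symmetric])
      ultimately have "euclidean_size a \<le> euclidean_size (C $$ (i, 0) mod a)"
        using min[of ?C i 0] i nd by (simp add: mod_eq_0_iff_dvd)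
      then show False using mod_size_less[OF a0] by (simp add: not_less[symmetric])
    qed
    have Bc: "B \<in> carrier_mat ?N ?N" by (rule mat_equiv_carrier(2)[OF B(1)])
    let ?a = "mat 1 1 (\<lambda>_. a)"
    let ?R = "mat 1 n (\<lambda>(i, j). B $$ (0, Suc j) div a)"
    let ?C = "mat n 1 (\<lambda>(i, j). B $$ (Suc i, 0) div a)"
    let ?D = "mat n n (\<lambda>(i, j). B $$ (Suc i, Suc j))"
    define D where "D = ?D - ?C * (?a * ?R)"
    have Dc: "D \<in> carrier_mat n n" unfolding D_def by (intro minus_carrier_mat mult_carrier_mat) auto
    have "B = four_block_mat ?a (?a * ?R) (?C * ?a) ?D"
    proof (rule eq_matI)
      fix i j assume "i < dim_row (four_block_mat ?a (?a * ?R) (?C * ?a) ?D)"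
        "j < dim_col (four_block_mat ?a (?a * ?R) (?C * ?a) ?D)"
      then have ij: "i < ?N" "j < ?N" by auto
      show "B $$ (i, j) = four_block_mat ?a (?a * ?R) (?C * ?a) ?D $$ (i, j)"
        using ij row[OF B(1) a_def[symmetric], of j] col[OF B(1) a_def[symmetric], of i] a_def
        by (cases i; cases j) (auto simp: scalar_prod_def)
    qed (use Bc in auto)
    then have BE: "mat_equiv ?N B (four_block_mat ?a (0\<^sub>m 1 n) (0\<^sub>m n 1) D)"
      using mat_equiv_four_block_eliminate[of ?a 1 ?R n ?C ?D] unfolding D_def by simp
    define E where "E = four_block_mat ?a (0\<^sub>m 1 n) (0\<^sub>m n 1) D"
    have E: "mat_equiv ?N A E" using mat_equiv_trans[OF B(1) BE] E_def by simp
    have Ec: "E \<in> carrier_mat ?N ?N" by (rule mat_equiv_carrier(2)[OF E])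
    have aD: "a dvd D $$ (i, j)" if ij: "i < n" "j < n" for i j
    proof -
      \<comment> \<open>Adding row \<open>Suc i\<close> to row 0 lifts row \<open>i\<close> of
        \<open>D\<close> into the first row and leaves the corner alone, as \<open>E\<close> is zero
        below its corner.\<close>
      have "mat_equiv ?N A (addrow 1 0 (Suc i) E)"
        by (rule mat_equiv_trans[OF E mat_equiv_addrow]) (use Ec ij in auto)
      moreover have "addrow 1 0 (Suc i) E $$ (0, 0) = a"
        using ij Dc unfolding E_def by simp
      ultimately have "a dvd addrow 1 0 (Suc i) E $$ (0, Suc j)" using row ij by simp
      then show ?thesis using ij Dc unfolding E_def by simp
    qed
    obtain d where d: "\<And>i. Suc i < n \<Longrightarrow> d i dvd d (Suc i)" "mat_equiv n D (mat_diag n d)"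
      using Suc.IH[OF Dc] by auto
    have ad: "a dvd d i" if "i < n" for i
      using mat_equiv_dvd[OF d(2) aD that that] that by (simp add: mat_diag_def)
    have "mat_equiv (1 + n) E (four_block_mat ?a (0\<^sub>m 1 n) (0\<^sub>m n 1) (mat_diag n d))"
      unfolding E_def by (rule mat_equiv_four_block[OF mat_equiv_refl d(2)]) simp
    moreover have "four_block_mat ?a (0\<^sub>m 1 n) (0\<^sub>m n 1) (mat_diag n d) = mat_diag ?N (case_nat a d)"
      by (rule eq_matI) (auto simp: mat_diag_def split: nat.split)
    ultimately have "mat_equiv ?N A (mat_diag ?N (case_nat a d))"
      using mat_equiv_trans[OF E] by simp
    moreover have "case_nat a d i dvd case_nat a d (Suc i)" if "Suc i < ?N" for i
      using that ad d(1) by (cases i) auto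
    ultimately show ?thesis by blast
  qed
qed

text \<open>The \<open>u i\<close> are units with inverses \<open>v i\<close>; this is how the Smith
  entries become monic.\<close>

lemma mat_equiv_diag_scale:
  fixes d :: "nat \<Rightarrow> 'a :: comm_ring_1"
  assumes "\<And>i. i < n \<Longrightarrow> u i * v i = 1" "\<And>i. i < n \<Longrightarrow> d' i = u i * d i"
  shows "mat_equiv n (mat_diag n d) (mat_diag n d')"
proof -
  have vu: "v i * u i = 1" if "i < n" for i using assms(1)[OF that] by (simp add: mult.commute)
  have 1: "mat_diag n (\<lambda>i. w i) = 1\<^sub>m n" if "\<And>i. i < n \<Longrightarrow> w i = 1" for w :: "nat \<Rightarrow> 'a"
    using that by (intro eq_matI) (auto simp: mat_diag_def)
  have "unimodular n (mat_diag n u)"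
    using 1[of "\<lambda>i. u i * v i"] 1[of "\<lambda>i. v i * u i"] assms(1) vu
    by (intro unimodularI[of _ _ "mat_diag n v"]) simp_all
  moreover have "mat_diag n u * mat_diag n d = mat_diag n d'"
    unfolding mat_diag_diag using assms(2) by (intro eq_matI) (auto simp: mat_diag_def)
  ultimately show ?thesis using mat_equiv_left[of "mat_diag n d" n "mat_diag n u"] by simp
qed

text \<open>Permutation matrices on both sides. Companion blocks deliver the invariant factors
  scattered among ones, and this sorts them into a divisibility chain.\<close>

lemma mat_equiv_diag_permute:
  assumes p: "p permutes {0..<n}"
  shows "mat_equiv n (mat_diag n (d \<circ> p)) (mat_diag n (d :: nat \<Rightarrow> 'a :: comm_ring_1))"
proof -
  let ?P = "mat n n (\<lambda>(i, j). if i = p j then 1 else 0) :: 'a mat"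
  let ?Q = "mat n n (\<lambda>(i, j). if p i = j then 1 else 0) :: 'a mat"
  have lt: "p i < n" if "i < n" for i using permutes_in_image[OF p] that by simp
  have inj: "p i = p j \<longleftrightarrow> i = j" for i j using permutes_inj[OF p] by (auto dest: injD)
  have ip: "\<exists>k<n. p k = i" if "i < n" for i
    using permutes_image[OF p] that by (metis (full_types) atLeastLessThan_iff image_iff le0)
  have s: "(\<Sum>k = 0..<n. (if i = p k then f k else 0) * (if p k = j then 1 else 0)) =
     (if i = j then f (inv_into UNIV p i) else (0::'a))" if i: "i < n" for i j f
  proof -
    obtain k where k: "k < n" "p k = i" using ip[OF i] by auto
    have "(\<Sum>l = 0..<n. (if i = p l then f l else 0) * (if p l = j then 1 else 0)) =
        (\<Sum>l = 0..<n. if l = k then (if i = j then f k else 0) else 0)"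
      by (rule sum.cong) (use k inj in auto)
    also have "\<dots> = (if i = j then f (inv_into UNIV p i) else 0)"
      using k inv_f_f[OF permutes_inj[OF p], of k] by (auto simp: sum.delta)
    finally show ?thesis .
  qed
  have PQ: "?P * ?Q = 1\<^sub>m n"
    using s[of _ "\<lambda>_. 1"] by (intro eq_matI) (auto simp: scalar_prod_def)
  have QP: "?Q * ?P = 1\<^sub>m n"
  proof (intro eq_matI)
    fix i j assume "i < dim_row (1\<^sub>m n :: 'a mat)" "j < dim_col (1\<^sub>m n :: 'a mat)"
    then have ij: "i < n" "j < n" by auto
    have "(\<Sum>k = 0..<n. (if p i = k then 1 else 0) * (if k = p j then 1 else 0)) =
        (\<Sum>k = 0..<n. if k = p i then (if i = j then 1 else 0) else (0 :: 'a))"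
      by (rule sum.cong) (use inj in auto)
    then show "(?Q * ?P) $$ (i, j) = 1\<^sub>m n $$ (i, j)"
      using ij lt by (simp add: scalar_prod_def sum.delta)
  qed auto
  have u: "unimodular n ?P" "unimodular n ?Q"
    by (rule unimodularI[OF _ _ PQ QP]; simp) (rule unimodularI[OF _ _ QP PQ]; simp)
  have "mat_diag n d = ?P * mat_diag n (d \<circ> p) * ?Q"
  proof (rule eq_matI)
    fix i j assume "i < dim_row (?P * mat_diag n (d \<circ> p) * ?Q)"
      "j < dim_col (?P * mat_diag n (d \<circ> p) * ?Q)"
    then have ij: "i < n" "j < n" by auto
    have "(?P * mat_diag n (d \<circ> p) * ?Q) $$ (i, j) =
        (\<Sum>k = 0..<n. (if i = p k then (d \<circ> p) k else 0) * (if p k = j then 1 else 0))"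
      using ij by (subst mat_diag_mult_right[of _ n n]) (auto simp: scalar_prod_def intro!: sum.cong)
    then show "mat_diag n d $$ (i, j) = (?P * mat_diag n (d \<circ> p) * ?Q) $$ (i, j)"
      using ij s[OF ij(1), of "d \<circ> p" j] permutes_inverses(1)[OF p] by (simp add: mat_diag_def)
  qed (auto simp: mat_diag_def)
  then show ?thesis by (intro mat_equivI[OF _ u]) auto
qed

section \<open>Minors\<close>

lemma card_index_set:
  assumes "I \<subseteq> {..<n}" shows "card {i. i < n \<and> i \<in> I} = card I"
  by (rule arg_cong[where f = card]) (use assms in blast)

lemma submatrix_carrier:
  assumes "A \<in> carrier_mat n n" "I \<subseteq> {..<n}" "J \<subseteq> {..<n}"
  shows "submatrix A I J \<in> carrier_mat (card I) (card J)"
  using card_index_set[OF assms(2)] card_index_set[OF assms(3)] carrier_matD[OF assms(1)]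
  by (intro carrier_matI) (simp_all only: dim_submatrix)

lemma submatrix_index':
  assumes "A \<in> carrier_mat n n" "I \<subseteq> {..<n}" "J \<subseteq> {..<n}" "i < card I" "j < card J"
  shows "submatrix A I J $$ (i, j) = A $$ (pick I i, pick J j)"
  by (rule submatrix_index)
     (simp_all only: carrier_matD[OF assms(1)] card_index_set[OF assms(2)] card_index_set[OF assms(3)] assms)

lemma pick_less:
  assumes "I \<subseteq> {..<n}" "i < card I"
  shows "pick I i < n"
  using subsetD[OF assms(1) pick_in_set_le[OF assms(2)]] by simp

text \<open>The Cauchy-Binet expansion before terms are collected: \<open>\<phi>\<close> runs over
  all choices of rows, including repeated and unsorted ones. For divisibility the uncollected form
  is enough.\<close>

lemma det_mult_rectangular:
  fixes B C :: "'a :: comm_ring_1 mat"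
  assumes B: "B \<in> carrier_mat k n" and C: "C \<in> carrier_mat n k"
  shows "det (B * C) = (\<Sum>\<phi>\<in>{0..<k} \<rightarrow>\<^sub>E {0..<n}.
    (\<Prod>i = 0..<k. B $$ (i, \<phi> i)) * det (mat k k (\<lambda>(i, j). C $$ (\<phi> i, j))))"
proof -
  let ?S = "{p. p permutes {0..<k}}" and ?F = "{0..<k} \<rightarrow>\<^sub>E {0..<n}"
  have "det (B * C) = (\<Sum>p\<in>?S. signof p * (\<Prod>i = 0..<k. \<Sum>l = 0..<n. B $$ (i, l) * C $$ (l, p i)))"
    using B C unfolding det_def'[OF mult_carrier_mat[OF B C]]
    by (intro sum.cong refl arg_cong2[where f = "(*)"] prod.cong)
       (auto simp: scalar_prod_def permutes_in_image)
  also have "\<dots> = (\<Sum>p\<in>?S. signof p * (\<Sum>\<phi>\<in>?F. \<Prod>i = 0..<k. B $$ (i, \<phi> i) * C $$ (\<phi> i, p i)))"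
    by (subst prod_sum_PiE) auto
  also have "\<dots> = (\<Sum>p\<in>?S. \<Sum>\<phi>\<in>?F. (\<Prod>i = 0..<k. B $$ (i, \<phi> i)) * (signof p * (\<Prod>i = 0..<k. C $$ (\<phi> i, p i))))"
    by (simp add: sum_distrib_left prod.distrib mult_ac)
  also have "\<dots> = (\<Sum>\<phi>\<in>?F. (\<Prod>i = 0..<k. B $$ (i, \<phi> i)) * (\<Sum>p\<in>?S. signof p * (\<Prod>i = 0..<k. C $$ (\<phi> i, p i))))"
    by (subst sum.swap) (simp add: sum_distrib_left)
  also have "\<dots> = (\<Sum>\<phi>\<in>?F. (\<Prod>i = 0..<k. B $$ (i, \<phi> i)) * det (mat k k (\<lambda>(i, j). C $$ (\<phi> i, j))))"
    by (intro sum.cong refl arg_cong2[where f = "(*)"], subst det_def'[of _ k])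
       (auto intro!: sum.cong prod.cong simp: permutes_in_image)
  finally show ?thesis .
qed

text \<open>A repeated row makes the determinant zero; otherwise the rows are those of a genuine
  minor in another order, and only the sign changes.\<close>

lemma dvd_det_select_rows:
  fixes A :: "'a :: comm_ring_1 mat"
  assumes A: "A \<in> carrier_mat n n" and D: "\<And>m. m \<in> minors n k A \<Longrightarrow> D dvd m"
    and \<phi>: "\<phi> \<in> {0..<k} \<rightarrow> {0..<n}" and J: "J \<subseteq> {..<n}" "card J = k"
  shows "D dvd det (mat k k (\<lambda>(i, j). A $$ (\<phi> i, pick J j)))"
proof (cases "inj_on \<phi> {0..<k}")
  case False
  then obtain i j where ij: "i < k" "j < k" "i \<noteq> j" "\<phi> i = \<phi> j" by (auto simp: inj_on_def)
  have "det (mat k k (\<lambda>(i, j). A $$ (\<phi> i, pick J j))) = 0"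
    by (rule det_identical_rows[of _ k i j]) (use ij in auto)
  then show ?thesis by simp
next
  case True
  define I where "I = \<phi> ` {0..<k}"
  have I: "I \<subseteq> {..<n}" "card I = k" using \<phi> True by (auto simp: I_def card_image)
  have finI: "finite I" unfolding I_def by simp
  \<comment> \<open>\<open>p i\<close> is the rank of \<open>\<phi> i\<close> within the set of
    chosen rows; beyond \<open>k\<close> it is the identity, as \<open>permutes\<close>
    demands.\<close>
  define p where "p i = (if i < k then card {a \<in> I. a < \<phi> i} else i)" for i
  have pick_p: "pick I (p i) = \<phi> i" if "i < k" for i
    using pick_card_in_set[of "\<phi> i" I] that by (auto simp: p_def I_def)
  have p_less: "p i < k" if "i < k" for i
  proof -
    have "\<phi> i \<in> I" using that by (auto simp: I_def)
    then have "{a \<in> I. a < \<phi> i} \<subset> I" by auto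
    then have "card {a \<in> I. a < \<phi> i} < card I" by (rule psubset_card_mono[OF finI])
    then show ?thesis using that I by (simp add: p_def)
  qed
  have inj: "inj_on p {0..<k}"
  proof (rule inj_onI)
    fix i j assume "i \<in> {0..<k}" "j \<in> {0..<k}" "p i = p j"
    then show "i = j" using pick_p[of i] pick_p[of j] True by (auto dest: inj_onD)
  qed
  have "p ` {0..<k} = {0..<k}"
    by (rule endo_inj_surj) (use inj p_less in auto)
  then have p: "p permutes {0..<k}"
    using inj by (intro bij_imp_permutes) (auto simp: bij_betw_def p_def)
  have "mat k k (\<lambda>(i, j). A $$ (\<phi> i, pick J j)) = mat k k (\<lambda>(i, j). submatrix A I J $$ (p i, j))"
    using submatrix_index'[OF A I(1) J(1)] I(2) J(2) pick_p p_less by (intro eq_matI) auto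
  then have "det (mat k k (\<lambda>(i, j). A $$ (\<phi> i, pick J j))) = signof p * det (submatrix A I J)"
    using det_permute_rows[OF _ p, of "submatrix A I J"] submatrix_carrier[OF A I(1) J(1)] I(2) J(2)
    by simp
  moreover have "det (submatrix A I J) \<in> minors n k A"
    using I J unfolding minors_def by blast
  ultimately show ?thesis using D by simp
qed

text \<open>Minors of \<open>P * A\<close> are linear combinations of minors of \<open>A\<close> of
  the same size. Common divisors \<open>D\<close> express this over any commutative ring.\<close>

lemma dvd_minors_mult_left:
  fixes A :: "'a :: comm_ring_1 mat"
  assumes A: "A \<in> carrier_mat n n" and P: "P \<in> carrier_mat n n"
    and D: "\<And>m. m \<in> minors n k A \<Longrightarrow> D dvd m" and m: "m \<in> minors n k (P * A)"
  shows "D dvd m"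
proof -
  obtain I J where I: "I \<subseteq> {..<n}" "card I = k" and J: "J \<subseteq> {..<n}" "card J = k"
    and m: "m = det (submatrix (P * A) I J)" using m unfolding minors_def by blast
  let ?B = "mat k n (\<lambda>(i, l). P $$ (pick I i, l))" and ?C = "mat n k (\<lambda>(l, j). A $$ (l, pick J j))"
  have pI: "pick I i < n" if "i < k" for i using pick_less[OF I(1)] that I(2) by auto
  have pJ: "pick J i < n" if "i < k" for i using pick_less[OF J(1)] that J(2) by auto
  have PA: "P * A \<in> carrier_mat n n" using P A by auto
  have "submatrix (P * A) I J = ?B * ?C"
  proof (rule eq_matI)
    fix i j assume "i < dim_row (?B * ?C)" "j < dim_col (?B * ?C)"
    then have ij: "i < k" "j < k" by auto
    have "submatrix (P * A) I J $$ (i, j) = (P * A) $$ (pick I i, pick J j)"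
      by (rule submatrix_index'[OF PA I(1) J(1)]) (use ij I J in auto)
    then show "submatrix (P * A) I J $$ (i, j) = (?B * ?C) $$ (i, j)"
      using ij pI pJ A P by (auto simp: scalar_prod_def)
  qed (use submatrix_carrier[OF PA I(1) J(1)] I J in auto)
  then have "m = (\<Sum>\<phi>\<in>{0..<k} \<rightarrow>\<^sub>E {0..<n}. (\<Prod>i = 0..<k. ?B $$ (i, \<phi> i)) *
      det (mat k k (\<lambda>(i, j). ?C $$ (\<phi> i, j))))"
    using det_mult_rectangular[of ?B k n ?C] m by simp
  also have "\<dots> = (\<Sum>\<phi>\<in>{0..<k} \<rightarrow>\<^sub>E {0..<n}. (\<Prod>i = 0..<k. ?B $$ (i, \<phi> i)) *
      det (mat k k (\<lambda>(i, j). A $$ (\<phi> i, pick J j))))"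
    by (intro sum.cong refl arg_cong2[where f = "(*)"] arg_cong[where f = det] eq_matI)
       (auto simp: PiE_def Pi_def)
  also have "D dvd \<dots>"
    by (intro dvd_sum dvd_mult dvd_det_select_rows[OF A D _ J]) (auto simp: PiE_def)
  finally show ?thesis .
qed

text \<open>Turns multiplication on the right into multiplication on the left, the case already
  treated.\<close>

lemma minors_transpose:
  assumes A: "A \<in> carrier_mat n n"
  shows "minors n k (transpose_mat A) = minors n k A"
proof -
  have *: "det (submatrix (transpose_mat A) I J) = det (submatrix A J I)"
    if "I \<subseteq> {..<n}" "J \<subseteq> {..<n}" "card I = k" "card J = k" for I J
  proof -
    have "submatrix (transpose_mat A) I J = transpose_mat (submatrix A J I)"
      using that A submatrix_carrier[OF A that(2,1)] submatrix_index'[OF A that(2,1)] pick_less[of I n] pick_less[of J n]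
        submatrix_carrier[of "transpose_mat A" n, OF _ that(1,2)] submatrix_index'[of "transpose_mat A" n, OF _ that(1,2)]
      by (intro eq_matI) auto
    then show ?thesis
      using det_transpose[of "submatrix A J I" k] submatrix_carrier[OF A that(2,1)] that by simp
  qed
  show ?thesis
  proof (intro Set.set_eqI iffI)
    fix m assume "m \<in> minors n k (transpose_mat A)"
    then obtain I J where "I \<subseteq> {..<n}" "J \<subseteq> {..<n}" "card I = k" "card J = k"
      "m = det (submatrix (transpose_mat A) I J)" unfolding minors_def by blast
    then show "m \<in> minors n k A" using *[of I J] unfolding minors_def by auto
  next
    fix m assume "m \<in> minors n k A"
    then obtain I J where "I \<subseteq> {..<n}" "J \<subseteq> {..<n}" "card I = k" "card J = k"
      "m = det (submatrix A I J)" unfolding minors_def by blast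
    then show "m \<in> minors n k (transpose_mat A)" 
      using *[of J I] unfolding minors_def by (intro CollectI exI[of _ J] exI[of _ I]) auto
  qed
qed

lemma dvd_minors_mat_equiv:
  assumes "mat_equiv n A B" and D: "\<And>m. m \<in> minors n k A \<Longrightarrow> D dvd m" and m: "m \<in> minors n k B"
  shows "D dvd m"
proof -
  obtain P Q where A: "A \<in> carrier_mat n n" and P: "P \<in> carrier_mat n n" and Q: "Q \<in> carrier_mat n n"
    and B: "B = P * A * Q" using assms(1) by (auto simp: mat_equiv_def dest!: unimodular_carrier)
  have PA: "P * A \<in> carrier_mat n n" using P A by auto
  have "D dvd m" if "m \<in> minors n k (P * A)" for m
    using dvd_minors_mult_left[OF A P D that] .
  then have "D dvd m" if "m \<in> minors n k (transpose_mat (P * A))" for m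
    using that unfolding minors_transpose[OF PA] .
  moreover have "m \<in> minors n k (transpose_mat Q * transpose_mat (P * A))"
    using m minors_transpose[of B n k] P A Q unfolding B by (simp add: transpose_mult[of _ n n _ n])
  ultimately show ?thesis
    using dvd_minors_mult_left[of "transpose_mat (P * A)" n "transpose_mat Q" k D m] PA Q by auto
qed

lemma Gcd_minors_mat_equiv:
  fixes A B :: "'a :: {comm_ring_1, semiring_Gcd} mat"
  assumes "mat_equiv n A B"
  shows "Gcd (minors n k A) = Gcd (minors n k B)"
proof (rule associated_eqI)
  show "Gcd (minors n k A) dvd Gcd (minors n k B)"
    by (rule Gcd_greatest) (rule dvd_minors_mat_equiv[OF assms Gcd_dvd])
  show "Gcd (minors n k B) dvd Gcd (minors n k A)"
    by (rule Gcd_greatest) (rule dvd_minors_mat_equiv[OF mat_equiv_sym[OF assms] Gcd_dvd])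
qed auto

lemma le_pick:
  assumes "i < card I" shows "i \<le> pick I i"
  using assms
proof (induction i)
  case (Suc i)
  then have "pick I i < pick I (Suc i)" by (intro pick_mono_le) auto
  then show ?case using Suc by simp
qed simp

lemma pick_lessThan:
  assumes "i < k" shows "pick {..<k} i = i"
proof -
  have "{a \<in> {..<k}. a < i} = {..<i}" using assms by auto
  then show ?thesis using pick_card_in_set[of i "{..<k}"] assms by simp
qed

text \<open>The leading minor is the product itself. In any other submatrix, an entry of row
  \<open>i\<close> is zero or \<open>d (pick I i)\<close>; since \<open>i \<le> pick I i\<close>,
  the chain makes \<open>d i\<close> divide it, and hence the product divides every term of the
  Leibniz expansion.\<close>

lemma Gcd_minors_diag:
  fixes d :: "nat \<Rightarrow> 'a :: {comm_ring_1, semiring_Gcd}"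
  assumes d: "\<And>i. Suc i < n \<Longrightarrow> d i dvd d (Suc i)" and k: "k \<le> n"
  shows "Gcd (minors n k (mat_diag n d)) = normalize (\<Prod>i<k. d i)"
proof (rule associated_eqI)
  have mono: "d i dvd d j" if "i \<le> j" "j < n" for i j
    using that(1)
  proof (rule dec_induct)
    fix m assume "i \<le> m" "m < j" "d i dvd d m"
    then show "d i dvd d (Suc m)" using d[of m] that(2) dvd_trans[of "d i" "d m"] by simp
  qed simp
  have "submatrix (mat_diag n d) {..<k} {..<k} = mat_diag k d"
  proof (rule eq_matI)
    show "dim_row (submatrix (mat_diag n d) {..<k} {..<k}) = dim_row (mat_diag k d)"
      "dim_col (submatrix (mat_diag n d) {..<k} {..<k}) = dim_col (mat_diag k d)"
      using submatrix_carrier[of "mat_diag n d" n "{..<k}" "{..<k}"] k by (auto simp: mat_diag_def)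
    fix i j assume "i < dim_row (mat_diag k d)" "j < dim_col (mat_diag k d)"
    then show "submatrix (mat_diag n d) {..<k} {..<k} $$ (i, j) = mat_diag k d $$ (i, j)"
      using submatrix_index'[of "mat_diag n d" n "{..<k}" "{..<k}" i j] k
      by (simp add: pick_lessThan mat_diag_def)
  qed
  moreover have "det (mat_diag k d) = (\<Prod>i<k. d i)"
    by (subst det_upper_triangular[of _ k])
       (auto simp: mat_diag_def upper_triangular_def diag_mat_def prod.list_conv_set_nth atLeast0LessThan
             intro!: prod.cong)
  ultimately have "(\<Prod>i<k. d i) \<in> minors n k (mat_diag n d)"
    unfolding minors_def using k by (intro CollectI exI[of _ "{..<k}"]) auto
  then show "Gcd (minors n k (mat_diag n d)) dvd normalize (\<Prod>i<k. d i)"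
    by (simp add: Gcd_dvd)
  have "(\<Prod>i<k. d i) dvd m" if m: "m \<in> minors n k (mat_diag n d)" for m
  proof -
    obtain I J where I: "I \<subseteq> {..<n}" "card I = k" and J: "J \<subseteq> {..<n}" "card J = k"
      and m: "m = det (submatrix (mat_diag n d) I J)" using m unfolding minors_def by blast
    have c: "submatrix (mat_diag n d) I J \<in> carrier_mat k k"
      using submatrix_carrier[of "mat_diag n d" n, OF _ I(1) J(1)] I J by auto
    have "d i dvd submatrix (mat_diag n d) I J $$ (i, j)" if "i < k" "j < k" for i j
      using submatrix_index'[of "mat_diag n d" n, OF _ I(1) J(1), of i j] that I J
        pick_less[OF I(1), of i] pick_less[OF J(1), of j] le_pick[of i I] mono[of i "pick I i"]
      by (auto simp: mat_diag_def)
    have "(\<Prod>i = 0..<k. d i) dvd m" unfolding m det_def'[OF c]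
      using \<open>\<And>i j. i < k \<Longrightarrow> j < k \<Longrightarrow> d i dvd submatrix (mat_diag n d) I J $$ (i, j)\<close>
      by (intro dvd_sum dvd_mult prod_dvd_prod) (auto simp: permutes_in_image)
    then show ?thesis by (simp add: atLeast0LessThan)
  qed
  then show "normalize (\<Prod>i<k. d i) dvd Gcd (minors n k (mat_diag n d))"
    by (auto intro!: Gcd_greatest)
qed auto

section \<open>Similarity of complex matrices\<close>

interpretation const_poly: comm_ring_hom "\<lambda>c :: complex. [:c:]"
  by unfold_locales auto

abbreviation const_mat :: "complex mat \<Rightarrow> complex poly mat" where
  "const_mat \<equiv> map_mat (\<lambda>c. [:c:])"

lemma shifted_matrix_carrier: "shifted_matrix n x \<in> carrier_mat n n"
  unfolding shifted_matrix_def carrier_mat_def by simp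

lemma pCons_minus_one: "[:- 1:] = (- 1 :: complex poly)"
  by (metis one_pCons minus_pCons minus_zero)

lemma shifted_matrix_index:
  assumes "x \<in> carrier_mat n n" "i < n" "j < n"
  shows "shifted_matrix n x $$ (i, j) = (if i = j then [:x $$ (i, j), -1:] else [:x $$ (i, j):])"
  using assms by (simp add: shifted_matrix_def pCons_minus_one)

lemma shifted_mult:
  assumes x: "x \<in> carrier_mat n n" and A: "A \<in> carrier_mat n n"
  shows "shifted_matrix n x * A = const_mat x * A - [:0, 1:] \<cdot>\<^sub>m A"
proof -
  have "shifted_matrix n x * A = const_mat x * A - ([:0, 1:] \<cdot>\<^sub>m 1\<^sub>m n) * A"
    unfolding shifted_matrix_def by (rule minus_mult_distrib_mat) (use x A in auto)
  also have "([:0, 1:] \<cdot>\<^sub>m 1\<^sub>m n) * A = [:0, 1:] \<cdot>\<^sub>m A"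
    using A mult_smult_assoc_mat[of "1\<^sub>m n" n n A n "[:0, 1:]"] by simp
  finally show ?thesis .
qed

lemma mult_shifted:
  assumes x: "x \<in> carrier_mat n n" and A: "A \<in> carrier_mat n n"
  shows "A * shifted_matrix n x = A * const_mat x - [:0, 1:] \<cdot>\<^sub>m A"
proof -
  have "A * shifted_matrix n x = A * const_mat x - A * ([:0, 1:] \<cdot>\<^sub>m 1\<^sub>m n)"
    unfolding shifted_matrix_def by (rule mult_minus_distrib_mat) (use x A in auto)
  also have "A * ([:0, 1:] \<cdot>\<^sub>m 1\<^sub>m n) = [:0, 1:] \<cdot>\<^sub>m A"
    using A mult_smult_distrib[of A n n "1\<^sub>m n" n "[:0, 1:]"] by simp
  finally show ?thesis .
qed

text \<open>Division by a matrix that is linear in \<open>t\<close> with invertible leading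
  coefficient, by induction on a degree bound. Write \<open>P = P0 + t P1\<close> and
  \<open>P1 = (y - t) R + S\<close>. As \<open>t S = y S - (y - t) S\<close>, the new quotient is
  \<open>t R - S\<close> and the new remainder is \<open>P0 + y S\<close>.\<close>

lemma shifted_left_division:
  assumes y: "y \<in> carrier_mat n n" and P: "P \<in> carrier_mat n n"
  shows "\<exists>R\<in>carrier_mat n n. \<exists>S\<in>carrier_mat n n. P = shifted_matrix n y * R + const_mat S"
proof -
  obtain m where "\<And>i j. i < n \<Longrightarrow> j < n \<Longrightarrow> degree (P $$ (i, j)) < m"
  proof -
    have "finite ((\<lambda>k. degree (P $$ k)) ` ({..<n} \<times> {..<n}))" by simp
    then obtain m where m: "\<forall>d\<in>(\<lambda>k. degree (P $$ k)) ` ({..<n} \<times> {..<n}). d < m"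
      using finite_nat_set_iff_bounded by blast
    then show ?thesis by (intro that[of m]) (use m in blast)
  qed
  then have "\<forall>i<n. \<forall>j<n. \<forall>k\<ge>m. coeff (P $$ (i, j)) k = 0"
    by (meson coeff_eq_0 order_less_le_trans)
  then show ?thesis using P
  proof (induction m arbitrary: P)
    case 0
    then have "P $$ (i, j) = 0" if "i < n" "j < n" for i j
      using that by (simp add: poly_eq_iff)
    then have "P = shifted_matrix n y * 0\<^sub>m n n + const_mat (0\<^sub>m n n)"
      using 0(2) shifted_matrix_carrier[of n y] by (intro eq_matI) auto
    then show ?case by (intro bexI[of _ "0\<^sub>m n n"]) auto
  next
    case (Suc m)
    let ?t = "[:0, 1:] :: complex poly" and ?Y = "shifted_matrix n y"
    define P1 where "P1 = map_mat (poly_shift 1) P"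
    define P0 where "P0 = map_mat (\<lambda>p. coeff p 0) P"
    have P0: "P0 \<in> carrier_mat n n" and P1: "P1 \<in> carrier_mat n n"
      using Suc.prems(2) by (auto simp: P0_def P1_def)
    have PP: "P $$ (i, j) = [:P0 $$ (i, j):] + ?t * P1 $$ (i, j)" if "i < n" "j < n" for i j
      using that Suc.prems(2) by (simp add: P0_def P1_def poly_eq_iff coeff_pCons coeff_poly_shift split: nat.split)
    have "\<forall>i<n. \<forall>j<n. \<forall>k\<ge>m. coeff (P1 $$ (i, j)) k = 0"
      using Suc.prems by (simp add: P1_def coeff_poly_shift)
    then obtain R S where R: "R \<in> carrier_mat n n" and S: "S \<in> carrier_mat n n"
      and P1eq: "P1 = ?Y * R + const_mat S" using Suc.IH[OF _ P1] by blast
    have cS: "const_mat S \<in> carrier_mat n n" and YR: "?Y * R \<in> carrier_mat n n" and yS: "y * S \<in> carrier_mat n n"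
      using S mult_carrier_mat[OF shifted_matrix_carrier R] y by auto
    have "?Y * (?t \<cdot>\<^sub>m R - const_mat S) = ?Y * (?t \<cdot>\<^sub>m R) - ?Y * const_mat S"
      by (rule mult_minus_distrib_mat[OF shifted_matrix_carrier]) (use R cS in auto)
    also have "?Y * (?t \<cdot>\<^sub>m R) = ?t \<cdot>\<^sub>m (?Y * R)"
      by (rule mult_smult_distrib[OF shifted_matrix_carrier R])
    also have "?Y * const_mat S = const_mat (y * S) - ?t \<cdot>\<^sub>m const_mat S"
      by (simp only: shifted_mult[OF y cS] const_poly.mat_hom_mult[OF y S])
    finally have e: "?Y * (?t \<cdot>\<^sub>m R - const_mat S) =
        ?t \<cdot>\<^sub>m (?Y * R) - (const_mat (y * S) - ?t \<cdot>\<^sub>m const_mat S)" .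
    have "P = ?Y * (?t \<cdot>\<^sub>m R - const_mat S) + const_mat (P0 + y * S)"
    proof (rule eq_matI)
      fix i j assume "i < dim_row (?Y * (?t \<cdot>\<^sub>m R - const_mat S) + const_mat (P0 + y * S))"
        "j < dim_col (?Y * (?t \<cdot>\<^sub>m R - const_mat S) + const_mat (P0 + y * S))"
      then have ij: "i < n" "j < n" using P0 yS by auto
      define u where "u = (?Y * R) $$ (i, j)"
      define v where "v = (y * S) $$ (i, j)"
      define w where "w = S $$ (i, j)"
      have "P1 $$ (i, j) = u + [:w:]" using ij YR S unfolding P1eq u_def w_def by simp
      then have p: "P $$ (i, j) = [:P0 $$ (i, j):] + ?t * (u + [:w:])" using PP[OF ij] by simp
      have gen: "(?t \<cdot>\<^sub>m A - (const_mat B - ?t \<cdot>\<^sub>m const_mat S)) $$ (i, j) =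
          ?t * A $$ (i, j) - ([:B $$ (i, j):] - ?t * [:S $$ (i, j):])"
        if "A \<in> carrier_mat n n" "B \<in> carrier_mat n n" for A B
        using ij S that by simp
      have q: "(?t \<cdot>\<^sub>m (?Y * R) - (const_mat (y * S) - ?t \<cdot>\<^sub>m const_mat S)) $$ (i, j) =
          ?t * u - ([:v:] - ?t * [:w:])"
        unfolding gen[OF YR yS] u_def v_def w_def by (rule refl)
      have "const_mat (A + B) $$ (i, j) = [:A $$ (i, j):] + [:B $$ (i, j):]"
        "(C + const_mat (A + B)) $$ (i, j) = C $$ (i, j) + const_mat (A + B) $$ (i, j)"
        if "A \<in> carrier_mat n n" "B \<in> carrier_mat n n" for A B C
        using ij that by simp_all
      from this[OF P0 yS] have r: "(C + const_mat (P0 + y * S)) $$ (i, j) =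
          C $$ (i, j) + ([:P0 $$ (i, j):] + [:v:])" for C
        unfolding v_def by simp
      have "c + z * (a + b) = z * a - (d - z * b) + (c + d)" for a b c d z :: "complex poly"
        by (simp add: algebra_simps)
      then show "P $$ (i, j) = (?Y * (?t \<cdot>\<^sub>m R - const_mat S) + const_mat (P0 + y * S)) $$ (i, j)"
        unfolding e r q p .
    qed (use Suc.prems(2) P0 yS in auto)
    moreover have "?t \<cdot>\<^sub>m R - const_mat S \<in> carrier_mat n n" "P0 + y * S \<in> carrier_mat n n"
      by (rule minus_carrier_mat[OF cS], rule add_carrier_mat[OF yS])
    ultimately show ?case
      by (intro bexI[of _ "?t \<cdot>\<^sub>m R - const_mat S"] bexI[of _ "P0 + y * S"])
  qed
qed

text \<open>With \<open>W_k\<close> the coefficient matrix at \<open>t^k\<close>, comparing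
  coefficients at \<open>t^(k+1)\<close> gives \<open>W_k = y W_(k+1)\<close>. Vanishing above the
  degree therefore propagates down to all of \<open>W\<close>, and \<open>T\<close> vanishes with
  it.\<close>

lemma shifted_left_division_unique:
  assumes y: "y \<in> carrier_mat n n" and W: "W \<in> carrier_mat n n" and T: "T \<in> carrier_mat n n"
    and eq: "shifted_matrix n y * W = const_mat T"
  shows "T = 0\<^sub>m n n"
proof -
  have entry: "(\<Sum>l = 0..<n. [:y $$ (i, l):] * W $$ (l, j)) - [:0, 1:] * W $$ (i, j) = [:T $$ (i, j):]"
    if "i < n" "j < n" for i j
  proof -
    have "(const_mat y * W - [:0, 1:] \<cdot>\<^sub>m W) $$ (i, j) = const_mat T $$ (i, j)"
      using eq shifted_mult[OF y W] by simp
    then show ?thesis using that y W T by (simp add: scalar_prod_def)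
  qed
  obtain m where m: "\<forall>d\<in>(\<lambda>k. degree (W $$ k)) ` ({..<n} \<times> {..<n}). d < m"
    using finite_nat_set_iff_bounded[of "(\<lambda>k. degree (W $$ k)) ` ({..<n} \<times> {..<n})"] by auto
  \<comment> \<open>Descending induction on the exponent: \<open>s\<close> counts how far below the
    bound \<open>m\<close> the vanishing has been shown, and \<open>s = m\<close> covers every
    \<open>k\<close>.\<close>
  have "\<forall>k i j. m \<le> k + s \<longrightarrow> i < n \<longrightarrow> j < n \<longrightarrow> coeff (W $$ (i, j)) k = 0" for s
  proof (induction s)
    case 0
    have "degree (W $$ (i, j)) < m" if "i < n" "j < n" for i j using m that by blast
    then show ?case by (auto intro!: coeff_eq_0 intro: order_less_le_trans)
  next
    case (Suc s)
    show ?case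
    proof (intro allI impI)
      fix k i j assume "m \<le> k + Suc s" and ij: "i < n" "j < n"
      then have z: "coeff (W $$ (l, j)) (Suc k) = 0" if "l < n" for l using Suc that by auto
      have "coeff ((\<Sum>l = 0..<n. [:y $$ (i, l):] * W $$ (l, j)) - [:0, 1:] * W $$ (i, j)) (Suc k) = 0"
        unfolding entry[OF ij] by simp
      then show "coeff (W $$ (i, j)) k = 0" using z by (simp add: coeff_sum)
    qed
  qed
  from this[of m] have "W $$ (i, j) = 0" if "i < n" "j < n" for i j
    using that by (simp add: poly_eq_iff)
  then have "[:T $$ (i, j):] = 0" if "i < n" "j < n" for i j
    using entry[OF that] that by simp
  then show ?thesis using T by (intro eq_matI) auto
qed

text \<open>If \<open>P (x - t) = (y - t) Q\<close>, then the remainder of \<open>P\<close> modulo the left multiples of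
  \<open>y - t\<close> intertwines \<open>x\<close> and \<open>y\<close>.\<close>

lemma similar_if_shifted_equiv:
  assumes x: "x \<in> carrier_mat n n" and y: "y \<in> carrier_mat n n"
    and equiv: "mat_equiv n (shifted_matrix n x) (shifted_matrix n y)"
  shows "\<exists>S\<in>carrier_mat n n. \<exists>S'\<in>carrier_mat n n. S * S' = 1\<^sub>m n \<and> S' * S = 1\<^sub>m n \<and> y = S * x * S'"
proof -
  let ?X = "shifted_matrix n x" and ?Y = "shifted_matrix n y" and ?t = "[:0, 1:] :: complex poly"
  have X: "?X \<in> carrier_mat n n" and Y: "?Y \<in> carrier_mat n n" by (rule shifted_matrix_carrier)+
  obtain P Q0 where PQ0: "unimodular n P" "unimodular n Q0" and Yeq: "?Y = P * ?X * Q0"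
    using equiv by (auto simp: mat_equiv_def)
  obtain P' where P: "P \<in> carrier_mat n n" and P': "P' \<in> carrier_mat n n" and PP': "P * P' = 1\<^sub>m n"
    using PQ0(1) by (auto simp: unimodular_def)
  obtain Q where Q0: "Q0 \<in> carrier_mat n n" and Q: "Q \<in> carrier_mat n n" and QQ: "Q0 * Q = 1\<^sub>m n"
    using PQ0(2) by (auto simp: unimodular_def)
  have "?Y * Q = P * ?X * (Q0 * Q)"
    unfolding Yeq using P X Q0 Q by (simp add: assoc_mult_mat[of _ n n _ n _ n])
  then have PX: "?Y * Q = P * ?X" unfolding QQ using P X by simp
  obtain R S where R: "R \<in> carrier_mat n n" and S: "S \<in> carrier_mat n n"
    and Peq: "P = ?Y * R + const_mat S" using shifted_left_division[OF y P] by blast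
  obtain R' S' where R': "R' \<in> carrier_mat n n" and S': "S' \<in> carrier_mat n n"
    and P'eq: "P' = ?X * R' + const_mat S'" using shifted_left_division[OF x P'] by blast
  have cS: "const_mat S \<in> carrier_mat n n" and cS': "const_mat S' \<in> carrier_mat n n"
    using S S' by auto
  have YR: "?Y * R \<in> carrier_mat n n" and RX: "R * ?X \<in> carrier_mat n n" using Y R X by auto
  \<comment> \<open>Substituting \<open>P = (y - t) R + S\<close> into
    \<open>(y - t) Q = P (x - t)\<close> shows that \<open>(y - t) (Q - R (x - t) - S)\<close>
    equals \<open>S (x - t) - (y - t) S\<close>. The terms in \<open>t\<close> cancel there, so the
    constant matrix \<open>S x - y S\<close> is a left multiple of \<open>y - t\<close> and must
    vanish.\<close>
  have "S * x - y * S = 0\<^sub>m n n"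
  proof (rule shifted_left_division_unique[OF y])
    show "Q - (R * ?X + const_mat S) \<in> carrier_mat n n" "S * x - y * S \<in> carrier_mat n n"
      using RX cS x y S by auto
    have "?Y * (Q - (R * ?X + const_mat S)) = ?Y * Q - (?Y * (R * ?X) + ?Y * const_mat S)"
      using mult_minus_distrib_mat[OF Y Q, of "R * ?X + const_mat S"] mult_add_distrib_mat[OF Y RX cS]
        RX cS by simp
    also have "?Y * Q = ?Y * (R * ?X) + const_mat S * ?X"
      unfolding PX Peq using add_mult_distrib_mat[OF YR cS X] assoc_mult_mat[OF Y R X] by simp
    also have "const_mat S * ?X = const_mat (S * x) - ?t \<cdot>\<^sub>m const_mat S"
      by (simp only: mult_shifted[OF x cS] const_poly.mat_hom_mult[OF S x])
    also have "?Y * const_mat S = const_mat (y * S) - ?t \<cdot>\<^sub>m const_mat S"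
      by (simp only: shifted_mult[OF y cS] const_poly.mat_hom_mult[OF y S])
    also have "?Y * (R * ?X) + (const_mat (S * x) - ?t \<cdot>\<^sub>m const_mat S) -
        (?Y * (R * ?X) + (const_mat (y * S) - ?t \<cdot>\<^sub>m const_mat S)) = const_mat (S * x - y * S)"
    proof -
      have "A + (const_mat B - D) - (A + (const_mat C - D)) = const_mat (B - C)"
        if "A \<in> carrier_mat n n" "B \<in> carrier_mat n n" "C \<in> carrier_mat n n" "D \<in> carrier_mat n n"
        for A B C D
        using that by (intro eq_matI) auto
      from this[OF mult_carrier_mat[OF Y RX] mult_carrier_mat[OF S x] mult_carrier_mat[OF y S]
          smult_carrier_mat[OF cS]]
      show ?thesis .
    qed
    finally show "?Y * (Q - (R * ?X + const_mat S)) = const_mat (S * x - y * S)" .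
  qed
  then have Sx: "S * x = y * S"
  proof -
    have "(S * x) $$ (i, j) = (y * S) $$ (i, j)" if "i < n" "j < n" for i j
    proof -
      have "(S * x - y * S) $$ (i, j) = 0" using \<open>S * x - y * S = 0\<^sub>m n n\<close> that by simp
      then show ?thesis using that S x y by (simp del: index_mult_mat(1))
    qed
    then show ?thesis using S x y by (intro eq_matI) (simp_all del: index_mult_mat(1))
  qed
  have QR: "Q * R' \<in> carrier_mat n n" and RS: "R * const_mat S' \<in> carrier_mat n n"
    and SS: "S * S' \<in> carrier_mat n n" using Q R R' cS' S S' by auto
  \<comment> \<open>With \<open>P' = (x - t) R' + S'\<close>, the identity \<open>P P' = 1\<close>
    becomes \<open>1 = (y - t) (Q R' + R S') + S S'\<close>. Thus \<open>1 - S S'\<close> is a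
    constant left multiple of \<open>y - t\<close>.\<close>
  have "1\<^sub>m n - S * S' = 0\<^sub>m n n"
  proof (rule shifted_left_division_unique[OF y])
    show "Q * R' + R * const_mat S' \<in> carrier_mat n n" "1\<^sub>m n - S * S' \<in> carrier_mat n n"
      using RS QR minus_carrier_mat[OF SS] by auto
    have "1\<^sub>m n = P * (?X * R') + P * const_mat S'"
      using PP' unfolding P'eq using mult_add_distrib_mat[OF P _ cS', of "?X * R'"] X R' by simp
    also have "P * (?X * R') = ?Y * (Q * R')"
      using assoc_mult_mat[OF P X R'] assoc_mult_mat[OF Y Q R'] PX by simp
    also have "P * const_mat S' = ?Y * (R * const_mat S') + const_mat (S * S')"
      unfolding Peq using add_mult_distrib_mat[OF YR cS cS'] assoc_mult_mat[OF Y R cS']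
      by (simp only: const_poly.mat_hom_mult[OF S S'])
    finally have 1: "1\<^sub>m n = ?Y * (Q * R') + (?Y * (R * const_mat S') + const_mat (S * S'))" .
    have c: "[:1 - z:] = 1 - [:z:]" for z :: complex
      by (metis const_poly.hom_minus const_poly.hom_one)
    have "const_mat (1\<^sub>m n - B) = 1\<^sub>m n - const_mat B" if "B \<in> carrier_mat n n" for B
      using that by (intro eq_matI) (auto simp: c)
    from this[OF SS] have "const_mat (1\<^sub>m n - S * S') = 1\<^sub>m n - const_mat (S * S')" .
    also have "\<dots> = ?Y * (Q * R') + ?Y * (R * const_mat S')"
      unfolding 1
    proof -
      have "A + (B + const_mat C) - const_mat C = A + B"
        if "A \<in> carrier_mat n n" "B \<in> carrier_mat n n" "C \<in> carrier_mat n n" for A B C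
        using that by (intro eq_matI) auto
      from this[OF mult_carrier_mat[OF Y QR] mult_carrier_mat[OF Y RS] SS]
      show "?Y * (Q * R') + (?Y * (R * const_mat S') + const_mat (S * S')) - const_mat (S * S') =
          ?Y * (Q * R') + ?Y * (R * const_mat S')" .
    qed
    also have "\<dots> = ?Y * (Q * R' + R * const_mat S')"
      using mult_add_distrib_mat[OF Y QR RS] by simp
    finally show "?Y * (Q * R' + R * const_mat S') = const_mat (1\<^sub>m n - S * S')" by simp
  qed
  then have SS1: "S * S' = 1\<^sub>m n"
  proof -
    have "(S * S') $$ (i, j) = 1\<^sub>m n $$ (i, j)" if "i < n" "j < n" for i j
    proof -
      have "(1\<^sub>m n - S * S') $$ (i, j) = 0" using \<open>1\<^sub>m n - S * S' = 0\<^sub>m n n\<close> that by simp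
      then show ?thesis using that S S' by (simp del: index_mult_mat(1))
    qed
    then show ?thesis using S S' by (intro eq_matI) (simp_all del: index_mult_mat(1))
  qed
  have "S * x * S' = y * (S * S')"
    unfolding Sx using assoc_mult_mat[OF y S S'] by simp
  then have "y = S * x * S'" unfolding SS1 using y by simp
  then show ?thesis using S S' SS1 mat_mult_left_right_inverse[OF S S' SS1] by blast
qed

lemma shifted_equiv_if_similar:
  assumes x: "x \<in> carrier_mat n n" and g: "g \<in> carrier_mat n n" and h: "h \<in> carrier_mat n n"
    and gh: "g * h = 1\<^sub>m n" "h * g = 1\<^sub>m n"
  shows "mat_equiv n (shifted_matrix n x) (shifted_matrix n (g * x * h))"
proof -
  let ?t = "[:0, 1:] :: complex poly"
  have cg: "const_mat g \<in> carrier_mat n n" and ch: "const_mat h \<in> carrier_mat n n"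
    and cx: "const_mat x \<in> carrier_mat n n" using g h x by auto
  have c1: "const_mat (1\<^sub>m n) = 1\<^sub>m n" by (intro eq_matI) auto
  have gh': "const_mat g * const_mat h = 1\<^sub>m n" "const_mat h * const_mat g = 1\<^sub>m n"
    using gh c1 by (simp_all flip: const_poly.mat_hom_mult[OF g h] const_poly.mat_hom_mult[OF h g])
  have u: "unimodular n (const_mat g)" "unimodular n (const_mat h)"
    by (rule unimodularI[OF cg ch gh'], rule unimodularI[OF ch cg gh'(2,1)])
  have gx: "g * x \<in> carrier_mat n n" using g x by auto
  have "const_mat g * shifted_matrix n x * const_mat h =
      (const_mat g * const_mat x - ?t \<cdot>\<^sub>m const_mat g) * const_mat h"
    by (simp add: mult_shifted[OF x cg])
  also have "\<dots> = const_mat g * const_mat x * const_mat h - ?t \<cdot>\<^sub>m const_mat g * const_mat h"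
    by (rule minus_mult_distrib_mat) (use cg cx ch in auto)
  also have "?t \<cdot>\<^sub>m const_mat g * const_mat h = ?t \<cdot>\<^sub>m 1\<^sub>m n"
    using mult_smult_assoc_mat[OF cg ch] gh'(1) by simp
  also have "const_mat g * const_mat x * const_mat h = const_mat (g * x * h)"
    by (simp only: const_poly.mat_hom_mult[OF gx h] const_poly.mat_hom_mult[OF g x])
  also have "const_mat (g * x * h) - ?t \<cdot>\<^sub>m 1\<^sub>m n = shifted_matrix n (g * x * h)"
    by (simp add: shifted_matrix_def)
  finally show ?thesis
    by (intro mat_equivI[OF shifted_matrix_carrier u]) simp
qed

section \<open>Invariant factors\<close>

lemma normalize_monic_poly:
  fixes p :: "complex poly"
  assumes "lead_coeff p = 1" shows "normalize p = p"
proof -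
  have "unit_factor p = 1" using assms by (simp add: unit_factor_poly_def)
  then show ?thesis using unit_factor_mult_normalize[of p] by simp
qed

lemma lead_coeff_normalize_poly:
  fixes p :: "complex poly"
  assumes "p \<noteq> 0" shows "lead_coeff (normalize p) = 1"
  using lead_coeff_Gcd_complex_poly[of p "{p}"] assms by simp

lemma degree_normalize_poly:
  fixes p :: "complex poly" shows "degree (normalize p) = degree p"
  by (cases "p = 0") (auto intro!: antisym dvd_imp_degree_le)

lemma monic_dvd_degree_eq:
  fixes p q :: "complex poly"
  assumes "p dvd q" "lead_coeff p = 1" "lead_coeff q = 1" "degree p = degree q"
  shows "p = q"
proof -
  obtain r where r: "q = p * r" using assms(1) by (elim dvdE)
  have "q \<noteq> 0" "p \<noteq> 0" using assms by auto
  then have "r \<noteq> 0" using r by auto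
  then have "degree r = 0" using assms(4) r \<open>p \<noteq> 0\<close> by (simp add: degree_mult_eq)
  moreover have "lead_coeff r = 1" using assms(2,3) r by (simp add: lead_coeff_mult)
  ultimately have "r = 1" by (metis coeff_pCons_0 degree_eq_zeroE one_pCons)
  then show ?thesis using r by simp
qed

lemma lead_coeff_prod_monic:
  fixes f :: "'i \<Rightarrow> complex poly"
  assumes "\<And>i. i \<in> I \<Longrightarrow> lead_coeff (f i) = 1"
  shows "lead_coeff (\<Prod>i\<in>I. f i) = 1"
  using assms by (simp add: lead_coeff_prod)

lemma det_shifted_matrix:
  assumes x: "x \<in> carrier_mat n n"
  shows "degree (det (shifted_matrix n x)) = n" "det (shifted_matrix n x) \<noteq> 0"
proof -
  have "shifted_matrix n x = (-1) \<cdot>\<^sub>m char_poly_matrix x"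
    using x by (intro eq_matI) (auto simp: shifted_matrix_def char_poly_matrix_def)
  then have "det (shifted_matrix n x) = (-1) ^ n * char_poly x"
    using x by (simp add: char_poly_def char_poly_matrix_def)
  moreover have "(-1 :: complex poly) ^ n = 1 \<or> (-1 :: complex poly) ^ n = -1"
    by (cases "even n") auto
  ultimately have *: "det (shifted_matrix n x) = char_poly x \<or> det (shifted_matrix n x) = - char_poly x"
    by auto
  have c: "degree (char_poly x) = n" "coeff (char_poly x) n = 1" using degree_monic_char_poly[OF x] by auto
  have "char_poly x \<noteq> 0" using c(2) by auto
  then show "degree (det (shifted_matrix n x)) = n" "det (shifted_matrix n x) \<noteq> 0"
    using * c(1) by auto
qed

lemma minors_full:
  assumes A: "A \<in> carrier_mat n n" shows "minors n n A = {det A}"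
proof -
  have "submatrix A {..<n} {..<n} = A"
  proof (rule eq_matI)
    have c: "submatrix A {..<n} {..<n} \<in> carrier_mat n n"
      using submatrix_carrier[OF A, of "{..<n}" "{..<n}"] by simp
    then show "dim_row (submatrix A {..<n} {..<n}) = dim_row A" "dim_col (submatrix A {..<n} {..<n}) = dim_col A"
      using A by auto
    fix i j assume "i < dim_row A" "j < dim_col A"
    then show "submatrix A {..<n} {..<n} $$ (i, j) = A $$ (i, j)"
      using submatrix_index'[OF A, of "{..<n}" "{..<n}" i j] A by (simp add: pick_lessThan)
  qed
  moreover have "I \<subseteq> {..<n} \<and> card I = n \<longleftrightarrow> I = {..<n}" for I
    using card_subset_eq[of "{..<n}" I] by auto
  then have "minors n n A = {det (submatrix A I J) | I J. I = {..<n} \<and> J = {..<n}}"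
    unfolding minors_def by metis
  ultimately show ?thesis by simp
qed

text \<open>Monic entries make the partial products equal to the gcds of minors, not merely
  associated to them, so the entries are determined by \<open>x\<close>.\<close>

definition smith_form :: "nat \<Rightarrow> complex mat \<Rightarrow> (nat \<Rightarrow> complex poly) \<Rightarrow> bool" where
  "smith_form n x d \<longleftrightarrow> (\<forall>i. Suc i < n \<longrightarrow> d i dvd d (Suc i)) \<and> (\<forall>i<n. lead_coeff (d i) = 1) \<and>
     mat_equiv n (shifted_matrix n x) (mat_diag n d)"

lemma smith_form_Gcd_minors:
  assumes "smith_form n x d" "k \<le> n"
  shows "Gcd (minors n k (shifted_matrix n x)) = (\<Prod>j<k. d j)"
proof -
  have "Gcd (minors n k (shifted_matrix n x)) = normalize (\<Prod>j<k. d j)"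
    using assms Gcd_minors_diag[of n d k] Gcd_minors_mat_equiv unfolding smith_form_def by metis
  also have "\<dots> = (\<Prod>j<k. d j)"
    using assms by (intro normalize_monic_poly lead_coeff_prod_monic) (auto simp: smith_form_def)
  finally show ?thesis .
qed

text \<open>\<open>det (x - t)\<close> is nonzero, so no diagonal entry vanishes and each can be
  made monic.\<close>

lemma smith_form_exists:
  assumes x: "x \<in> carrier_mat n n"
  shows "\<exists>d. smith_form n x d"
proof -
  let ?X = "shifted_matrix n x"
  obtain d where d: "\<And>i. Suc i < n \<Longrightarrow> d i dvd d (Suc i)" "mat_equiv n ?X (mat_diag n d)"
    using smith_normal_form_exists[OF shifted_matrix_carrier, of n x] by auto
  have "normalize (det ?X) = Gcd (minors n n (mat_diag n d))"
    using Gcd_minors_mat_equiv[OF d(2), of n] minors_full[OF shifted_matrix_carrier, of n x] by simp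
  also have "\<dots> = normalize (\<Prod>j<n. d j)" by (rule Gcd_minors_diag) (use d(1) in auto)
  finally have "(\<Prod>j<n. d j) \<noteq> 0" using det_shifted_matrix(2)[OF x] by (metis normalize_eq_0_iff)
  then have nz: "d i \<noteq> 0" if "i < n" for i using that by simp
  have "mat_equiv n (mat_diag n (\<lambda>i. normalize (d i))) (mat_diag n d)"
    by (rule mat_equiv_diag_scale[where u = "\<lambda>i. unit_factor (d i)" and v = "\<lambda>i. 1 div unit_factor (d i)"])
       (use nz in \<open>simp_all add: unit_factor_mult_normalize\<close>)
  then have "mat_equiv n ?X (mat_diag n (\<lambda>i. normalize (d i)))"
    by (rule mat_equiv_trans[OF d(2) mat_equiv_sym])
  then have "smith_form n x (\<lambda>i. normalize (d i))"
    using d(1) nz lead_coeff_normalize_poly unfolding smith_form_def by simp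
  then show ?thesis by blast
qed

lemma minor_gcd_smith_form:
  assumes "smith_form n x d" "i \<in> {1..Suc n}"
  shows "minor_gcd n x i = (\<Prod>j<n + 1 - i. d j)"
  using assms smith_form_Gcd_minors[OF assms(1), of "n + 1 - i"]
  by (cases "i \<le> n") (auto simp: minor_gcd_def)

text \<open>The two orders run in opposite directions: the \<open>i\<close>-th gcd is the product of
  the first \<open>n + 1 - i\<close> Smith entries, so passing from \<open>i + 1\<close> to
  \<open>i\<close> adds the entry of index \<open>n - i\<close>.\<close>

lemma inv_factor_smith_form:
  assumes s: "smith_form n x d" and i: "i \<in> {1..n}"
  shows "inv_factor n x i = d (n - i)"
proof -
  have e: "n + 1 - i = Suc (n - i)" "n + 1 - (i + 1) = n - i" using i by auto
  have "minor_gcd n x i = (\<Prod>j<n - i. d j) * d (n - i)"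
    using minor_gcd_smith_form[OF s, of i] i unfolding e by simp
  moreover have "minor_gcd n x (i + 1) = (\<Prod>j<n - i. d j)"
    using minor_gcd_smith_form[OF s, of "i + 1"] i unfolding e(2) by simp
  moreover have "d j \<noteq> 0" if "j < n" for j
    using s that unfolding smith_form_def by (metis leading_coeff_0_iff zero_neq_one)
  then have "(\<Prod>j<n - i. d j) \<noteq> 0" using i by simp
  ultimately show ?thesis using i by (simp add: inv_factor_def)
qed

lemma smith_form_inv_factor:
  assumes x: "x \<in> carrier_mat n n"
  shows "smith_form n x (\<lambda>j. inv_factor n x (n - j))"
proof -
  obtain d where d: "smith_form n x d" using smith_form_exists[OF x] by blast
  have e: "inv_factor n x (n - j) = d j" if "j < n" for j
    using inv_factor_smith_form[OF d, of "n - j"] that by simp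
  then have "mat_diag n (\<lambda>j. inv_factor n x (n - j)) = mat_diag n d"
    by (intro eq_matI) (auto simp: mat_diag_def)
  then show ?thesis using d e by (auto simp: smith_form_def)
qed

lemma inv_factor_Suc_n: "inv_factor n x (Suc n) = 1"
  by (simp add: inv_factor_def)

lemma lead_coeff_inv_factor:
  assumes "x \<in> carrier_mat n n" "i \<ge> 1"
  shows "lead_coeff (inv_factor n x i) = 1"
proof (cases "i \<le> n")
  case True
  then have "n - (n - i) = i" "n - i < n" using assms(2) by auto
  then show ?thesis
    using smith_form_inv_factor[OF assms(1)] unfolding smith_form_def by metis
qed (simp add: inv_factor_def)

lemma inv_factor_dvd:
  assumes x: "x \<in> carrier_mat n n" and i: "i \<in> {1..n}"
  shows "inv_factor n x (i + 1) dvd inv_factor n x i"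
proof (cases "i = n")
  case False
  then have "Suc (n - Suc i) < n" "n - (n - Suc i) = i + 1" "n - Suc (n - Suc i) = i" using i by auto
  then show ?thesis using smith_form_inv_factor[OF x] unfolding smith_form_def by metis
qed (simp add: inv_factor_Suc_n)

lemma inv_factor_eq_ratio_mult:
  assumes x: "x \<in> carrier_mat n n" and i: "i \<in> {1..n}"
  shows "inv_factor n x i = inv_factor_ratio n x i * inv_factor n x (i + 1)"
  unfolding inv_factor_ratio_def using inv_factor_dvd[OF assms] by simp

lemma lead_coeff_inv_factor_ratio:
  assumes x: "x \<in> carrier_mat n n" and i: "i \<in> {1..n}"
  shows "lead_coeff (inv_factor_ratio n x i) = 1"
  using arg_cong[OF inv_factor_eq_ratio_mult[OF assms], of lead_coeff]
    lead_coeff_inv_factor[OF x, of i] lead_coeff_inv_factor[OF x, of "i + 1"] i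
  unfolding lead_coeff_mult by simp

lemma minor_gcd_eq_prod_inv_factor:
  assumes x: "x \<in> carrier_mat n n" and i: "i \<in> {1..Suc n}"
  shows "minor_gcd n x i = (\<Prod>j\<in>{i..n}. inv_factor n x j)"
proof -
  have "minor_gcd n x i = (\<Prod>j<n + 1 - i. inv_factor n x (n - j))"
    by (rule minor_gcd_smith_form[OF smith_form_inv_factor[OF x] i])
  also have "\<dots> = (\<Prod>j\<in>{i..n}. inv_factor n x j)"
    by (rule prod.reindex_bij_witness[of _ "\<lambda>j. n - j" "\<lambda>j. n - j"]) (use i in auto)
  finally show ?thesis .
qed

lemma inv_factor_cong:
  assumes "mat_equiv n (shifted_matrix n x) (shifted_matrix n y)"
  shows "inv_factor n x = inv_factor n y"
proof -
  have "minor_gcd n x = minor_gcd n y"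
    by (rule ext) (simp add: minor_gcd_def Gcd_minors_mat_equiv[OF assms])
  then show ?thesis by (simp add: fun_eq_iff inv_factor_def)
qed

lemma similar_if_inv_factor_eq:
  assumes x: "x \<in> carrier_mat n n" and y: "y \<in> carrier_mat n n"
    and eq: "\<And>i. i \<in> {1..n} \<Longrightarrow> inv_factor n x i = inv_factor n y i"
  shows "\<exists>S\<in>carrier_mat n n. \<exists>S'\<in>carrier_mat n n. S * S' = 1\<^sub>m n \<and> S' * S = 1\<^sub>m n \<and> y = S * x * S'"
proof (rule similar_if_shifted_equiv[OF x y])
  have "mat_diag n (\<lambda>j. inv_factor n x (n - j)) = mat_diag n (\<lambda>j. inv_factor n y (n - j))"
    by (rule eq_matI) (auto simp: mat_diag_def eq)
  moreover have "mat_equiv n (shifted_matrix n x) (mat_diag n (\<lambda>j. inv_factor n x (n - j)))"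
    "mat_equiv n (shifted_matrix n y) (mat_diag n (\<lambda>j. inv_factor n y (n - j)))"
    using smith_form_inv_factor[OF x] smith_form_inv_factor[OF y] by (auto simp: smith_form_def)
  ultimately show "mat_equiv n (shifted_matrix n x) (shifted_matrix n y)"
    by (metis mat_equiv_sym mat_equiv_trans)
qed

section \<open>Companion matrices\<close>

definition companion :: "nat \<Rightarrow> complex poly \<Rightarrow> complex mat" where
  "companion m q = mat m m (\<lambda>(i, j). if Suc j = m then - coeff q i else if i = Suc j then 1 else 0)"

lemma companion_carrier: "companion m q \<in> carrier_mat m m"
  by (simp add: companion_def)

text \<open>The row vector \<open>(1, t, t\<^sup>2, \<dots>)\<close> annihilates all columns of \<open>C - t\<close> but the last one,
  where it gives \<open>-q\<close>. Hence \<open>q\<close> divides the determinant.\<close>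

lemma dvd_det_companion:
  assumes m: "m > 0" and q: "degree q = m" "lead_coeff q = 1"
  shows "q dvd det (shifted_matrix m (companion m q))"
proof -
  let ?N = "shifted_matrix m (companion m q)" and ?t = "\<lambda>i. monom (1 :: complex) i"
  have N: "?N \<in> carrier_mat m m" by (rule shifted_matrix_carrier)
  have idx: "?N $$ (i, l) = (if i = l then [:companion m q $$ (i, l), -1:] else [:companion m q $$ (i, l):])"
    if "i < m" "l < m" for i l
    by (rule shifted_matrix_index[OF companion_carrier that])
  have col: "(\<Sum>i = 0..<m. ?t i * ?N $$ (i, l)) = (if Suc l = m then - q else 0)" if l: "l < m" for l
  proof -
    have e: "?t i * ?N $$ (i, l) =
        monom (companion m q $$ (i, l)) i - (if i = l then monom 1 (Suc i) else 0)" if "i < m" for i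
    proof -
      have "[:c, -1:] = [:c:] - monom 1 1" for c :: complex by (simp add: monom_Suc monom_0 pCons_minus_one)
      then show ?thesis
        using idx[OF that l] by (simp add: right_diff_distrib mult_monom smult_monom)
    qed
    have s: "(\<Sum>i = 0..<m. ?t i * ?N $$ (i, l)) =
        (\<Sum>i = 0..<m. monom (companion m q $$ (i, l)) i) - monom 1 (Suc l)"
      using l by (simp add: e sum_subtractf sum.delta)
    show ?thesis
    proof (cases "Suc l = m")
      case True
      have "(\<Sum>i = 0..<m. monom (companion m q $$ (i, l)) i) = - (\<Sum>i = 0..<m. monom (coeff q i) i)"
        using True by (simp add: companion_def minus_monom flip: sum_negf)
      then have "(\<Sum>i = 0..<m. ?t i * ?N $$ (i, l)) =
          - ((\<Sum>i = 0..<m. monom (coeff q i) i) + monom 1 m)"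
        unfolding s True by (simp only: minus_add_distrib add_uminus_conv_diff)
      also have "(\<Sum>i = 0..<m. monom (coeff q i) i) + monom 1 m = q"
        using poly_as_sum_of_monoms[of q] q by (simp add: atLeast0LessThan lessThan_Suc_atMost[symmetric])
      finally show ?thesis using True by simp
    next
      case False
      then have "(\<Sum>i = 0..<m. monom (companion m q $$ (i, l)) i) =
          (\<Sum>i = 0..<m. if i = Suc l then monom 1 (Suc l) else 0)"
        using l by (intro sum.cong) (auto simp: companion_def)
      then show ?thesis using False l s by (simp add: sum.delta)
    qed
  qed
  have adj: "adj_mat ?N \<in> carrier_mat m m" "?N * adj_mat ?N = det ?N \<cdot>\<^sub>m 1\<^sub>m m" using adj_mat[OF N] by auto
  \<comment> \<open>The first column of \<open>N * adj N = det N * 1\<close> is paired with the row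
    vector of powers of \<open>t\<close>; only the entry at index 0 survives, where the power is
    1.\<close>
  have "det ?N = (\<Sum>i = 0..<m. ?t i * (det ?N \<cdot>\<^sub>m 1\<^sub>m m) $$ (i, 0))"
  proof -
    have "(\<Sum>i = 0..<m. ?t i * (det ?N \<cdot>\<^sub>m 1\<^sub>m m) $$ (i, 0)) = (\<Sum>i = 0..<m. if i = 0 then det ?N else 0)"
      using m by (intro sum.cong) (auto simp: monom_0)
    then show ?thesis using m by simp
  qed
  also have "\<dots> = (\<Sum>i = 0..<m. ?t i * (\<Sum>l = 0..<m. ?N $$ (i, l) * adj_mat ?N $$ (l, 0)))"
    unfolding adj(2)[symmetric] using N adj(1) m by (intro sum.cong) (auto simp: scalar_prod_def)
  also have "\<dots> = (\<Sum>l = 0..<m. (\<Sum>i = 0..<m. ?t i * ?N $$ (i, l)) * adj_mat ?N $$ (l, 0))"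
    by (simp add: sum_distrib_left sum_distrib_right mult.assoc) (rule sum.swap)
  also have "\<dots> = (\<Sum>l = 0..<m. if Suc l = m then - q * adj_mat ?N $$ (l, 0) else 0)"
    by (intro sum.cong refl) (simp add: col)
  also have "q dvd \<dots>" by (rule dvd_sum) auto
  finally show ?thesis .
qed

text \<open>Deleting the first row and the last column moves the subdiagonal ones onto the diagonal
  of an upper triangular matrix.\<close>

lemma companion_minor_one:
  assumes m: "m > 0"
  shows "1 \<in> minors m (m - 1) (shifted_matrix m (companion m q))"
proof -
  let ?N = "shifted_matrix m (companion m q)" and ?I = "{1..<m}" and ?J = "{..<m - 1}"
  have N: "?N \<in> carrier_mat m m" by (rule shifted_matrix_carrier)
  have IJ: "?I \<subseteq> {..<m}" "?J \<subseteq> {..<m}" by auto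
  have pick: "pick ?I i = Suc i" if "i < m - 1" for i
  proof -
    have "{a \<in> ?I. a < Suc i} = {1..<Suc i}" using that by auto
    then show ?thesis using pick_card_in_set[of "Suc i" ?I] that by simp
  qed
  have c: "submatrix ?N ?I ?J \<in> carrier_mat (m - 1) (m - 1)"
    using submatrix_carrier[OF N IJ] by simp
  have idx: "submatrix ?N ?I ?J $$ (i, j) = (if i = j then 1 else if j = Suc i then [:0, -1:] else 0)"
    if ij: "i < m - 1" "j < m - 1" for i j
  proof -
    have "submatrix ?N ?I ?J $$ (i, j) = ?N $$ (Suc i, j)"
      using submatrix_index'[OF N IJ, of i j] ij pick[OF ij(1)] pick_lessThan[OF ij(2)] by simp
    also have "\<dots> = (if Suc i = j then [:companion m q $$ (Suc i, j), -1:] else [:companion m q $$ (Suc i, j):])"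
      by (rule shifted_matrix_index[OF companion_carrier]) (use ij in auto)
    also have "\<dots> = (if i = j then 1 else if j = Suc i then [:0, -1:] else 0)"
      using ij by (auto simp: companion_def)
    finally show ?thesis .
  qed
  have "upper_triangular (submatrix ?N ?I ?J)"
    using c idx by (auto simp: upper_triangular_def)
  then have "det (submatrix ?N ?I ?J) = prod_list (diag_mat (submatrix ?N ?I ?J))"
    by (rule det_upper_triangular[OF _ c])
  also have "diag_mat (submatrix ?N ?I ?J) = replicate (m - 1) 1"
    using c idx by (intro nth_equalityI) (auto simp: diag_mat_def)
  finally have "det (submatrix ?N ?I ?J) = 1" by simp
  then show ?thesis
    unfolding minors_def using IJ by (intro CollectI exI[of _ ?I] exI[of _ ?J]) auto
qed

text \<open>A minor of size \<open>m - 1\<close> equal to 1 forces all Smith entries but the last to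
  be 1. The last is then the normalized determinant, a monic multiple of \<open>q\<close> of the
  same degree.\<close>

lemma smith_form_companion:
  assumes m: "m > 0" and q: "degree q = m" "lead_coeff q = 1"
  shows "smith_form m (companion m q) (\<lambda>i. if Suc i = m then q else 1)"
proof -
  let ?N = "shifted_matrix m (companion m q)"
  have N: "?N \<in> carrier_mat m m" by (rule shifted_matrix_carrier)
  obtain d where d: "smith_form m (companion m q) d" using smith_form_exists[OF companion_carrier] by blast
  have u: "(\<Prod>j<m - 1. d j) dvd 1"
    using Gcd_dvd[OF companion_minor_one[OF m, of q]]
    unfolding smith_form_Gcd_minors[OF d diff_le_self] .
  have d1: "d j = 1" if "j < m - 1" for j
  proof -
    have "d j dvd (\<Prod>j<m - 1. d j)" using that by (intro dvd_prodI) auto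
    then have "normalize (d j) = 1" using u dvd_trans by (metis is_unit_normalize)
    moreover have "lead_coeff (d j) = 1" using d that by (simp add: smith_form_def)
    ultimately show ?thesis using normalize_monic_poly by metis
  qed
  have "normalize (det ?N) = (\<Prod>j<m. d j)"
    using smith_form_Gcd_minors[OF d, of m] minors_full[OF N] by simp
  also have "\<dots> = (\<Prod>j<Suc (m - 1). d j)" using m by simp
  also have "\<dots> = d (m - 1)" unfolding prod.lessThan_Suc by (simp add: d1)
  finally have nd: "normalize (det ?N) = d (m - 1)" .
  have "q = d (m - 1)"
  proof (rule monic_dvd_degree_eq)
    show "q dvd d (m - 1)" unfolding nd[symmetric] using dvd_det_companion[OF assms] by simp
    show "lead_coeff (d (m - 1)) = 1" using d m by (simp add: smith_form_def)
    show "degree q = degree (d (m - 1))"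
      unfolding nd[symmetric] degree_normalize_poly using det_shifted_matrix(1)[OF companion_carrier] q(1) by simp
  qed (rule q(2))
  then have e: "d j = (if Suc j = m then q else 1)" if "j < m" for j
    using d1[of j] that by auto
  then have "mat_diag m d = mat_diag m (\<lambda>i. if Suc i = m then q else 1)"
    by (intro eq_matI) (auto simp: mat_diag_def)
  then show ?thesis using d q by (auto simp: smith_form_def)
qed

section \<open>Block sums of companion matrices\<close>

lemma mat_diag_append:
  "four_block_mat (mat_diag (length xs) ((!) xs)) (0\<^sub>m (length xs) (length ys))
     (0\<^sub>m (length ys) (length xs)) (mat_diag (length ys) ((!) ys)) =
   mat_diag (length (xs @ ys)) ((!) (xs @ ys))"
  by (rule eq_matI) (auto simp: mat_diag_def nth_append)

lemma shifted_four_block: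
  assumes A: "A \<in> carrier_mat p p" and B: "B \<in> carrier_mat q q"
  shows "shifted_matrix (p + q) (four_block_mat A (0\<^sub>m p q) (0\<^sub>m q p) B) =
    four_block_mat (shifted_matrix p A) (0\<^sub>m p q) (0\<^sub>m q p) (shifted_matrix q B)"
  by (rule eq_matI) (use A B in \<open>auto simp: shifted_matrix_def\<close>)

text \<open>The Smith diagonal of one companion block. An empty block contributes no entry at all,
  not even \<open>q = 1\<close>.\<close>

definition companion_diag :: "nat \<Rightarrow> complex poly \<Rightarrow> complex poly list" where
  "companion_diag m q = (if m = 0 then [] else replicate (m - 1) 1 @ [q])"

lemma length_companion_diag: "length (companion_diag m q) = m"
  by (simp add: companion_diag_def)

definition block_companion :: "(nat \<Rightarrow> nat) \<Rightarrow> (nat \<Rightarrow> complex poly) \<Rightarrow> nat list \<Rightarrow> complex mat" where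
  "block_companion b q ks = diag_block_mat (map (\<lambda>k. companion (b k) (q k)) ks)"

lemma block_companion_carrier:
  "block_companion b q ks \<in> carrier_mat (\<Sum>k\<leftarrow>ks. b k) (\<Sum>k\<leftarrow>ks. b k)"
  unfolding block_companion_def carrier_mat_def
  by (simp add: dim_diag_block_mat o_def companion_def)

lemma block_companion_Cons:
  "block_companion b q (k # ks) = four_block_mat (companion (b k) (q k))
     (0\<^sub>m (b k) (\<Sum>k\<leftarrow>ks. b k)) (0\<^sub>m (\<Sum>k\<leftarrow>ks. b k) (b k)) (block_companion b q ks)"
  using carrier_matD[OF companion_carrier[of "b k" "q k"]] carrier_matD[OF block_companion_carrier[of b q ks]]
  unfolding block_companion_def by (simp add: Let_def)

lemma shifted_block_companion:
  assumes "\<And>k. k \<in> set ks \<Longrightarrow> degree (q k) = b k" "\<And>k. k \<in> set ks \<Longrightarrow> lead_coeff (q k) = 1"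
  shows "mat_equiv (\<Sum>k\<leftarrow>ks. b k) (shifted_matrix (\<Sum>k\<leftarrow>ks. b k) (block_companion b q ks))
    (mat_diag (\<Sum>k\<leftarrow>ks. b k) ((!) (concat (map (\<lambda>k. companion_diag (b k) (q k)) ks))))"
  using assms
proof (induction ks)
  case Nil
  have "shifted_matrix 0 (block_companion b q []) = mat_diag 0 ((!) [])"
    by (rule eq_matI) (simp_all add: shifted_matrix_def mat_diag_def)
  then show ?case using mat_equiv_refl[OF shifted_matrix_carrier[of 0 "block_companion b q []"]] by simp
next
  case (Cons k ks)
  let ?N = "\<Sum>k\<leftarrow>ks. b k" and ?ys = "concat (map (\<lambda>k. companion_diag (b k) (q k)) ks)"
  have IH: "mat_equiv ?N (shifted_matrix ?N (block_companion b q ks)) (mat_diag ?N ((!) ?ys))"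
    using Cons by simp
  have l: "length ?ys = ?N" by (simp add: length_concat o_def length_companion_diag)
  have "mat_equiv (b k) (shifted_matrix (b k) (companion (b k) (q k))) (mat_diag (b k) ((!) (companion_diag (b k) (q k))))"
  proof (cases "b k = 0")
    case True
    have "shifted_matrix 0 (companion 0 (q k)) = mat_diag 0 ((!) [])"
      by (rule eq_matI) (simp_all add: shifted_matrix_def mat_diag_def)
    then show ?thesis using True mat_equiv_refl[OF shifted_matrix_carrier[of 0 "companion 0 (q k)"]]
      by (simp add: companion_diag_def)
  next
    case False
    then have "mat_diag (b k) ((!) (companion_diag (b k) (q k))) =
        mat_diag (b k) (\<lambda>i. if Suc i = b k then q k else 1)"
      by (intro eq_matI) (auto simp: mat_diag_def companion_diag_def nth_append)
    then show ?thesis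
      using smith_form_companion[of "b k" "q k"] Cons.prems False by (simp add: smith_form_def)
  qed
  from mat_equiv_four_block[OF this IH]
  have "mat_equiv (b k + ?N)
     (four_block_mat (shifted_matrix (b k) (companion (b k) (q k))) (0\<^sub>m (b k) ?N) (0\<^sub>m ?N (b k))
       (shifted_matrix ?N (block_companion b q ks)))
     (mat_diag (b k + ?N) ((!) (companion_diag (b k) (q k) @ ?ys)))"
    using mat_diag_append[of "companion_diag (b k) (q k)" ?ys] l by (simp add: length_companion_diag)
  then show ?case
    using shifted_four_block[OF companion_carrier[of "b k" "q k"] block_companion_carrier[of b q ks]]
    by (simp add: block_companion_Cons)
qed

text \<open>A block of size \<open>m > 0\<close> contributes \<open>q\<close> and
  \<open>m - 1\<close> ones; for \<open>m = 0\<close> it contributes nothing while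
  \<open>q = 1\<close>. The additional 1 on the left gives both cases the same form without
  subtraction.\<close>

lemma mset_companion_diag:
  assumes "degree q = m" "lead_coeff q = 1"
  shows "mset (companion_diag m q) + {#1#} = {#q#} + replicate_mset m 1"
proof (cases "m = 0")
  case True
  then have "q = 1" using assms by (metis degree_eq_zeroE coeff_pCons_0 one_pCons)
  then show ?thesis using True by (simp add: companion_diag_def)
next
  case False
  then obtain k where "m = Suc k" by (cases m) auto
  then show ?thesis by (simp add: companion_diag_def)
qed

lemma mset_concat_companion_diag:
  assumes "\<And>k. k \<in> set ks \<Longrightarrow> degree (q k) = b k" "\<And>k. k \<in> set ks \<Longrightarrow> lead_coeff (q k) = 1"
  shows "mset (concat (map (\<lambda>k. companion_diag (b k) (q k)) ks)) + replicate_mset (length ks) 1 =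
    mset (map q ks) + replicate_mset (\<Sum>k\<leftarrow>ks. b k) 1"
  using assms
proof (induction ks)
  case (Cons k ks)
  let ?M = "mset (concat (map (\<lambda>k. companion_diag (b k) (q k)) ks))"
  have rep: "replicate_mset (i + j) (1 :: complex poly) = replicate_mset i 1 + replicate_mset j 1" for i j
    by (induction i) auto
  have "mset (concat (map (\<lambda>k. companion_diag (b k) (q k)) (k # ks))) + replicate_mset (length (k # ks)) 1
      = (mset (companion_diag (b k) (q k)) + {#1#}) + (?M + replicate_mset (length ks) 1)"
    by (simp add: ac_simps)
  also have "\<dots> = ({#q k#} + replicate_mset (b k) 1) + (mset (map q ks) + replicate_mset (\<Sum>k\<leftarrow>ks. b k) 1)"
    using Cons mset_companion_diag[of "q k" "b k"] by simp
  finally show ?case by (simp add: rep ac_simps)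
qed simp

text \<open>There are \<open>n\<close> blocks of total size \<open>n\<close>, so the
  \<open>n\<close> ones added per block cancel against the \<open>n\<close> ones that the blocks
  supply. The diagonal is therefore a rearrangement of \<open>q 1\<close>, ...,
  \<open>q n\<close>.\<close>

lemma smith_form_block_companion:
  assumes deg: "\<And>i. i \<in> {1..n} \<Longrightarrow> degree (q i) = b i" and lc: "\<And>i. i \<in> {1..n} \<Longrightarrow> lead_coeff (q i) = 1"
    and chain: "\<And>i. i \<in> {1..<n} \<Longrightarrow> q (Suc i) dvd q i" and sum: "(\<Sum>i = 1..n. b i) = n"
  shows "smith_form n (block_companion b q [1..<Suc n]) (\<lambda>j. q (n - j))"
proof -
  let ?ks = "[1..<Suc n]"
  let ?xs = "concat (map (\<lambda>k. companion_diag (b k) (q k)) ?ks)" and ?ys = "map (\<lambda>j. q (n - j)) [0..<n]"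
  have set: "set ?ks = {1..n}" by auto
  have N: "(\<Sum>k\<leftarrow>?ks. b k) = n"
    using sum sum_set_upt_conv_sum_list_nat[of b 1 "Suc n"] by (simp add: atLeastLessThanSuc_atLeastAtMost del: upt_Suc)
  have "mset ?xs + replicate_mset (length ?ks) 1 = mset (map q ?ks) + replicate_mset n 1"
    using mset_concat_companion_diag[of ?ks q b] deg lc unfolding set N by blast
  moreover have "length ?ks = n" by simp
  ultimately have "mset ?xs = mset (map q ?ks)" by (metis add_right_imp_eq)
  also have "map q ?ks = rev ?ys"
    by (rule nth_equalityI) (auto simp: rev_nth simp del: upt_Suc)
  finally have "mset ?xs = mset ?ys" by simp
  then obtain p where p: "p permutes {..<length ?ys}" "permute_list p ?ys = ?xs"
    by (rule mset_eq_permutation)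
  have l: "length ?ys = n" by simp
  have p': "p permutes {0..<n}" using p(1) by (simp add: atLeast0LessThan)
  have "?xs ! i = q (n - p i)" if "i < n" for i
  proof -
    have "p i < n" using permutes_in_image[OF p', of i] that by simp
    then show ?thesis using permute_list_nth[OF p(1), of i] that unfolding p(2) by simp
  qed
  then have "mat_diag n ((!) ?xs) = mat_diag n ((\<lambda>j. q (n - j)) \<circ> p)"
    by (intro eq_matI) (auto simp: mat_diag_def)
  moreover have "mat_equiv n (shifted_matrix n (block_companion b q ?ks)) (mat_diag n ((!) ?xs))"
    using shifted_block_companion[of ?ks q b] deg lc unfolding set N by blast
  ultimately have "mat_equiv n (shifted_matrix n (block_companion b q ?ks)) (mat_diag n (\<lambda>j. q (n - j)))"
    using mat_equiv_trans mat_equiv_diag_permute[OF p'] by metis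
  moreover have "q (n - i) dvd q (n - Suc i)" if "Suc i < n" for i
  proof -
    have "Suc (n - Suc i) = n - i" "n - Suc i \<in> {1..<n}" using that by auto
    then show ?thesis using chain[of "n - Suc i"] by simp
  qed
  moreover have "lead_coeff (q (n - i)) = 1" if "i < n" for i using that lc[of "n - i"] by auto
  ultimately show ?thesis by (simp add: smith_form_def)
qed

section \<open>The adjoint action on a sheet\<close>

lemma group_SL: "group (SL n)"
proof (rule groupI)
  fix x assume x: "x \<in> carrier (SL n)"
  then have xc: "x \<in> carrier_mat n n" and d: "det x = 1" by (auto simp: SL_def)
  have a: "adj_mat x \<in> carrier_mat n n" "x * adj_mat x = 1\<^sub>m n" "adj_mat x * x = 1\<^sub>m n"
    using adj_mat[OF xc] d by auto
  have "det x * det (adj_mat x) = 1" using det_mult[OF xc a(1)] a(2) by simp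
  then have "det (adj_mat x) = 1" using d by simp
  then show "\<exists>y\<in>carrier (SL n). y \<otimes>\<^bsub>SL n\<^esub> x = \<one>\<^bsub>SL n\<^esub>"
    using a by (intro bexI[of _ "adj_mat x"]) (simp_all add: SL_def)
next
  fix x y assume "x \<in> carrier (SL n)" "y \<in> carrier (SL n)"
  then show "x \<otimes>\<^bsub>SL n\<^esub> y \<in> carrier (SL n)" by (simp add: SL_def det_mult[of _ n] mult_carrier_mat[of _ n n])
next
  fix x y z assume "x \<in> carrier (SL n)" "y \<in> carrier (SL n)" "z \<in> carrier (SL n)"
  then show "x \<otimes>\<^bsub>SL n\<^esub> y \<otimes>\<^bsub>SL n\<^esub> z = x \<otimes>\<^bsub>SL n\<^esub> (y \<otimes>\<^bsub>SL n\<^esub> z)"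
    by (simp add: SL_def assoc_mult_mat[of _ n n _ n _ n])
qed (auto simp: SL_def)

lemma SL_carrier: "g \<in> carrier (SL n) \<Longrightarrow> g \<in> carrier_mat n n"
  by (simp add: SL_def)

lemma SL_inv:
  assumes "g \<in> carrier (SL n)"
  shows "inv\<^bsub>SL n\<^esub> g \<in> carrier_mat n n" "g * inv\<^bsub>SL n\<^esub> g = 1\<^sub>m n" "inv\<^bsub>SL n\<^esub> g * g = 1\<^sub>m n"
  using group.inv_closed[OF group_SL assms] group.r_inv[OF group_SL assms] group.l_inv[OF group_SL assms]
  by (simp_all add: SL_def)

definition mat_trace :: "nat \<Rightarrow> complex mat \<Rightarrow> complex" where
  "mat_trace n x = (\<Sum>i<n. x $$ (i, i))"

lemma mat_trace_mult_commute:
  assumes "A \<in> carrier_mat n n" "B \<in> carrier_mat n n"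
  shows "mat_trace n (A * B) = mat_trace n (B * A)"
proof -
  have "mat_trace n (A * B) = (\<Sum>i<n. \<Sum>k<n. A $$ (i, k) * B $$ (k, i))"
    using assms by (simp add: mat_trace_def scalar_prod_def atLeast0LessThan)
  also have "\<dots> = (\<Sum>k<n. \<Sum>i<n. B $$ (k, i) * A $$ (i, k))"
    by (subst sum.swap) (simp add: mult.commute)
  also have "\<dots> = mat_trace n (B * A)"
    using assms by (simp add: mat_trace_def scalar_prod_def atLeast0LessThan)
  finally show ?thesis .
qed

lemma mat_trace_conjugate:
  assumes x: "x \<in> carrier_mat n n" and g: "g \<in> carrier_mat n n" and h: "h \<in> carrier_mat n n"
    and hg: "h * g = 1\<^sub>m n"
  shows "mat_trace n (g * x * h) = mat_trace n x"
proof -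
  have "mat_trace n (g * x * h) = mat_trace n (h * (g * x))"
    by (rule mat_trace_mult_commute) (use x g h in auto)
  also have "h * (g * x) = x" using assoc_mult_mat[OF h g x] hg x by simp
  finally show ?thesis .
qed

lemma sl_iff: "x \<in> sl n \<longleftrightarrow> x \<in> carrier_mat n n \<and> mat_trace n x = 0"
  by (simp add: sl_def mat_trace_def)

lemma sheet_carrier: "x \<in> sheet n b \<Longrightarrow> x \<in> carrier_mat n n"
  by (simp add: sheet_def sl_def)

lemma inv_factor_conjugate:
  assumes "x \<in> carrier_mat n n" "g \<in> carrier_mat n n" "h \<in> carrier_mat n n"
    "g * h = 1\<^sub>m n" "h * g = 1\<^sub>m n"
  shows "inv_factor n (g * x * h) = inv_factor n x"
  using inv_factor_cong[OF shifted_equiv_if_similar[OF assms]] by simp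

lemma sheet_conjugate:
  assumes x: "x \<in> sheet n b" and g: "g \<in> carrier_mat n n" and h: "h \<in> carrier_mat n n"
    and gh: "g * h = 1\<^sub>m n" "h * g = 1\<^sub>m n"
  shows "g * x * h \<in> sheet n b"
  using x mat_trace_conjugate[OF sheet_carrier[OF x] g h gh(2)]
    inv_factor_conjugate[OF sheet_carrier[OF x] g h gh] g h
  by (simp add: sheet_def sl_iff mult_carrier_mat[of _ n n])

lemma adjoint_action_apply:
  "x \<in> X \<Longrightarrow> adjoint_action n X g x = g * x * inv\<^bsub>SL n\<^esub> g"
  by (simp add: adjoint_action_def)

lemma adjoint_action_closed:
  assumes "g \<in> carrier (SL n)" "x \<in> sheet n b"
  shows "adjoint_action n (sheet n b) g x \<in> sheet n b"
  unfolding adjoint_action_apply[OF assms(2)]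
  by (rule sheet_conjugate[OF assms(2) SL_carrier[OF assms(1)] SL_inv[OF assms(1)]])

lemma adjoint_action_mult:
  assumes g: "g \<in> carrier (SL n)" and h: "h \<in> carrier (SL n)" and x: "x \<in> sheet n b"
  shows "adjoint_action n (sheet n b) (g * h) x =
    adjoint_action n (sheet n b) g (adjoint_action n (sheet n b) h x)"
proof -
  have m: "g \<otimes>\<^bsub>SL n\<^esub> h = g * h" by (simp add: SL_def)
  have "inv\<^bsub>SL n\<^esub> (g * h) = inv\<^bsub>SL n\<^esub> h * inv\<^bsub>SL n\<^esub> g"
    using group.inv_mult_group[OF group_SL g h] unfolding m by (simp add: SL_def)
  then have "adjoint_action n (sheet n b) (g * h) x = g * h * x * (inv\<^bsub>SL n\<^esub> h * inv\<^bsub>SL n\<^esub> g)"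
    by (simp add: adjoint_action_apply[OF x])
  also have "\<dots> = g * (h * x * inv\<^bsub>SL n\<^esub> h) * inv\<^bsub>SL n\<^esub> g"
    using SL_carrier[OF g] SL_carrier[OF h] SL_inv(1)[OF g] SL_inv(1)[OF h] sheet_carrier[OF x]
    by (simp add: assoc_mult_mat[of _ n n _ n _ n] mult_carrier_mat[of _ n n])
  also have "\<dots> = adjoint_action n (sheet n b) g (adjoint_action n (sheet n b) h x)"
    by (subst adjoint_action_apply[OF adjoint_action_closed[OF h x]], subst adjoint_action_apply[OF x]) (rule refl)
  finally show ?thesis .
qed

lemma adjoint_action_one:
  assumes "x \<in> sheet n b"
  shows "adjoint_action n (sheet n b) (1\<^sub>m n) x = x"
proof -
  have "\<one>\<^bsub>SL n\<^esub> = 1\<^sub>m n" by (simp add: SL_def)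
  then have "inv\<^bsub>SL n\<^esub> (1\<^sub>m n) = 1\<^sub>m n" using monoid.inv_one[OF group.is_monoid[OF group_SL]] by metis
  then show ?thesis using sheet_carrier[OF assms] by (simp add: adjoint_action_apply assms)
qed

lemma group_action_sheet: "group_action (SL n) (sheet n b) (adjoint_action n (sheet n b))"
proof -
  let ?X = "sheet n b" and ?a = "adjoint_action n (sheet n b)"
  have bij: "?a g \<in> Bij ?X" if g: "g \<in> carrier (SL n)" for g
  proof -
    have i: "inv\<^bsub>SL n\<^esub> g \<in> carrier (SL n)" by (rule group.inv_closed[OF group_SL g])
    have "?a (inv\<^bsub>SL n\<^esub> g) (?a g x) = x" "?a g (?a (inv\<^bsub>SL n\<^esub> g) x) = x" if "x \<in> ?X" for x
      using adjoint_action_mult[OF i g that] adjoint_action_mult[OF g i that] adjoint_action_one[OF that]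
        SL_inv(2,3)[OF g] by simp_all
    then have "bij_betw (?a g) ?X ?X"
      by (intro bij_betw_byWitness[where f' = "?a (inv\<^bsub>SL n\<^esub> g)"])
         (use adjoint_action_closed[OF g] adjoint_action_closed[OF i] in auto)
    then show ?thesis by (simp add: Bij_def adjoint_action_def)
  qed
  have "?a (g \<otimes>\<^bsub>SL n\<^esub> h) = ?a g \<otimes>\<^bsub>BijGroup ?X\<^esub> ?a h"
    if g: "g \<in> carrier (SL n)" and h: "h \<in> carrier (SL n)" for g h
  proof -
    have "?a (g * h) = compose ?X (?a g) (?a h)"
    proof (rule extensionalityI)
      show "?a (g * h) \<in> extensional ?X" by (simp add: adjoint_action_def)
      fix x assume "x \<in> ?X"
      then show "?a (g * h) x = compose ?X (?a g) (?a h) x"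
        using adjoint_action_mult[OF g h] by (simp add: compose_eq)
    qed simp
    then show ?thesis using bij[OF g] bij[OF h] by (simp add: BijGroup_def SL_def)
  qed
  then have "?a \<in> hom (SL n) (BijGroup ?X)"
    using bij by (intro homI) (auto simp: BijGroup_def)
  then show ?thesis
    by (intro group_action.intro group_hom.intro group_hom_axioms.intro group_SL group_BijGroup)
qed

lemma exists_complex_nth_root:
  assumes "n > 0"
  shows "\<exists>c :: complex. c ^ n = w"
proof
  have "rcis (root n (cmod w)) (Arg w / real n) ^ n = rcis (cmod w) (Arg w)"
    using assms by (simp add: DeMoivre2)
  then show "rcis (root n (cmod w)) (Arg w / real n) ^ n = w" by (simp add: rcis_cmod_Arg)
qed

lemma orbit_sheet:
  assumes n: "n > 0" and x: "x \<in> sheet n b"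
  shows "orbit (SL n) (adjoint_action n (sheet n b)) x =
    {y \<in> sheet n b. \<forall>i\<in>{1..n}. inv_factor n y i = inv_factor n x i}" (is "?l = ?r")
proof (intro equalityI subsetI)
  fix y assume "y \<in> ?l"
  then obtain g where g: "g \<in> carrier (SL n)" and y: "y = adjoint_action n (sheet n b) g x"
    by (auto simp: orbit_def)
  have "inv_factor n y = inv_factor n x"
    unfolding y adjoint_action_apply[OF x]
    by (rule inv_factor_conjugate[OF sheet_carrier[OF x] SL_carrier[OF g] SL_inv[OF g]])
  then show "y \<in> ?r" using adjoint_action_closed[OF g x] y by simp
next
  fix y assume "y \<in> ?r"
  then have y: "y \<in> sheet n b" and eq: "\<And>i. i \<in> {1..n} \<Longrightarrow> inv_factor n x i = inv_factor n y i" by auto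
  note xc = sheet_carrier[OF x] and yc = sheet_carrier[OF y]
  obtain S S' where S: "S \<in> carrier_mat n n" and S': "S' \<in> carrier_mat n n"
    and SS: "S * S' = 1\<^sub>m n" "S' * S = 1\<^sub>m n" and yeq: "y = S * x * S'"
    using similar_if_inv_factor_eq[OF xc yc eq] by blast
  have "det S * det S' = 1" using det_mult[OF S S'] SS by simp
  then have "det S \<noteq> 0" by auto
  \<comment> \<open>Scaling \<open>S\<close> does not change the conjugation, and
    \<open>det (c S) = c^n det S\<close>, so \<open>S\<close> can be moved into
    \<open>SL n\<close>.\<close>
  obtain c where c: "c ^ n = 1 / det S" using exists_complex_nth_root[OF n] by blast
  let ?g = "c \<cdot>\<^sub>m S"
  have gc: "?g \<in> carrier_mat n n" using S by simp
  have "det ?g = 1" using S c \<open>det S \<noteq> 0\<close> by simp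
  then have g: "?g \<in> carrier (SL n)" using S by (simp add: SL_def)
  note gi = SL_inv[OF g]
  have "y * S = S * x * (S' * S)"
    unfolding yeq using S S' xc by (simp add: assoc_mult_mat[of _ n n _ n _ n])
  then have "y * S = S * x" using SS S xc by simp
  then have yg: "y * ?g = ?g * x"
    using mult_smult_distrib[OF yc S] mult_smult_assoc_mat[OF S xc] by simp
  have "y = y * (?g * inv\<^bsub>SL n\<^esub> ?g)" using gi(2) yc by simp
  also have "\<dots> = ?g * x * inv\<^bsub>SL n\<^esub> ?g"
    using assoc_mult_mat[OF yc gc gi(1)] yg by simp
  finally show "y \<in> ?l" using g by (auto simp: orbit_def adjoint_action_apply[OF x])
qed

section \<open>Families of monic polynomials and the section of the quotient map\<close>

lemma root_sum_mult:
  assumes "f \<noteq> 0" "g \<noteq> 0"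
  shows "root_sum (f * g) = root_sum f + root_sum g"
proof -
  let ?R = "{z. poly (f * g) z = 0}"
  have fin: "finite ?R" using assms by (intro poly_roots_finite) auto
  \<comment> \<open>Both factors are summed over the roots of the product; a point that is not a
    root of \<open>p\<close> has order 0 and adds nothing.\<close>
  have *: "root_sum p = (\<Sum>z\<in>?R. of_nat (order z p) * z)" if pd: "p dvd f * g" for p
  proof -
    obtain k where k: "f * g = p * k" using pd by (elim dvdE)
    have "poly (f * g) z = 0" if "poly p z = 0" for z unfolding k using that by simp
    then have "{z. poly p z = 0} \<subseteq> ?R" by blast
    moreover have "\<forall>z\<in>?R - {z. poly p z = 0}. of_nat (order z p) * z = 0"
      by (auto simp: order_root)
    ultimately show ?thesis unfolding root_sum_def by (intro sum.mono_neutral_left fin)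
  qed
  have "root_sum (f * g) = (\<Sum>z\<in>?R. of_nat (order z f) * z + of_nat (order z g) * z)"
    unfolding root_sum_def using assms by (intro sum.cong refl) (simp add: order_mult distrib_right)
  then show ?thesis using *[of f] *[of g] assms by (simp add: sum.distrib)
qed

lemma root_sum_one: "root_sum 1 = 0"
  by (simp add: root_sum_def)

lemma root_sum_linear: "root_sum [:- a, 1:] = a"
proof -
  have "{z. poly [:- a, 1:] z = 0} = {a}" by auto
  then show ?thesis using order_power_n_n[of a 1] by (simp add: root_sum_def)
qed

lemma root_sum_prod:
  assumes "\<And>i. i \<in> I \<Longrightarrow> f i \<noteq> 0"
  shows "root_sum (\<Prod>i\<in>I. f i) = (\<Sum>i\<in>I. root_sum (f i))"
  using assms
  by (induction I rule: infinite_finite_induct) (simp_all add: root_sum_one root_sum_mult)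

text \<open>Viete's formula, which turns the trace condition into a linear equation in coefficients.
  Degree 0 is separate: there truncated subtraction would pick the leading coefficient 1.\<close>

lemma root_sum_monic:
  assumes "lead_coeff f = 1"
  shows "root_sum f = (if degree f = 0 then 0 else - coeff f (degree f - 1))"
proof -
  have L: "degree (\<Prod>a\<leftarrow>as. [:- a, 1:]) = length as \<and> coeff (\<Prod>a\<leftarrow>as. [:- a, 1:]) (length as) = 1 \<and>
      root_sum (\<Prod>a\<leftarrow>as. [:- a, 1:]) = sum_list as \<and>
      (as \<noteq> [] \<longrightarrow> coeff (\<Prod>a\<leftarrow>as. [:- a, 1:]) (length as - 1) = - sum_list as)" for as :: "complex list"
  proof (induction as)
    case Nil
    then show ?case by (simp add: root_sum_one)
  next
    case (Cons a as)
    let ?P = "\<Prod>a\<leftarrow>as. [:- a, 1:]"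
    have P: "?P \<noteq> 0" using Cons by auto
    have 1: "degree ([:- a, 1:] * ?P) = Suc (length as)"
      using P Cons by (subst degree_mult_eq) auto
    have 2: "coeff ([:- a, 1:] * ?P) (Suc k) = - a * coeff ?P (Suc k) + coeff ?P k" for k
      by (simp add: coeff_pCons)
    have "coeff ?P (Suc (length as)) = 0" using Cons by (intro coeff_eq_0) simp
    then have 3: "coeff ([:- a, 1:] * ?P) (Suc (length as)) = 1" using 2[of "length as"] Cons by simp
    have 4: "root_sum ([:- a, 1:] * ?P) = a + sum_list as"
      using root_sum_mult[of "[:- a, 1:]", OF _ P] root_sum_linear[of a] Cons.IH by simp
    have 5: "coeff ([:- a, 1:] * ?P) (length as) = - (a + sum_list as)"
    proof (cases as)
      case Nil
      then show ?thesis by simp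
    next
      case (Cons c cs)
      then show ?thesis using 2[of "length cs"] Cons.IH by simp
    qed
    show ?case using 1 3 4 5 by simp
  qed
  obtain as where "smult (lead_coeff f) (\<Prod>a\<leftarrow>as. [:- a, 1:]) = f"
    using fundamental_theorem_algebra_factorized by blast
  then have f: "(\<Prod>a\<leftarrow>as. [:- a, 1:]) = f" using assms by simp
  show ?thesis using L[of as] unfolding f by (cases as) auto
qed

lemma coeff_family_poly:
  "coeff (family_poly b c i) j =
     (if j < b i - b (i + 1) then c (i, j) else if j = b i - b (i + 1) then 1 else 0)"
  unfolding family_poly_def by (simp add: coeff_sum)

lemma degree_family_poly: "degree (family_poly b c i) = b i - b (i + 1)"
  and lead_coeff_family_poly: "lead_coeff (family_poly b c i) = 1"
proof -
  have "degree (family_poly b c i) \<le> b i - b (i + 1)"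
    by (rule degree_le) (simp add: coeff_family_poly)
  moreover have "b i - b (i + 1) \<le> degree (family_poly b c i)"
    by (rule le_degree) (simp add: coeff_family_poly)
  ultimately show d: "degree (family_poly b c i) = b i - b (i + 1)" by simp
  show "lead_coeff (family_poly b c i) = 1" unfolding d by (simp add: coeff_family_poly)
qed

definition family_prod :: "nat \<Rightarrow> (nat \<Rightarrow> nat) \<Rightarrow> (nat \<times> nat \<Rightarrow> complex) \<Rightarrow> nat \<Rightarrow> complex poly" where
  "family_prod n b c i = (\<Prod>j\<in>{i..n}. family_poly b c j)"

definition sheet_section :: "nat \<Rightarrow> (nat \<Rightarrow> nat) \<Rightarrow> (nat \<times> nat \<Rightarrow> complex) \<Rightarrow> complex mat" where
  "sheet_section n b c = block_companion b (family_prod n b c) [1..<Suc n]"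

lemma lead_coeff_family_prod: "lead_coeff (family_prod n b c i) = 1"
  unfolding family_prod_def by (rule lead_coeff_prod_monic) (rule lead_coeff_family_poly)

lemma family_prod_Suc:
  "i \<le> n \<Longrightarrow> family_prod n b c i = family_poly b c i * family_prod n b c (Suc i)"
  unfolding family_prod_def by (simp add: prod.atLeast_Suc_atMost)

text \<open>The degrees \<open>b j - b (j + 1)\<close> telescope down to
  \<open>b (n + 1) = 0\<close>; monotonicity of \<open>b\<close> makes the natural subtractions
  exact.\<close>

lemma degree_family_prod:
  assumes b: "is_partition n b" and i: "i \<ge> 1" "i \<le> Suc n"
  shows "degree (family_prod n b c i) = b i"
  using i(2,1)
proof (induction i rule: inc_induct)
  case base
  then show ?case using b by (simp add: family_prod_def is_partition_def)
next
  case (step m)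
  have "family_poly b c m \<noteq> 0" "family_prod n b c (Suc m) \<noteq> 0"
    using lead_coeff_family_poly[of b c m] lead_coeff_family_prod[of n b c "Suc m"] by auto
  moreover have "b (m + 1) \<le> b m" using b step by (simp add: is_partition_def)
  ultimately show ?case
    using step by (simp add: family_prod_Suc degree_mult_eq degree_family_poly)
qed

lemma sum_partition:
  "is_partition n b \<Longrightarrow> (\<Sum>i = 1..n. b i) = n"
  by (simp add: is_partition_def)

lemma sum_list_partition:
  assumes "is_partition n b" shows "(\<Sum>k\<leftarrow>[1..<Suc n]. b k) = n"
  using sum_partition[OF assms] sum_set_upt_conv_sum_list_nat[of b 1 "Suc n"]
  by (simp add: atLeastLessThanSuc_atLeastAtMost del: upt_Suc)

lemma sheet_section_carrier:
  assumes "is_partition n b" shows "sheet_section n b c \<in> carrier_mat n n"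
  using block_companion_carrier[of b "family_prod n b c" "[1..<Suc n]"] sum_list_partition[OF assms]
  by (simp only: sheet_section_def)

lemma inv_factor_sheet_section:
  assumes b: "is_partition n b" and i: "i \<in> {1..n}"
  shows "inv_factor n (sheet_section n b c) i = family_prod n b c i"
proof -
  have "smith_form n (sheet_section n b c) (\<lambda>j. family_prod n b c (n - j))"
    unfolding sheet_section_def
  proof (rule smith_form_block_companion[OF _ lead_coeff_family_prod _ sum_partition[OF b]])
    show "degree (family_prod n b c i) = b i" if "i \<in> {1..n}" for i
      by (rule degree_family_prod[OF b]) (use that in auto)
    show "family_prod n b c (Suc i) dvd family_prod n b c i" if "i \<in> {1..<n}" for i
      using that family_prod_Suc[of i n b c] by simp
  qed
  from inv_factor_smith_form[OF this i] show ?thesis using i by simp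
qed

lemma inv_factor_ratio_sheet_section:
  assumes b: "is_partition n b" and i: "i \<in> {1..n}"
  shows "inv_factor_ratio n (sheet_section n b c) i = family_poly b c i"
proof -
  have "inv_factor n (sheet_section n b c) (i + 1) = family_prod n b c (Suc i)"
  proof (cases "i = n")
    case True
    then show ?thesis by (simp add: inv_factor_Suc_n family_prod_def)
  next
    case False
    then show ?thesis using inv_factor_sheet_section[OF b, of "i + 1"] i by simp
  qed
  moreover have "family_prod n b c (Suc i) \<noteq> 0" using lead_coeff_family_prod[of n b c "Suc i"] by auto
  ultimately show ?thesis
    using inv_factor_sheet_section[OF assms] family_prod_Suc[of i n b c] i
    by (simp add: inv_factor_ratio_def)
qed

lemma sheet_quotient_section:
  assumes b: "is_partition n b" and c: "c \<in> points (family_space n b)"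
  shows "sheet_quotient n b (sheet_section n b c) = c"
proof
  fix k :: "nat \<times> nat"
  obtain i j where k: "k = (i, j)" by (cases k)
  show "sheet_quotient n b (sheet_section n b c) k = c k"
  proof (cases "k \<in> family_index n b")
    case True
    then have "i \<in> {1..n}" "j < b i - b (i + 1)" unfolding k family_index_def by auto
    then show ?thesis
      using True by (simp add: k sheet_quotient_def inv_factor_ratio_sheet_section[OF b] coeff_family_poly)
  next
    case False
    \<comment> \<open>Off the index set both sides are \<open>undefined\<close>, because points of
      the family space are extensional.\<close>
    then show ?thesis
      using c False by (simp add: k sheet_quotient_def family_space_def PiE_def extensional_def)
  qed
qed

section \<open>The trace of the section\<close>

lemma mat_trace_companion:
  assumes "degree q = m" "lead_coeff q = 1"
  shows "mat_trace m (companion m q) = root_sum q"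
proof (cases "m = 0")
  case True
  then show ?thesis using root_sum_monic[OF assms(2)] assms(1) by (simp add: mat_trace_def)
next
  case False
  have "mat_trace m (companion m q) = (\<Sum>i<m. if i = m - 1 then - coeff q i else 0)"
    unfolding mat_trace_def using False by (intro sum.cong) (auto simp: companion_def)
  then show ?thesis using root_sum_monic[OF assms(2)] assms(1) False by (simp add: sum.delta)
qed

lemma mat_trace_four_block:
  assumes "A \<in> carrier_mat p p" "B \<in> carrier_mat q q"
  shows "mat_trace (p + q) (four_block_mat A (0\<^sub>m p q) (0\<^sub>m q p) B) = mat_trace p A + mat_trace q B"
proof -
  have split: "mat_trace (p + q) M = (\<Sum>i<p. M $$ (i, i)) + (\<Sum>i<q. M $$ (p + i, p + i))" for M :: "complex mat"
    unfolding mat_trace_def by (induction q) (simp_all add: add.assoc)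
  show ?thesis unfolding split unfolding mat_trace_def using assms by simp
qed

lemma mat_trace_block_companion:
  assumes "\<And>k. k \<in> set ks \<Longrightarrow> degree (q k) = b k" "\<And>k. k \<in> set ks \<Longrightarrow> lead_coeff (q k) = 1"
  shows "mat_trace (\<Sum>k\<leftarrow>ks. b k) (block_companion b q ks) = (\<Sum>k\<leftarrow>ks. root_sum (q k))"
  using assms
proof (induction ks)
  case (Cons k ks)
  then show ?case
    using mat_trace_four_block[OF companion_carrier[of "b k" "q k"] block_companion_carrier[of b q ks]]
    by (simp add: block_companion_Cons mat_trace_companion)
qed (simp add: mat_trace_def)

text \<open>Each companion block has the root sum of its \<open>q_k\<close> as trace. The factor
  \<open>p_j\<close> occurs in \<open>q_1\<close>, ..., \<open>q_j\<close>, so exchanging the sums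
  counts its roots \<open>j\<close> times.\<close>

lemma mat_trace_sheet_section:
  assumes b: "is_partition n b"
  shows "mat_trace n (sheet_section n b c) = (\<Sum>i = 1..n. of_nat i * root_sum (family_poly b c i))"
proof -
  let ?r = "\<lambda>j. root_sum (family_poly b c j)"
  have nz: "family_poly b c j \<noteq> 0" for j using lead_coeff_family_poly[of b c j] by auto
  have "mat_trace n (sheet_section n b c) = (\<Sum>k\<leftarrow>[1..<Suc n]. root_sum (family_prod n b c k))"
  proof -
    have "mat_trace (\<Sum>k\<leftarrow>[1..<Suc n]. b k) (block_companion b (family_prod n b c) [1..<Suc n]) =
        (\<Sum>k\<leftarrow>[1..<Suc n]. root_sum (family_prod n b c k))"
      by (rule mat_trace_block_companion[OF degree_family_prod[OF b] lead_coeff_family_prod]) auto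
    then show ?thesis unfolding sum_list_partition[OF b] sheet_section_def .
  qed
  also have "\<dots> = (\<Sum>k\<in>{1..n}. root_sum (family_prod n b c k))"
    using sum.distinct_set_conv_list[of "[1..<Suc n]" "\<lambda>k. root_sum (family_prod n b c k)"]
    by (simp add: atLeastLessThanSuc_atLeastAtMost del: upt_Suc)
  also have "\<dots> = (\<Sum>k\<in>{1..n}. \<Sum>j\<in>{j \<in> {1..n}. k \<le> j}. ?r j)"
    unfolding family_prod_def
    by (intro sum.cong refl, subst root_sum_prod[OF nz]) (auto intro!: sum.cong)
  also have "\<dots> = (\<Sum>j\<in>{1..n}. \<Sum>k\<in>{k \<in> {1..n}. k \<le> j}. ?r j)"
    by (rule sum.swap_restrict) auto
  also have "\<dots> = (\<Sum>j = 1..n. of_nat j * ?r j)"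
  proof (intro sum.cong refl)
    fix j assume "j \<in> {1..n}"
    then have "{k \<in> {1..n}. k \<le> j} = {1..j}" by auto
    then show "(\<Sum>k\<in>{k \<in> {1..n}. k \<le> j}. ?r j) = of_nat j * ?r j" by simp
  qed
  finally show ?thesis .
qed

lemma sheet_section_in_sheet:
  assumes b: "is_partition n b" and c: "c \<in> trace_zero_families n b"
  shows "sheet_section n b c \<in> sheet n b"
  using c sheet_section_carrier[OF b] mat_trace_sheet_section[OF b] inv_factor_sheet_section[OF b]
    degree_family_prod[OF b]
  by (simp add: sheet_def sl_iff trace_zero_families_def)

section \<open>The family attached to a point of the sheet\<close>

lemma degree_inv_factor_sheet:
  assumes b: "is_partition n b" and x: "x \<in> sheet n b" and i: "i \<in> {1..Suc n}"
  shows "degree (inv_factor n x i) = b i"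
proof (cases "i = Suc n")
  case True
  then show ?thesis using b by (simp add: inv_factor_Suc_n is_partition_def)
next
  case False
  then have "i \<in> {1..n}" using i by auto
  then show ?thesis using x unfolding sheet_def by blast
qed

text \<open>The quotient map records only coefficients below \<open>b i - b (i + 1)\<close>. On the
  sheet the ratio is monic of exactly that degree, so nothing is lost.\<close>

lemma family_poly_sheet_quotient:
  assumes b: "is_partition n b" and x: "x \<in> sheet n b" and i: "i \<in> {1..n}"
  shows "family_poly b (sheet_quotient n b x) i = inv_factor_ratio n x i"
proof -
  note xc = sheet_carrier[OF x]
  have lr: "lead_coeff (inv_factor_ratio n x i) = 1" by (rule lead_coeff_inv_factor_ratio[OF xc i])
  have "inv_factor_ratio n x i \<noteq> 0" "inv_factor n x (i + 1) \<noteq> 0"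
    using lr lead_coeff_inv_factor[OF xc, of "i + 1"] by auto
  then have "degree (inv_factor n x i) = degree (inv_factor_ratio n x i) + degree (inv_factor n x (i + 1))"
    unfolding inv_factor_eq_ratio_mult[OF xc i] by (rule degree_mult_eq)
  then have deg: "degree (inv_factor_ratio n x i) = b i - b (i + 1)"
    using degree_inv_factor_sheet[OF b x, of i] degree_inv_factor_sheet[OF b x, of "i + 1"] i by simp
  show ?thesis
  proof (rule poly_eqI)
    fix j
    show "coeff (family_poly b (sheet_quotient n b x) i) j = coeff (inv_factor_ratio n x i) j"
      using i deg lr coeff_eq_0[of "inv_factor_ratio n x i" j]
      by (auto simp: coeff_family_poly sheet_quotient_def family_index_def)
  qed
qed

lemma family_prod_sheet_quotient:
  assumes b: "is_partition n b" and x: "x \<in> sheet n b" and i: "i \<ge> 1" "i \<le> Suc n"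
  shows "family_prod n b (sheet_quotient n b x) i = inv_factor n x i"
  using i(2,1)
proof (induction i rule: inc_induct)
  case base
  then show ?case by (simp add: family_prod_def inv_factor_Suc_n)
next
  case (step m)
  then show ?case
    using inv_factor_eq_ratio_mult[OF sheet_carrier[OF x], of m]
    by (simp add: family_prod_Suc family_poly_sheet_quotient[OF b x])
qed

lemma sheet_quotient_in_trace_zero:
  assumes b: "is_partition n b" and x: "x \<in> sheet n b"
  shows "sheet_quotient n b x \<in> trace_zero_families n b"
proof -
  let ?c = "sheet_quotient n b x"
  note xc = sheet_carrier[OF x]
  have "inv_factor n x i = inv_factor n (sheet_section n b ?c) i" if "i \<in> {1..n}" for i
    using inv_factor_sheet_section[OF b that] family_prod_sheet_quotient[OF b x, of i] that by simp
  then obtain S S' where S: "S \<in> carrier_mat n n" "S' \<in> carrier_mat n n" "S' * S = 1\<^sub>m n"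
    and eq: "sheet_section n b ?c = S * x * S'"
    using similar_if_inv_factor_eq[OF xc sheet_section_carrier[OF b]] by blast
  have "mat_trace n (sheet_section n b ?c) = mat_trace n x"
    unfolding eq by (rule mat_trace_conjugate[OF xc S])
  also have "\<dots> = 0" using x by (simp add: sheet_def sl_iff)
  finally show ?thesis
    unfolding mat_trace_sheet_section[OF b]
    by (simp add: trace_zero_families_def sheet_quotient_def family_space_def)
qed

lemma sheet_quotient_eq_iff:
  assumes b: "is_partition n b" and x: "x \<in> sheet n b" and y: "y \<in> sheet n b"
  shows "sheet_quotient n b y = sheet_quotient n b x \<longleftrightarrow>
    (\<forall>i\<in>{1..n}. inv_factor n y i = inv_factor n x i)" (is "?l \<longleftrightarrow> ?r")
proof
  assume ?l
  then show ?r using family_prod_sheet_quotient[OF b x] family_prod_sheet_quotient[OF b y] by simp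
next
  assume r: ?r
  have "inv_factor_ratio n y i = inv_factor_ratio n x i" if i: "i \<in> {1..n}" for i
  proof (cases "i = n")
    case True
    then show ?thesis using r i by (simp add: inv_factor_ratio_def inv_factor_Suc_n)
  next
    case False
    then show ?thesis using r i by (simp add: inv_factor_ratio_def)
  qed
  then show ?l by (auto simp: sheet_quotient_def family_index_def fun_eq_iff)
qed

section \<open>Regularity of the invariant factors\<close>

text \<open>\<open>polynomial_functions\<close> contains functions on the whole type, whereas
  expansions such as the Leibniz formula hold only for matrices of the right size. Agreement is
  therefore asked on the points alone.\<close>

definition polyfun :: "'a coord_space \<Rightarrow> ('a \<Rightarrow> complex) \<Rightarrow> bool" where
  "polyfun A f \<longleftrightarrow> (\<exists>g\<in>polynomial_functions A. \<forall>x\<in>points A. f x = g x)"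

lemma polyfun_cong:
  assumes "polyfun A f" "\<And>x. x \<in> points A \<Longrightarrow> f x = g x" shows "polyfun A g"
proof -
  obtain u where "u \<in> polynomial_functions A" "\<forall>x\<in>points A. f x = u x"
    using assms(1) unfolding polyfun_def by blast
  then show ?thesis using assms(2) unfolding polyfun_def by (intro bexI[of _ u]) auto
qed

lemma polyfun_polynomial: "f \<in> polynomial_functions A \<Longrightarrow> polyfun A f"
  unfolding polyfun_def by blast

lemma polyfun_const: "polyfun A (\<lambda>_. c)"
  by (rule polyfun_polynomial[OF polynomial_functions.const])

lemma polyfun_add:
  assumes "polyfun A f" "polyfun A g" shows "polyfun A (\<lambda>x. f x + g x)"
proof -
  obtain u v where "u \<in> polynomial_functions A" "\<forall>x\<in>points A. f x = u x"
    "v \<in> polynomial_functions A" "\<forall>x\<in>points A. g x = v x"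
    using assms unfolding polyfun_def by blast
  then show ?thesis unfolding polyfun_def
    by (intro bexI[of _ "\<lambda>x. u x + v x"] polynomial_functions.add) auto
qed

lemma polyfun_mult:
  assumes "polyfun A f" "polyfun A g" shows "polyfun A (\<lambda>x. f x * g x)"
proof -
  obtain u v where "u \<in> polynomial_functions A" "\<forall>x\<in>points A. f x = u x"
    "v \<in> polynomial_functions A" "\<forall>x\<in>points A. g x = v x"
    using assms unfolding polyfun_def by blast
  then show ?thesis unfolding polyfun_def
    by (intro bexI[of _ "\<lambda>x. u x * v x"] polynomial_functions.mult) auto
qed

lemma polyfun_sum:
  assumes "\<And>i. i \<in> I \<Longrightarrow> polyfun A (f i)" shows "polyfun A (\<lambda>x. \<Sum>i\<in>I. f i x)"
  using assms
  by (induction I rule: infinite_finite_induct) (simp_all add: polyfun_const polyfun_add)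

lemma polyfun_prod:
  assumes "\<And>i. i \<in> I \<Longrightarrow> polyfun A (f i)" shows "polyfun A (\<lambda>x. \<Prod>i\<in>I. f i x)"
  using assms
  by (induction I rule: infinite_finite_induct) (simp_all add: polyfun_const polyfun_mult)

lemma regular_on_polyfun:
  assumes "polyfun A f" "X \<subseteq> points A" shows "regular_on A X f"
proof -
  obtain u where "u \<in> polynomial_functions A" "\<forall>x\<in>points A. f x = u x"
    using assms(1) unfolding polyfun_def by blast
  then show ?thesis
    by (intro regular_on_cong[OF assms(2) regular_on_polynomial[OF assms(2)], of u]) (use assms(2) in auto)
qed

lemma polyfun_det:
  assumes c: "\<And>x. x \<in> points A \<Longrightarrow> M x \<in> carrier_mat m m"
    and e: "\<And>i j. i < m \<Longrightarrow> j < m \<Longrightarrow> polyfun A (\<lambda>x. M x $$ (i, j))"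
  shows "polyfun A (\<lambda>x. det (M x))"
proof (rule polyfun_cong)
  show "polyfun A (\<lambda>x. \<Sum>p\<in>{p. p permutes {0..<m}}. signof p * (\<Prod>i = 0..<m. M x $$ (i, p i)))"
    by (intro polyfun_sum polyfun_mult polyfun_const polyfun_prod e) (auto simp: permutes_in_image)
  fix x assume "x \<in> points A"
  then show "(\<Sum>p\<in>{p. p permutes {0..<m}}. signof p * (\<Prod>i = 0..<m. M x $$ (i, p i))) = det (M x)"
    using det_def'[OF c] by simp
qed

definition poly_family :: "'a coord_space \<Rightarrow> ('a \<Rightarrow> complex poly) \<Rightarrow> bool" where
  "poly_family A F \<longleftrightarrow> (\<forall>k. polyfun A (\<lambda>x. coeff (F x) k))"

lemma poly_family_cong:
  assumes "poly_family A F" "\<And>x. x \<in> points A \<Longrightarrow> F x = G x" shows "poly_family A G"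
  using assms polyfun_cong[of A] unfolding poly_family_def by (metis (no_types, lifting))

lemma poly_family_const: "poly_family A (\<lambda>_. p)"
  unfolding poly_family_def by (simp add: polyfun_const)

lemma poly_family_smult:
  "polyfun A f \<Longrightarrow> poly_family A F \<Longrightarrow> poly_family A (\<lambda>x. smult (f x) (F x))"
  unfolding poly_family_def by (simp add: polyfun_mult)

lemma poly_family_add: "poly_family A F \<Longrightarrow> poly_family A G \<Longrightarrow> poly_family A (\<lambda>x. F x + G x)"
  unfolding poly_family_def by (simp add: polyfun_add)

lemma poly_family_mult: "poly_family A F \<Longrightarrow> poly_family A G \<Longrightarrow> poly_family A (\<lambda>x. F x * G x)"
  unfolding poly_family_def coeff_mult by (intro allI polyfun_sum polyfun_mult) auto

lemma poly_family_sum: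
  assumes "\<And>i. i \<in> I \<Longrightarrow> poly_family A (F i)" shows "poly_family A (\<lambda>x. \<Sum>i\<in>I. F i x)"
  using assms
  by (induction I rule: infinite_finite_induct) (simp_all add: poly_family_const poly_family_add)

lemma poly_family_prod:
  assumes "\<And>i. i \<in> I \<Longrightarrow> poly_family A (F i)" shows "poly_family A (\<lambda>x. \<Prod>i\<in>I. F i x)"
  using assms
  by (induction I rule: infinite_finite_induct) (simp_all add: poly_family_const poly_family_mult)

lemma poly_family_det:
  assumes c: "\<And>x. x \<in> points A \<Longrightarrow> M x \<in> carrier_mat m m"
    and e: "\<And>i j. i < m \<Longrightarrow> j < m \<Longrightarrow> poly_family A (\<lambda>x. M x $$ (i, j))"
  shows "poly_family A (\<lambda>x. det (M x))"
proof (rule poly_family_cong)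
  show "poly_family A (\<lambda>x. \<Sum>p\<in>{p. p permutes {0..<m}}. signof p * (\<Prod>i = 0..<m. M x $$ (i, p i)))"
    by (intro poly_family_sum poly_family_mult poly_family_const poly_family_prod e) (auto simp: permutes_in_image)
  fix x assume "x \<in> points A"
  then show "(\<Sum>p\<in>{p. p permutes {0..<m}}. signof p * (\<Prod>i = 0..<m. M x $$ (i, p i))) = det (M x)"
    using det_def'[OF c] by simp
qed

text \<open>Near \<open>x\<^sub>0\<close> the degree of a common divisor of \<open>W x\<close> and \<open>E x\<close> can only drop. The multiples
  \<open>t\<^sup>k W x\<close> and \<open>t\<^sup>k E x\<close> below have the degrees \<open>d, d + 1, \<dots>\<close> at \<open>x\<^sub>0\<close>, so their coefficients of
  degree \<open>\<ge> d\<close> form a matrix that is triangular at \<open>x\<^sub>0\<close>. Multiplying by its adjugate gives a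
  combination with leading term \<open>det t\<^sup>d\<close>.\<close>

lemma local_elimination:
  assumes W: "poly_family A W" and E: "poly_family A E"
    and dW: "\<And>x. x \<in> points A \<Longrightarrow> degree (W x) \<le> D"
    and dE: "\<And>x. x \<in> points A \<Longrightarrow> degree (E x) \<le> N"
    and x0: "x0 \<in> points A" "W x0 \<noteq> 0" "degree (W x0) = d" "E x0 \<noteq> 0" "degree (E x0) = N" "d \<le> N"
  shows "\<exists>h\<in>polynomial_functions A. \<exists>U. poly_family A U \<and> h x0 \<noteq> 0 \<and>
    (\<forall>x\<in>points A. degree (U x) \<le> d \<and> coeff (U x) d = h x \<and>
      (\<forall>G. G dvd W x \<longrightarrow> G dvd E x \<longrightarrow> G dvd U x))"
proof -
  \<comment> \<open>For every \<open>x\<close>, not only for \<open>x0\<close>, all the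
    \<open>r\<close> multiples used have degree below \<open>M\<close>. Hence the \<open>r\<close>
    exponents from \<open>d\<close> to \<open>M - 1\<close> capture all their coefficients from
    \<open>d\<close> upwards, and \<open>T\<close> is square.\<close>
  define M where "M = Suc (N + D)"
  define r where "r = M - d"
  \<comment> \<open>At \<open>x0\<close> the multiples of \<open>W\<close> have the degrees
    \<open>d\<close> to \<open>N - 1\<close>; from \<open>k = N - d\<close> on, \<open>E\<close> of
    degree \<open>N\<close> takes over. In both cases the degree is \<open>d + k\<close>.\<close>
  define e where "e k x = (if k < N - d then monom 1 k * W x else monom 1 (k - (N - d)) * E x)" for k x
  define T where "T x = mat r r (\<lambda>(j, k). coeff (e k x) (d + j))" for x
  \<comment> \<open>The combination uses column 0 of the adjugate: \<open>T\<close> times it is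
    \<open>det (T x)\<close> in row 0 and zero below, which are the coefficients of
    \<open>U x\<close> at \<open>d\<close>, \<open>d + 1\<close>, and so on.\<close>
  define U where "U x = (\<Sum>k<r. smult (adj_mat (T x) $$ (k, 0)) (e k x))" for x
  have r: "r > 0" using x0(6) by (simp add: r_def M_def)
  have e_fam: "poly_family A (e k)" for k
    unfolding e_def by (cases "k < N - d") (simp_all add: poly_family_mult poly_family_const W E)
  have e_deg: "degree (e k x) < M" if "x \<in> points A" "k < r" for k x
  proof (cases "k < N - d")
    case True
    have "degree (e k x) \<le> degree (monom (1 :: complex) k) + degree (W x)"
      using True degree_mult_le[of "monom 1 k" "W x"] by (simp add: e_def)
    then show ?thesis using True dW[OF that(1)] degree_monom_le[of "1 :: complex" k] by (simp add: M_def)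
  next
    case False
    have "degree (e k x) \<le> degree (monom (1 :: complex) (k - (N - d))) + degree (E x)"
      using False degree_mult_le[of "monom 1 (k - (N - d))" "E x"] by (simp add: e_def)
    then show ?thesis
      using False dE[OF that(1)] degree_monom_le[of "1 :: complex" "k - (N - d)"] that(2) x0(6)
      by (simp add: r_def)
  qed
  have e_x0: "degree (e k x0) = d + k" "e k x0 \<noteq> 0" for k
    using x0 by (auto simp: e_def degree_mult_eq degree_monom_eq)
  have Tc: "T x \<in> carrier_mat r r" for x by (simp add: T_def)
  have T_fam: "polyfun A (\<lambda>x. T x $$ (i, j))" if "i < r" "j < r" for i j
    using that e_fam unfolding poly_family_def by (simp add: T_def)
  obtain h where h: "h \<in> polynomial_functions A" "\<And>x. x \<in> points A \<Longrightarrow> det (T x) = h x"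
    using polyfun_det[OF Tc T_fam] unfolding polyfun_def by blast
  have "upper_triangular (T x0)"
    unfolding upper_triangular_def using e_x0(1) by (auto simp: T_def intro!: coeff_eq_0)
  then have "det (T x0) = prod_list (diag_mat (T x0))" by (rule det_upper_triangular[OF _ Tc])
  moreover have "0 \<notin> set (diag_mat (T x0))"
    using e_x0 by (auto simp: diag_mat_def T_def) (metis leading_coeff_0_iff)
  ultimately have h0: "h x0 \<noteq> 0" using h(2)[OF x0(1)] by (simp add: prod_list_zero_iff)
  have adj_fam: "polyfun A (\<lambda>x. adj_mat (T x) $$ (k, 0))" if k: "k < r" for k
  proof (rule polyfun_cong)
    show "polyfun A (\<lambda>x. (-1) ^ k * det (mat_delete (T x) 0 k))"
    proof (intro polyfun_mult polyfun_const polyfun_det)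
      show "mat_delete (T x) 0 k \<in> carrier_mat (r - 1) (r - 1)" for x
        by (rule mat_delete_carrier[OF Tc])
      show "polyfun A (\<lambda>x. mat_delete (T x) 0 k $$ (i, j))" if "i < r - 1" "j < r - 1" for i j
        using that T_fam[of "Suc i" j] T_fam[of "Suc i" "Suc j"] carrier_matD[OF Tc]
        by (cases "j < k") (simp_all add: mat_delete_def)
    qed
    show "(-1) ^ k * det (mat_delete (T x) 0 k) = adj_mat (T x) $$ (k, 0)" for x
      using k r carrier_matD[OF Tc] by (simp add: adj_mat_def cofactor_def)
  qed
  have U_fam: "poly_family A U"
    unfolding U_def by (intro poly_family_sum poly_family_smult adj_fam e_fam) auto
  have U_coeff: "coeff (U x) (d + j) = (if j = 0 then det (T x) else 0)" if j: "j < r" for x j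
  proof -
    have "coeff (U x) (d + j) = (\<Sum>k = 0..<r. T x $$ (j, k) * adj_mat (T x) $$ (k, 0))"
      unfolding U_def atLeast0LessThan using j by (simp add: coeff_sum T_def mult.commute)
    also have "\<dots> = (T x * adj_mat (T x)) $$ (j, 0)"
      using j r carrier_matD[OF Tc[of x]] carrier_matD[OF adj_mat(1)[OF Tc[of x]]] by (simp add: scalar_prod_def)
    also have "\<dots> = (if j = 0 then det (T x) else 0)"
      using j r by (simp add: adj_mat(2)[OF Tc])
    finally show ?thesis .
  qed
  have U_high: "coeff (U x) m = 0" if "x \<in> points A" "m \<ge> M" for x m
  proof -
    have "coeff (e k x) m = 0" if "k < r" for k
      using e_deg[OF \<open>x \<in> points A\<close> that] \<open>m \<ge> M\<close> by (simp add: coeff_eq_0)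
    then show ?thesis unfolding U_def by (simp add: coeff_sum)
  qed
  have U_deg: "degree (U x) \<le> d" if x: "x \<in> points A" for x
  proof (rule degree_le, intro allI impI)
    fix m assume "d < m"
    then obtain j where j: "m = d + j" "j > 0" using less_imp_add_positive by blast
    show "coeff (U x) m = 0"
    proof (cases "j < r")
      case True
      then show ?thesis using U_coeff[OF True] j by simp
    next
      case False
      then show ?thesis using U_high[OF x, of m] j by (simp add: r_def)
    qed
  qed
  have U_dvd: "G dvd U x" if "G dvd W x" "G dvd E x" for G x
    unfolding U_def e_def using that by (intro dvd_sum dvd_smult) auto
  show ?thesis
    using h(1) U_fam h0 U_deg U_dvd U_coeff[OF r] h(2)
    by (intro bexI[of _ h] exI[of _ U]) auto
qed

section \<open>The gcd of the minors near a given matrix\<close>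

lemma Gcd_image_bezout:
  fixes f :: "'k \<Rightarrow> complex poly"
  assumes "finite K"
  shows "\<exists>a. Gcd (f ` K) = (\<Sum>k\<in>K. a k * f k)"
  using assms
proof induction
  case (insert k K)
  then obtain a where a: "Gcd (f ` K) = (\<Sum>k\<in>K. a k * f k)" by blast
  obtain s t where "s * f k + t * Gcd (f ` K) = gcd (f k) (Gcd (f ` K))"
    using bezout_coefficients_fst_snd by blast
  then have "Gcd (f ` insert k K) = s * f k + (\<Sum>j\<in>K. t * a j * f j)"
    by (simp add: a sum_distrib_left mult.assoc)
  also have "\<dots> = (\<Sum>j\<in>insert k K. (if j = k then s else t * a j) * f j)"
    using insert by (auto intro!: arg_cong2[where f = "(+)"] sum.cong)
  finally show ?case by (rule exI[of _ "\<lambda>j. if j = k then s else t * a j"])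
qed simp

lemma points_matrix_space: "points (matrix_space n) = carrier_mat n n"
  by (simp add: matrix_space_def)

lemma polyfun_entry: "i < n \<Longrightarrow> j < n \<Longrightarrow> polyfun (matrix_space n) (\<lambda>x. x $$ (i, j))"
  by (rule polyfun_polynomial, rule polynomial_functions.coord) (auto simp: matrix_space_def)

lemma poly_family_shifted_entry:
  assumes "i < n" "j < n"
  shows "poly_family (matrix_space n) (\<lambda>x. shifted_matrix n x $$ (i, j))"
proof (rule poly_family_cong)
  show "poly_family (matrix_space n)
      (\<lambda>x. smult (x $$ (i, j)) 1 + (if i = j then [:0, -1:] else 0))"
    by (intro poly_family_add poly_family_smult poly_family_const polyfun_entry assms)
  show "smult (x $$ (i, j)) 1 + (if i = j then [:0, -1:] else 0) = shifted_matrix n x $$ (i, j)"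
    if "x \<in> points (matrix_space n)" for x
    using that assms by (simp add: shifted_matrix_index points_matrix_space)
qed

lemma shifted_minor:
  assumes I: "I \<subseteq> {..<n}" "card I = k" and J: "J \<subseteq> {..<n}" "card J = k"
  shows "poly_family (matrix_space n) (\<lambda>x. det (submatrix (shifted_matrix n x) I J))"
    and "x \<in> carrier_mat n n \<Longrightarrow> degree (det (submatrix (shifted_matrix n x) I J)) \<le> k"
proof -
  have c: "submatrix (shifted_matrix n x) I J \<in> carrier_mat k k" for x
    using submatrix_carrier[OF shifted_matrix_carrier I(1) J(1)] I J by simp
  have idx: "submatrix (shifted_matrix n x) I J $$ (i, j) = shifted_matrix n x $$ (pick I i, pick J j)"
    and lt: "pick I i < n" "pick J j < n" if "i < k" "j < k" for i j x
    using submatrix_index'[OF shifted_matrix_carrier I(1) J(1)] that I J pick_less[OF I(1), of i]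
      pick_less[OF J(1), of j] by auto
  show "poly_family (matrix_space n) (\<lambda>x. det (submatrix (shifted_matrix n x) I J))"
    by (rule poly_family_det[OF c]) (simp add: idx lt poly_family_shifted_entry)
  assume x: "x \<in> carrier_mat n n"
  have "degree (det (submatrix (shifted_matrix n x) I J)) \<le> 1 * k"
    by (rule degree_det_le[OF _ c]) (simp add: idx lt shifted_matrix_index[OF x])
  then show "degree (det (submatrix (shifted_matrix n x) I J)) \<le> k" by simp
qed

text \<open>Up to its leading coefficient the determinant is the product of all invariant factors,
  and the gcd is a partial product.\<close>

lemma minor_gcd_dvd_det:
  assumes x: "x \<in> carrier_mat n n" and i: "i \<in> {1..n}"
  shows "minor_gcd n x i dvd det (shifted_matrix n x)"
proof -
  have "normalize (det (shifted_matrix n x)) = minor_gcd n x 1"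
    using i minors_full[OF shifted_matrix_carrier, of n x] by (simp add: minor_gcd_def)
  also have "\<dots> = (\<Prod>j\<in>{1..n}. inv_factor n x j)"
    by (rule minor_gcd_eq_prod_inv_factor[OF x]) simp
  finally have "(\<Prod>j\<in>{i..n}. inv_factor n x j) dvd normalize (det (shifted_matrix n x))"
    using i by (simp add: prod_dvd_prod_subset)
  then show ?thesis using minor_gcd_eq_prod_inv_factor[OF x, of i] i by simp
qed

text \<open>Near \<open>x0\<close> the gcd has the multiple \<open>U x\<close> with coefficients
  polynomial in \<open>x\<close> and degree at most that of the gcd at \<open>x0\<close>;
  \<open>h\<close> is its top coefficient. Both semicontinuity of the degree and regularity of the
  coefficients are read off from this.\<close>

lemma minor_gcd_local:
  assumes i: "i \<in> {1..n}" and x0: "x0 \<in> carrier_mat n n"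
  shows "\<exists>h\<in>polynomial_functions (matrix_space n). \<exists>U. poly_family (matrix_space n) U \<and> h x0 \<noteq> 0 \<and>
    (\<forall>x\<in>carrier_mat n n. degree (U x) \<le> degree (minor_gcd n x0 i) \<and>
      coeff (U x) (degree (minor_gcd n x0 i)) = h x \<and> minor_gcd n x i dvd U x)"
proof -
  let ?A = "matrix_space n"
  define k where "k = n + 1 - i"
  define K where "K = {(I, J). I \<subseteq> {..<n} \<and> J \<subseteq> {..<n} \<and> card I = k \<and> card J = k}"
  define f where "f x = (\<lambda>(I, J). det (submatrix (shifted_matrix n x) I J))" for x
  have K: "finite K"
    by (rule finite_subset[of _ "Pow {..<n} \<times> Pow {..<n}"]) (auto simp: K_def)
  have "minors n k (shifted_matrix n x) = f x ` K" for x
    unfolding minors_def K_def f_def by (auto simp: image_iff)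
  then have gcd: "minor_gcd n x i = Gcd (f x ` K)" for x
    using i by (simp add: minor_gcd_def k_def)
  obtain a where a: "Gcd (f x0 ` K) = (\<Sum>s\<in>K. a s * f x0 s)" using Gcd_image_bezout[OF K] by blast
  \<comment> \<open>The Bezout coefficients are frozen at \<open>x0\<close>. For other
    \<open>x\<close> the sum is still a combination of the minors of \<open>x - t\<close>, hence a
    multiple of their gcd.\<close>
  define W where "W x = (\<Sum>s\<in>K. a s * f x s)" for x
  have f_fam: "poly_family ?A (\<lambda>x. f x s)" and f_deg: "x \<in> carrier_mat n n \<Longrightarrow> degree (f x s) \<le> k"
    if "s \<in> K" for s x
    using that shifted_minor by (auto simp: K_def f_def)
  have W_fam: "poly_family ?A W"
    unfolding W_def by (intro poly_family_sum poly_family_mult poly_family_const f_fam)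
  define D where "D = (\<Sum>s\<in>K. degree (a s)) + k"
  have W_deg: "degree (W x) \<le> D" if x: "x \<in> carrier_mat n n" for x
    unfolding W_def
  proof (rule degree_sum_le[OF K])
    fix s assume s: "s \<in> K"
    have "degree (a s * f x s) \<le> degree (a s) + degree (f x s)" by (rule degree_mult_le)
    also have "\<dots> \<le> D" unfolding D_def
      using member_le_sum[OF s, of "\<lambda>s. degree (a s)"] K f_deg[OF s x] by (intro add_mono) auto
    finally show "degree (a s * f x s) \<le> D" .
  qed
  \<comment> \<open>The determinant is a suitable second polynomial: every gcd in question divides
    it, and its degree is \<open>n\<close> throughout.\<close>
  have E_fam: "poly_family ?A (\<lambda>x. det (shifted_matrix n x))"
    by (rule poly_family_det[OF shifted_matrix_carrier poly_family_shifted_entry])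
  have W0: "W x0 = minor_gcd n x0 i" unfolding gcd a W_def ..
  have dvd_det: "minor_gcd n x0 i dvd det (shifted_matrix n x0)" by (rule minor_gcd_dvd_det[OF x0 i])
  have "degree (minor_gcd n x0 i) \<le> n"
    using dvd_imp_degree_le[OF dvd_det] det_shifted_matrix[OF x0] by simp
  moreover have "minor_gcd n x0 i \<noteq> 0" using dvd_det det_shifted_matrix(2)[OF x0] by auto
  ultimately have "\<exists>h\<in>polynomial_functions ?A. \<exists>U. poly_family ?A U \<and> h x0 \<noteq> 0 \<and>
    (\<forall>x\<in>points ?A. degree (U x) \<le> degree (minor_gcd n x0 i) \<and> coeff (U x) (degree (minor_gcd n x0 i)) = h x \<and>
      (\<forall>G. G dvd W x \<longrightarrow> G dvd det (shifted_matrix n x) \<longrightarrow> G dvd U x))"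
    using W_deg det_shifted_matrix x0 W0
    by (intro local_elimination[OF W_fam E_fam, of D n]) (simp_all add: points_matrix_space)
  then obtain h U where h: "h \<in> polynomial_functions ?A" "poly_family ?A U" "h x0 \<noteq> 0"
    and U: "\<And>x. x \<in> carrier_mat n n \<Longrightarrow> degree (U x) \<le> degree (minor_gcd n x0 i) \<and>
      coeff (U x) (degree (minor_gcd n x0 i)) = h x \<and>
      (\<forall>G. G dvd W x \<longrightarrow> G dvd det (shifted_matrix n x) \<longrightarrow> G dvd U x)"
    unfolding points_matrix_space by blast
  have "minor_gcd n x i dvd W x" for x
    unfolding gcd W_def by (intro dvd_sum dvd_mult Gcd_dvd) auto
  then have "minor_gcd n x i dvd U x" if "x \<in> carrier_mat n n" for x
    using U[OF that] minor_gcd_dvd_det[OF that i] by blast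
  then show ?thesis using h U by (intro bexI[of _ h] exI[of _ U]) auto
qed

text \<open>Where \<open>h\<close> does not vanish, the gcd divides the nonzero polynomial
  \<open>U x\<close>, so its degree is at most the one at \<open>x0\<close>.\<close>

lemma openin_degree_minor_gcd_less:
  assumes i: "i \<in> {1..n}"
  shows "openin (zariski (matrix_space n)) {x \<in> carrier_mat n n. degree (minor_gcd n x i) < e}"
proof (subst openin_subopen, intro ballI)
  fix x0 assume "x0 \<in> {x \<in> carrier_mat n n. degree (minor_gcd n x i) < e}"
  then have x0: "x0 \<in> carrier_mat n n" "degree (minor_gcd n x0 i) < e" by auto
  obtain h U where h: "h \<in> polynomial_functions (matrix_space n)" "h x0 \<noteq> 0"
    and U: "\<And>x. x \<in> carrier_mat n n \<Longrightarrow> degree (U x) \<le> degree (minor_gcd n x0 i) \<and>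
      coeff (U x) (degree (minor_gcd n x0 i)) = h x \<and> minor_gcd n x i dvd U x"
    using minor_gcd_local[OF i x0(1)] by blast
  have "degree (minor_gcd n x i) < e" if x: "x \<in> carrier_mat n n" "h x \<noteq> 0" for x
  proof -
    have "U x \<noteq> 0" using U[OF x(1)] x(2) by auto
    then have "degree (minor_gcd n x i) \<le> degree (U x)" using U[OF x(1)] by (intro dvd_imp_degree_le) auto
    then show ?thesis using U[OF x(1)] x0(2) by simp
  qed
  then show "\<exists>T. openin (zariski (matrix_space n)) T \<and> x0 \<in> T \<and>
      T \<subseteq> {x \<in> carrier_mat n n. degree (minor_gcd n x i) < e}"
    using openin_zariski_nonzero[OF h(1)] x0 h(2)
    by (intro exI[of _ "{x \<in> carrier_mat n n. h x \<noteq> 0}"]) (auto simp: points_matrix_space)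
qed

lemma degree_minor_gcd_eq_sum:
  assumes x: "x \<in> carrier_mat n n" and i: "i \<in> {1..Suc n}"
  shows "degree (minor_gcd n x i) = (\<Sum>j\<in>{i..n}. degree (inv_factor n x j))"
proof -
  have "inv_factor n x j \<noteq> 0" if "j \<in> {i..n}" for j
    using lead_coeff_inv_factor[OF x, of j] that i by auto
  then show ?thesis unfolding minor_gcd_eq_prod_inv_factor[OF x i]
    by (intro degree_prod_eq_sum_degree) auto
qed

text \<open>Prescribing the degrees of the invariant factors amounts to prescribing those of the
  gcds, which are the tail sums of \<open>b\<close>. Each equality splits into an open upper bound
  and a closed lower bound; trace zero is a further closed condition.\<close>

lemma variety_sheet: "variety (matrix_space n) (sheet n b)"
proof -
  let ?A = "matrix_space n" and ?d = "\<lambda>i. \<Sum>j\<in>{i..n}. b j"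
  \<comment> \<open>The explicit \<open>carrier_mat n n\<close> matters for \<open>n = 0\<close>,
    where the intersection over the empty index set is the whole type.\<close>
  define U where "U = carrier_mat n n \<inter> (\<Inter>i\<in>{1..n}. {x \<in> carrier_mat n n. degree (minor_gcd n x i) < Suc (?d i)})"
  define C where "C = {x \<in> carrier_mat n n. mat_trace n x = 0} \<inter>
    (\<Inter>i\<in>{1..n}. carrier_mat n n - {x \<in> carrier_mat n n. degree (minor_gcd n x i) < ?d i})"
  have top: "openin (zariski ?A) (carrier_mat n n)"
    using openin_topspace[of "zariski ?A"] by (simp add: topspace_zariski points_matrix_space)
  have U: "openin (zariski ?A) U"
  proof (cases "n = 0")
    case True
    then show ?thesis using top by (simp add: U_def)
  next
    case False
    then show ?thesis unfolding U_def
      by (intro openin_Int top openin_Inter) (auto intro: openin_degree_minor_gcd_less)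
  qed
  have "(\<lambda>x. mat_trace n x) \<in> polynomial_functions ?A"
    unfolding mat_trace_def
    by (intro polynomial_functions_sum polynomial_functions.coord) (auto simp: matrix_space_def)
  from closedin_zariski_zero[OF this]
  have tr: "closedin (zariski ?A) {x \<in> carrier_mat n n. mat_trace n x = 0}" by (simp add: points_matrix_space)
  have ge: "closedin (zariski ?A) (carrier_mat n n - {x \<in> carrier_mat n n. degree (minor_gcd n x i) < ?d i})"
    if "i \<in> {1..n}" for i
    using closedin_diff[OF closedin_topspace openin_degree_minor_gcd_less[OF that]]
    by (simp add: topspace_zariski points_matrix_space)
  have C: "closedin (zariski ?A) C"
  proof (cases "n = 0")
    case True
    then show ?thesis using tr by (simp add: C_def)
  next
    case False
    then show ?thesis unfolding C_def
      by (intro closedin_Int tr closedin_Inter) (use ge in auto)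
  qed
  have "x \<in> sheet n b \<longleftrightarrow> x \<in> U \<inter> C" for x
  proof (cases "x \<in> carrier_mat n n")
    case True
    have "(\<forall>i\<in>{1..n}. degree (inv_factor n x i) = b i) \<longleftrightarrow> (\<forall>i\<in>{1..n}. degree (minor_gcd n x i) = ?d i)"
    proof
      assume "\<forall>i\<in>{1..n}. degree (inv_factor n x i) = b i"
      then show "\<forall>i\<in>{1..n}. degree (minor_gcd n x i) = ?d i"
        using degree_minor_gcd_eq_sum[OF True] by (auto intro!: sum.cong)
    next
      assume r: "\<forall>i\<in>{1..n}. degree (minor_gcd n x i) = ?d i"
      show "\<forall>i\<in>{1..n}. degree (inv_factor n x i) = b i"
      proof
        fix i assume i: "i \<in> {1..n}"
        have next_eq: "(\<Sum>j\<in>{Suc i..n}. degree (inv_factor n x j)) = ?d (Suc i)"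
        proof (cases "i = n")
          case False
          then show ?thesis using r i degree_minor_gcd_eq_sum[OF True, of "Suc i"] by simp
        qed simp
        have "(\<Sum>j\<in>{i..n}. degree (inv_factor n x j)) = ?d i"
          using r i degree_minor_gcd_eq_sum[OF True, of i] by simp
        then show "degree (inv_factor n x i) = b i"
          using next_eq i by (simp add: sum.atLeast_Suc_atMost)
      qed
    qed
    also have "\<dots> \<longleftrightarrow> (\<forall>i\<in>{1..n}. degree (minor_gcd n x i) < Suc (?d i) \<and> \<not> degree (minor_gcd n x i) < ?d i)"
      by (intro ball_cong refl) linarith
    finally show ?thesis using True by (simp add: sheet_def sl_iff U_def C_def) blast
  next
    case False
    then show ?thesis using sheet_carrier by (auto simp: U_def)
  qed
  then have "sheet n b = U \<inter> C" by blast
  then show ?thesis unfolding variety_def using affine_space_matrix_space U C by blast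
qed

text \<open>On the sheet the degree of the gcd is constant. Where \<open>h\<close> is nonzero,
  \<open>U x\<close> has that degree too and is thus a scalar multiple of the monic gcd; the scalar
  is \<open>h x\<close>, so the coefficients are those of \<open>U x\<close> divided by
  \<open>h x\<close>.\<close>

lemma regular_coeff_minor_gcd:
  assumes b: "is_partition n b" and i: "i \<in> {1..Suc n}"
  shows "regular_on (matrix_space n) (sheet n b) (\<lambda>x. coeff (minor_gcd n x i) k)"
proof (cases "i = Suc n")
  case True
  have "regular_on (matrix_space n) (sheet n b) (\<lambda>x. coeff 1 k)"
    by (rule regular_on_const) (use sheet_carrier in \<open>auto simp: points_matrix_space\<close>)
  then show ?thesis using True by (simp add: minor_gcd_def)
next
  case False
  then have i': "i \<in> {1..n}" using i by auto
  have X: "sheet n b \<subseteq> points (matrix_space n)" using sheet_carrier by (auto simp: points_matrix_space)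
  show ?thesis
  proof (rule regular_on_local_quotient[OF X])
    fix x0 assume x0: "x0 \<in> sheet n b"
    let ?d = "degree (minor_gcd n x0 i)"
    obtain h U where h: "h \<in> polynomial_functions (matrix_space n)" "h x0 \<noteq> 0"
      and U_fam: "poly_family (matrix_space n) U"
      and U: "\<And>x. x \<in> carrier_mat n n \<Longrightarrow> degree (U x) \<le> ?d \<and> coeff (U x) ?d = h x \<and> minor_gcd n x i dvd U x"
      using minor_gcd_local[OF i' sheet_carrier[OF x0]] by blast
    have "coeff (minor_gcd n x i) k = coeff (U x) k / h x" if x: "x \<in> sheet n b" "h x \<noteq> 0" for x
    proof -
      note xc = sheet_carrier[OF x(1)]
      have deg: "degree (minor_gcd n x i) = ?d"
        unfolding degree_minor_gcd_eq_sum[OF xc i] degree_minor_gcd_eq_sum[OF sheet_carrier[OF x0] i]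
        using degree_inv_factor_sheet[OF b x(1)] degree_inv_factor_sheet[OF b x0] i
        by (intro sum.cong) auto
      have lc: "lead_coeff (minor_gcd n x i) = 1"
        unfolding minor_gcd_eq_prod_inv_factor[OF xc i]
        by (rule lead_coeff_prod_monic, rule lead_coeff_inv_factor[OF xc]) (use i in auto)
      obtain r where r: "U x = minor_gcd n x i * r" using U[OF xc] by (elim conjE dvdE) blast
      have "U x \<noteq> 0" using U[OF xc] x(2) by auto
      then have "degree (U x) = ?d + degree r" using r deg by (auto simp: degree_mult_eq)
      then have "degree r = 0" using U[OF xc] by simp
      then obtain c where c: "r = [:c:]" by (rule degree_eq_zeroE)
      have "U x = smult c (minor_gcd n x i)" using r c by simp
      moreover from this have "h x = c" using U[OF xc] lc deg by simp
      ultimately show ?thesis using x(2) by simp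
    qed
    then show "\<exists>g h. regular_on (matrix_space n) (sheet n b) g \<and> regular_on (matrix_space n) (sheet n b) h \<and>
        h x0 \<noteq> 0 \<and> (\<forall>y\<in>sheet n b. h y \<noteq> 0 \<longrightarrow> coeff (minor_gcd n y i) k = g y / h y)"
      using U_fam h regular_on_polynomial[OF X h(1)] regular_on_polyfun[OF _ X, of "\<lambda>x. coeff (U x) k"]
      unfolding poly_family_def by (intro exI[of _ "\<lambda>x. coeff (U x) k"] exI[of _ h]) auto
  qed
qed

text \<open>Long division from the top. As \<open>Q\<close> is monic of degree \<open>m\<close>, the
  coefficient of \<open>R * Q\<close> at \<open>m + k\<close> is that of \<open>R\<close> at
  \<open>k\<close> plus products of lower coefficients of \<open>Q\<close> with higher coefficients
  of \<open>R\<close>. Constant degree of \<open>Q\<close> gives one recursion for all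
  \<open>x\<close>, without denominators.\<close>

lemma regular_coeff_exact_quotient:
  assumes X: "X \<subseteq> points A"
    and eq: "\<And>x. x \<in> X \<Longrightarrow> P x = R x * Q x"
    and Q: "\<And>x. x \<in> X \<Longrightarrow> lead_coeff (Q x) = 1" "\<And>x. x \<in> X \<Longrightarrow> degree (Q x) = m"
    and R: "\<And>x. x \<in> X \<Longrightarrow> degree (R x) \<le> K"
    and P_reg: "\<And>k. regular_on A X (\<lambda>x. coeff (P x) k)"
    and Q_reg: "\<And>k. regular_on A X (\<lambda>x. coeff (Q x) k)"
  shows "regular_on A X (\<lambda>x. coeff (R x) k)"
proof -
  \<comment> \<open>Descending induction on \<open>k\<close>: above \<open>K\<close> the
    coefficients are zero, each \<open>s\<close> reaches one exponent lower, and
    \<open>s = Suc K\<close> covers all.\<close>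
  have "\<forall>k. K < k + s \<longrightarrow> regular_on A X (\<lambda>x. coeff (R x) k)" for s
  proof (induction s)
    case 0
    show ?case
    proof (intro allI impI)
      fix k assume "K < k + 0"
      then have "0 = coeff (R x) k" if "x \<in> X" for x using R[OF that] by (simp add: coeff_eq_0)
      then show "regular_on A X (\<lambda>x. coeff (R x) k)"
        by (rule regular_on_cong[OF X regular_on_const[OF X]])
    qed
  next
    case (Suc s)
    show ?case
    proof (intro allI impI)
      fix k assume k: "K < k + Suc s"
      have "regular_on A X (\<lambda>x. coeff (P x) (m + k) - (\<Sum>j<m. coeff (Q x) j * coeff (R x) (k + (m - j))))"
        by (intro regular_on_diff[OF X] P_reg regular_on_sum[OF X] regular_on_mult[OF X] Q_reg)
           (use Suc k in auto)
      then show "regular_on A X (\<lambda>x. coeff (R x) k)"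
      proof (rule regular_on_cong[OF X])
        fix x assume x: "x \<in> X"
        have "coeff (P x) (m + k) = (\<Sum>j\<le>m + k. coeff (Q x) j * coeff (R x) (m + k - j))"
          unfolding eq[OF x] by (subst mult.commute) (rule coeff_mult)
        also have "\<dots> = (\<Sum>j\<in>{..m}. coeff (Q x) j * coeff (R x) (m + k - j))"
          by (rule sum.mono_neutral_right) (use Q(2)[OF x] in \<open>auto simp: coeff_eq_0\<close>)
        also have "\<dots> = (\<Sum>j<m. coeff (Q x) j * coeff (R x) (m + k - j)) + coeff (R x) k"
          using Q(1)[OF x] Q(2)[OF x] by (simp add: lessThan_Suc_atMost[symmetric])
        also have "(\<Sum>j<m. coeff (Q x) j * coeff (R x) (m + k - j)) =
            (\<Sum>j<m. coeff (Q x) j * coeff (R x) (k + (m - j)))"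
          by (intro sum.cong) (auto intro!: arg_cong2[where f = "(*)"] arg_cong[where f = "coeff (R x)"])
        finally show "coeff (P x) (m + k) - (\<Sum>j<m. coeff (Q x) j * coeff (R x) (k + (m - j))) = coeff (R x) k"
          by simp
      qed
    qed
  qed
  from this[of "Suc K"] show ?thesis by simp
qed

lemma regular_coeff_inv_factor:
  assumes b: "is_partition n b" and i: "i \<in> {1..Suc n}"
  shows "regular_on (matrix_space n) (sheet n b) (\<lambda>x. coeff (inv_factor n x i) k)"
proof (cases "i = Suc n")
  case True
  have "regular_on (matrix_space n) (sheet n b) (\<lambda>x. coeff 1 k)"
    by (rule regular_on_const) (use sheet_carrier in \<open>auto simp: points_matrix_space\<close>)
  then show ?thesis using True by (simp add: inv_factor_Suc_n)
next
  case False
  then have i': "i \<in> {1..n}" "Suc i \<in> {1..Suc n}" using i by auto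
  show ?thesis
  proof (rule regular_coeff_exact_quotient[where P = "\<lambda>x. minor_gcd n x i" and Q = "\<lambda>x. minor_gcd n x (Suc i)"
        and m = "\<Sum>j\<in>{Suc i..n}. b j" and K = "b i"])
    show "sheet n b \<subseteq> points (matrix_space n)" using sheet_carrier by (auto simp: points_matrix_space)
    show "regular_on (matrix_space n) (sheet n b) (\<lambda>x. coeff (minor_gcd n x i) k)"
      "regular_on (matrix_space n) (sheet n b) (\<lambda>x. coeff (minor_gcd n x (Suc i)) k)" for k
      using regular_coeff_minor_gcd[OF b i] regular_coeff_minor_gcd[OF b i'(2)] by auto
    fix x assume x: "x \<in> sheet n b"
    note xc = sheet_carrier[OF x]
    show "minor_gcd n x i = inv_factor n x i * minor_gcd n x (Suc i)"
      unfolding minor_gcd_eq_prod_inv_factor[OF xc i] minor_gcd_eq_prod_inv_factor[OF xc i'(2)]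
      using i' by (simp add: prod.atLeast_Suc_atMost)
    show "lead_coeff (minor_gcd n x (Suc i)) = 1"
      unfolding minor_gcd_eq_prod_inv_factor[OF xc i'(2)]
      by (rule lead_coeff_prod_monic, rule lead_coeff_inv_factor[OF xc]) (use i in auto)
    show "degree (minor_gcd n x (Suc i)) = (\<Sum>j\<in>{Suc i..n}. b j)"
      unfolding degree_minor_gcd_eq_sum[OF xc i'(2)]
      using degree_inv_factor_sheet[OF b x] i by (intro sum.cong) auto
    show "degree (inv_factor n x i) \<le> b i" using degree_inv_factor_sheet[OF b x i] by simp
  qed
qed

lemma regular_coeff_inv_factor_ratio:
  assumes b: "is_partition n b" and i: "i \<in> {1..n}"
  shows "regular_on (matrix_space n) (sheet n b) (\<lambda>x. coeff (inv_factor_ratio n x i) k)"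
proof (rule regular_coeff_exact_quotient[where P = "\<lambda>x. inv_factor n x i" and Q = "\<lambda>x. inv_factor n x (i + 1)"
      and m = "b (i + 1)" and K = "b i"])
  have i': "i \<in> {1..Suc n}" "i + 1 \<in> {1..Suc n}" using i by auto
  show "sheet n b \<subseteq> points (matrix_space n)" using sheet_carrier by (auto simp: points_matrix_space)
  show "regular_on (matrix_space n) (sheet n b) (\<lambda>x. coeff (inv_factor n x i) k)"
    "regular_on (matrix_space n) (sheet n b) (\<lambda>x. coeff (inv_factor n x (i + 1)) k)" for k
    using regular_coeff_inv_factor[OF b i'(1)] regular_coeff_inv_factor[OF b i'(2)] by auto
  fix x assume x: "x \<in> sheet n b"
  note xc = sheet_carrier[OF x]
  show "inv_factor n x i = inv_factor_ratio n x i * inv_factor n x (i + 1)"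
    by (rule inv_factor_eq_ratio_mult[OF xc i])
  show "lead_coeff (inv_factor n x (i + 1)) = 1" by (rule lead_coeff_inv_factor[OF xc]) simp
  show "degree (inv_factor n x (i + 1)) = b (i + 1)" by (rule degree_inv_factor_sheet[OF b x i'(2)])
  show "degree (inv_factor_ratio n x i) \<le> b i"
    unfolding family_poly_sheet_quotient[OF b x i, symmetric] degree_family_poly by simp
qed

section \<open>The geometric quotient\<close>

lemma polynomial_functions_family_coord:
  "k \<in> family_index n b \<Longrightarrow> (\<lambda>c. c k) \<in> polynomial_functions (family_space n b)"
  by (cases k, rule polynomial_functions.coord) (auto simp: family_space_def)

lemma variety_trace_zero_families: "variety (family_space n b) (trace_zero_families n b)"
proof -
  let ?A = "family_space n b"
  \<comment> \<open>Viete's formula in coordinates: the coefficient just below the leading one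
    carries the root sum. Indices with a constant polynomial are left out, as they have no
    coordinate and root sum 0.\<close>
  let ?F = "\<lambda>c. \<Sum>i\<in>{i \<in> {1..n}. b (i + 1) < b i}. - of_nat i * c (i, b i - b (i + 1) - 1) :: complex"
  have "?F \<in> polynomial_functions ?A"
    by (intro polynomial_functions_sum polynomial_functions.mult polynomial_functions.const
          polynomial_functions_family_coord) (auto simp: family_index_def)
  then have C: "closedin (zariski ?A) {c \<in> points ?A. ?F c = 0}" by (rule closedin_zariski_zero)
  have rs: "of_nat i * root_sum (family_poly b c i) =
      (if b (i + 1) < b i then - of_nat i * c (i, b i - b (i + 1) - 1) else 0)" for i c
  proof (cases "b (i + 1) < b i")
    case True
    then have "b i - b (i + 1) - 1 < b i - b (i + 1)" "b i - b (i + 1) \<noteq> 0" by auto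
    then show ?thesis
      using True root_sum_monic[OF lead_coeff_family_poly, of b c i]
      unfolding degree_family_poly coeff_family_poly by simp
  next
    case False
    then show ?thesis
      using root_sum_monic[OF lead_coeff_family_poly, of b c i] unfolding degree_family_poly by simp
  qed
  have "(\<Sum>i = 1..n. of_nat i * root_sum (family_poly b c i)) = ?F c" for c
    unfolding rs by (rule sum.inter_filter[symmetric]) simp
  then have "trace_zero_families n b = {c \<in> points ?A. ?F c = 0}"
    by (simp add: trace_zero_families_def)
  then have "trace_zero_families n b = points ?A \<inter> {c \<in> points ?A. ?F c = 0}" by blast
  moreover have "openin (zariski ?A) (points ?A)"
    using openin_topspace[of "zariski ?A"] by (simp add: topspace_zariski)
  ultimately show ?thesis
    unfolding variety_def using affine_space_family_space C by blast
qed

lemma poly_family_family_poly: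
  assumes "i \<in> {1..n}" shows "poly_family (family_space n b) (\<lambda>c. family_poly b c i)"
  unfolding poly_family_def coeff_family_poly
proof
  fix k
  show "polyfun (family_space n b) (\<lambda>c. if k < b i - b (i + 1) then c (i, k)
      else if k = b i - b (i + 1) then 1 else 0)"
  proof (cases "k < b i - b (i + 1)")
    case True
    then have "(i, k) \<in> family_index n b" using assms by (simp add: family_index_def)
    then have "(\<lambda>c. c (i, k)) \<in> polynomial_functions (family_space n b)"
      by (rule polynomial_functions_family_coord)
    then show ?thesis using True by (simp add: polyfun_polynomial)
  qed (simp add: polyfun_const)
qed

text \<open>The block boundaries depend on \<open>b\<close> only and do not move with
  \<open>c\<close>, so every entry is a constant or minus a fixed coefficient of one of the
  polynomials.\<close>

lemma polyfun_block_companion: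
  assumes "\<And>k. k \<in> set ks \<Longrightarrow> poly_family A (\<lambda>c. q c k)"
    and "i < (\<Sum>k\<leftarrow>ks. b k)" "j < (\<Sum>k\<leftarrow>ks. b k)"
  shows "polyfun A (\<lambda>c. block_companion b (q c) ks $$ (i, j))"
  using assms
proof (induction ks arbitrary: i j)
  case (Cons k ks)
  let ?N = "\<Sum>k\<leftarrow>ks. b k"
  have dim: "dim_row (companion (b k) p) = b k" "dim_col (companion (b k) p) = b k"
    "dim_row (block_companion b p' ks) = ?N" "dim_col (block_companion b p' ks) = ?N" for p p'
    using carrier_matD[OF companion_carrier] carrier_matD[OF block_companion_carrier] by auto
  have c: "polyfun A (\<lambda>c. - coeff (q c k) i)" for i
    using polyfun_mult[OF polyfun_const[of A "-1"], of "\<lambda>c. coeff (q c k) i"] Cons.prems(1)[of k]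
    by (simp add: poly_family_def)
  have comp: "polyfun A (\<lambda>c. companion (b k) (q c k) $$ (i, j))" if "i < b k" "j < b k" for i j
    using that c by (cases "Suc j = b k") (simp_all add: companion_def polyfun_const)
  have ij: "i < b k + ?N" "j < b k + ?N" using Cons.prems by auto
  have e: "block_companion b (q c) (k # ks) $$ (i, j) =
      (if i < b k then if j < b k then companion (b k) (q c k) $$ (i, j) else 0
       else if j < b k then 0 else block_companion b (q c) ks $$ (i - b k, j - b k))" for c
    using ij by (auto simp: block_companion_Cons dim)
  show ?case
    unfolding e using comp[of i j] Cons.IH[of "i - b k" "j - b k"] Cons.prems(1) ij
    by (cases "i < b k"; cases "j < b k") (simp_all add: polyfun_const)
qed simp

theorem proposition3p2:
  fixes n :: nat and b :: "nat \<Rightarrow> nat"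
  assumes "n \<ge> 2" and "is_partition n b"
  shows "geometric_quotient (SL n) (adjoint_action n (sheet n b))
           (matrix_space n) (sheet n b)
           (family_space n b) (trace_zero_families n b)
           (sheet_quotient n b)"
proof (rule geometric_quotient_of_section[OF variety_sheet variety_trace_zero_families group_action_sheet])
  let ?X = "sheet n b" and ?Y = "trace_zero_families n b"
  note b = assms(2)
  have X: "?X \<subseteq> points (matrix_space n)" by (rule variety_subset_points[OF variety_sheet])
  have Y: "?Y \<subseteq> points (family_space n b)" by (rule variety_subset_points[OF variety_trace_zero_families])
  show "variety_morphism (matrix_space n) ?X (family_space n b) ?Y (sheet_quotient n b)"
  proof (rule variety_morphismI[OF X Y sheet_quotient_in_trace_zero[OF b]])
    fix f assume "f \<in> coords (family_space n b)"
    then obtain i j where f: "f = (\<lambda>c. c (i, j))" and k: "(i, j) \<in> family_index n b"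
      by (auto simp: family_space_def)
    then have "i \<in> {1..n}" by (simp add: family_index_def)
    from regular_coeff_inv_factor_ratio[OF b this, of j]
    show "regular_on (matrix_space n) ?X (\<lambda>x. f (sheet_quotient n b x))"
      using k by (simp add: f sheet_quotient_def)
  qed
  show "variety_morphism (family_space n b) ?Y (matrix_space n) ?X (sheet_section n b)"
  proof (rule variety_morphismI[OF Y X sheet_section_in_sheet[OF b]])
    fix f assume "f \<in> coords (matrix_space n)"
    then obtain i j where f: "f = (\<lambda>x. x $$ (i, j))" and ij: "i < n" "j < n"
      by (auto simp: matrix_space_def)
    have "polyfun (family_space n b) (\<lambda>c. block_companion b (family_prod n b c) [1..<Suc n] $$ (i, j))"
    proof (rule polyfun_block_companion)
      show "poly_family (family_space n b) (\<lambda>c. family_prod n b c k)" if "k \<in> set [1..<Suc n]" for k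
        unfolding family_prod_def by (intro poly_family_prod poly_family_family_poly) (use that in auto)
    qed (use ij sum_list_partition[OF b] in auto)
    then show "regular_on (family_space n b) ?Y (\<lambda>c. f (sheet_section n b c))"
      unfolding f sheet_section_def by (rule regular_on_polyfun[OF _ Y])
  qed
  show "sheet_quotient n b (sheet_section n b c) = c" if "c \<in> ?Y" for c
    by (rule sheet_quotient_section[OF b]) (use that Y in auto)
  \<comment> \<open>Fibre and orbit are both the set of points of the sheet with the invariant
    factors of \<open>x\<close>.\<close>
  show "{y \<in> ?X. sheet_quotient n b y = sheet_quotient n b x} =
      orbit (SL n) (adjoint_action n ?X) x" if x: "x \<in> ?X" for x
    using sheet_quotient_eq_iff[OF b x] orbit_sheet[OF _ x] assms(1) by auto
qed

end
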